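(* For every starting configuration $\omega\in\mathcal S$, almost surely $$1.646 < \liminf_{n\to\infty}\ \mathrm{spd}(n)\ \le\ \limsup_{n\to\infty}\ \mathrm{spd}(n) < 2.92 .$$
   Context: Let $\mathcal S\subset\{0,1\}^{\mathbb Z}$ be the set of bi-infinite $0$-$1$ sequences that have a leftmost $1$. Let $\{N(j,t):t\ge 0\}_{j\in\mathbb Z}$ be independent rate-$1$ Poisson counting processes ("clocks"). Starting from $\omega\in\mathcal S$, define the continuous-time Markov chain $(\omega_t)_{t\ge 0}$, $\omega_0=\omega$: whenever the clock at site $s$ rings (i.e. $N(s,\cdot)$ increases) at time $t$, if $\omega_{t^-}(s)=1$ then the bits at $s$ and at all sites to the right of $s$ are flipped ($0\leftrightarrow1$); if $\omega_{t^-}(s)=0$ nothing happens. (If $i$ is the position of the leftmost $1$ of $\omega$, for each $j>i$ the restriction to the sites $\{i,\dots,j\}$ is a well-defined finite-state chain, these restrictions are consistent in $j$, and $(\omega_t)$ is their inverse limit; sites left of $i$ stay $0$.) Let $\Xi$ be the set of $0$-$1$ sequences $\mathbf x=(\mathbf x(0),\mathbf x(1),\dots)$ with $\mathbf x(0)=1$, and let $\mathrm{ones}(\mathbf x)=\inf\{j\ge1:\mathbf x(j)=0\}$ be the number of leading $1$'s of $\mathbf x$. Put $\sigma_0=0$ and let $i_0$ be the position of the leftmost $1$ of $\omega$. Recursively for $n\ge1$: $\sigma_n$ is the first time after $\sigma_{n-1}$ at which $N(i_{n-1},\cdot)$ increases; for $\sigma_{n-1}\le t<\sigma_n$, $X_t\in\Xi$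 is given by $X_t(j)=\omega_t(i_{n-1}+j)$, $j\ge0$; $\mathrm{jump}_n=\mathrm{ones}(X_{\sigma_n^-})$ (left limit at $\sigma_n$); and $i_n=i_{n-1}+\mathrm{jump}_n$. Thus $i_n$ is the position of the leftmost $1$ at time $\sigma_n$. The average speed up to time $\sigma_n$ is $$\mathrm{spd}(n)=\sigma_n^{-1}\sum_{j=1}^n\mathrm{jump}_j .$$ *)

theory Defs
  imports "HOL-Probability.Probability"
begin

definition counting_path :: "(real \<Rightarrow> nat) \<Rightarrow> bool" where
  "counting_path c \<longleftrightarrow> c 0 = 0 \<and> mono_on {0..} c \<and> (\<forall>t\<ge>0. continuous (at_right t) c)"

text \<open>
  The sequence \<open>T\<close> in the last clause is infinite; since independence of a family only concerns its
  finite subfamilies, this is independence of the increments over any finite partition.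
\<close>

definition poisson_process :: "real \<Rightarrow> 'a measure \<Rightarrow> (real \<Rightarrow> 'a \<Rightarrow> nat) \<Rightarrow> bool" where
  "poisson_process r M N \<longleftrightarrow>
     (\<forall>t\<ge>0. N t \<in> measurable M (count_space UNIV)) \<and>
     (AE x in M. counting_path (\<lambda>t. N t x)) \<and>
     (\<forall>s t. 0 \<le> s \<longrightarrow> s < t \<longrightarrow>
        distr M (count_space UNIV) (\<lambda>x. N t x - N s x) = measure_pmf (poisson_pmf (r * (t - s)))) \<and>
     (\<forall>T. 0 \<le> T 0 \<longrightarrow> incseq T \<longrightarrow>
        prob_space.indep_vars M (\<lambda>k::nat. count_space UNIV)
          (\<lambda>k x. N (T (Suc k)) x - N (T k) x) UNIV)"

text \<open>Independence is that of the whole paths, as random elements of a product space.\<close>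

definition independent_clocks :: "'a measure \<Rightarrow> (int \<Rightarrow> real \<Rightarrow> 'a \<Rightarrow> nat) \<Rightarrow> bool" where
  "independent_clocks M N \<longleftrightarrow>
     (\<forall>j. poisson_process 1 M (N j)) \<and>
     prob_space.indep_vars M (\<lambda>j. \<Pi>\<^sub>M t\<in>{0..}. count_space UNIV) (\<lambda>j x. \<lambda>t\<in>{0..}. N j t x) UNIV"

definition rings :: "(real \<Rightarrow> nat) \<Rightarrow> real \<Rightarrow> bool" where
  "rings c t \<longleftrightarrow> 0 < t \<and> (\<forall>u\<in>{0..<t}. c u < c t)"

definition next_ring :: "(real \<Rightarrow> nat) \<Rightarrow> real \<Rightarrow> real" where
  "next_ring c s = Inf {t. s < t \<and> rings c t}"

definition is_leftmost :: "(int \<Rightarrow> bool) \<Rightarrow> int \<Rightarrow> bool" where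
  "is_leftmost w i \<longleftrightarrow> w i \<and> (\<forall>j<i. \<not> w j)"

definition configurations :: "(int \<Rightarrow> bool) set" where
  "configurations = {w. \<exists>i. is_leftmost w i}"

definition leftmost :: "(int \<Rightarrow> bool) \<Rightarrow> int" where
  "leftmost w = (THE i. is_leftmost w i)"

definition flip :: "int \<Rightarrow> (int \<Rightarrow> bool) \<Rightarrow> (int \<Rightarrow> bool)" where
  "flip s \<eta> = (if \<eta> s then (\<lambda>k. if s \<le> k then \<not> \<eta> k else \<eta> k) else \<eta>)"

definition ringing_sites :: "(int \<Rightarrow> real \<Rightarrow> nat) \<Rightarrow> int set \<Rightarrow> real \<Rightarrow> int set" where
  "ringing_sites c S u = {s \<in> S. rings (c s) u}"

text \<open>
  \<open>box_chain c w j\<close> is driven by the clocks of the finitely many sites \<open>leftmost w, \<dots>, j\<close> only,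
  processed in the order in which they ring. Almost surely no two clocks ring together; in that
  null event ties are processed from left to right.
\<close>

definition box_chain ::
    "(int \<Rightarrow> real \<Rightarrow> nat) \<Rightarrow> (int \<Rightarrow> bool) \<Rightarrow> int \<Rightarrow> real \<Rightarrow> (int \<Rightarrow> bool)" where
  "box_chain c w j t =
     fold (\<lambda>u. fold flip (sorted_list_of_set (ringing_sites c {leftmost w..j} u)))
       (sorted_list_of_set {u \<in> {0<..t}. ringing_sites c {leftmost w..j} u \<noteq> {}}) w"

text \<open>
  The inverse limit of the box chains: the bit at \<open>s\<close> is read off from any box containing \<open>s\<close>
  (see \<open>box_chain_consistent\<close> below), in particular from the smallest one.
\<close>

definition chain :: "(int \<Rightarrow> real \<Rightarrow> nat) \<Rightarrow> (int \<Rightarrow> bool) \<Rightarrow> real \<Rightarrow> (int \<Rightarrow> bool)" where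
  "chain c w t s = box_chain c w s t s"

lemma fold_flip_agree:
  assumes "\<And>k. k \<le> s \<Longrightarrow> \<eta> k = \<zeta> k" "k \<le> s"
  shows "fold flip xs \<eta> k = fold flip (filter (\<lambda>r. r \<le> s) xs) \<zeta> k"
  using assms
proof (induction xs arbitrary: \<eta> \<zeta>)
  case (Cons r xs)
  show ?case
  proof (cases "r \<le> s")
    case True
    then show ?thesis
      using Cons.IH[of "flip r \<eta>" "flip r \<zeta>"] Cons.prems by (simp add: flip_def)
  next
    case False
    then show ?thesis
      using Cons.IH[of "flip r \<eta>" "\<zeta>"] Cons.prems by (simp add: flip_def)
  qed
qed simp

lemma filter_sorted_list_of_set:
  assumes "finite A"
  shows "filter P (sorted_list_of_set A) = sorted_list_of_set {a \<in> A. P a}"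
  by (rule sorted_distinct_set_unique) (simp_all add: assms sorted_wrt_filter)

lemma fold_drop_idle:
  assumes "\<And>u. u \<notin> B \<Longrightarrow> f u = id"
  shows "fold f xs = fold f (filter (\<lambda>u. u \<in> B) xs)"
  using assms by (induction xs) auto

theorem box_chain_consistent:
  assumes fin: "finite {u \<in> {0<..t}. ringing_sites c {leftmost w..j} u \<noteq> {}}" and "s \<le> j"
  shows "box_chain c w j t s = box_chain c w s t s"
proof -
  let ?R = "\<lambda>j. ringing_sites c {leftmost w..j}"
  let ?f = "\<lambda>j u. fold flip (sorted_list_of_set (?R j u))"
  have finR: "finite (?R j u)" for j u
    by (rule finite_subset[of _ "{leftmost w..j}"]) (auto simp: ringing_sites_def)
  have eq: "{r \<in> ?R j u. r \<le> s} = ?R s u" for u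
    using \<open>s \<le> j\<close> by (auto simp: ringing_sites_def)
  have step: "?f j u \<eta> k = ?f s u \<zeta> k"
    if "\<And>k. k \<le> s \<Longrightarrow> \<eta> k = \<zeta> k" "k \<le> s" for u \<eta> \<zeta> k
    using fold_flip_agree[of s \<eta> \<zeta> k "sorted_list_of_set (?R j u)"] that
    by (simp add: filter_sorted_list_of_set finR eq)
  have *: "fold (?f j) xs \<eta> k = fold (?f s) xs \<zeta> k"
    if "\<And>k. k \<le> s \<Longrightarrow> \<eta> k = \<zeta> k" "k \<le> s" for xs \<eta> \<zeta> k
    using that
  proof (induction xs arbitrary: \<eta> \<zeta>)
    case (Cons u xs)
    show ?case
      using Cons.IH[of "?f j u \<eta>" "?f s u \<zeta>"] step Cons.prems by simp
  qed simp
  have idle: "?f s u = id" if "u \<notin> {u. ?R s u \<noteq> {}}" for u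
    using that by simp
  have T: "{u \<in> {u \<in> {0<..t}. ?R j u \<noteq> {}}. u \<in> {u. ?R s u \<noteq> {}}} = {u \<in> {0<..t}. ?R s u \<noteq> {}}"
    using \<open>s \<le> j\<close> by (fastforce simp: ringing_sites_def)
  let ?A = "\<lambda>j. {u \<in> {0<..t}. ?R j u \<noteq> {}}"
  have "box_chain c w j t s = fold (?f j) (sorted_list_of_set (?A j)) w s"
    by (simp only: box_chain_def)
  also have "\<dots> = fold (?f s) (sorted_list_of_set (?A j)) w s"
    by (rule *) auto
  also have "\<dots> = fold (?f s) (filter (\<lambda>u. u \<in> {u. ?R s u \<noteq> {}}) (sorted_list_of_set (?A j))) w s"
    by (rule arg_cong[where f = "\<lambda>g. g w s"], rule fold_drop_idle, rule idle)
  also have "\<dots> = fold (?f s) (sorted_list_of_set (?A s)) w s"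
    by (simp only: filter_sorted_list_of_set[OF fin] T)
  also have "\<dots> = box_chain c w s t s"
    by (simp only: box_chain_def)
  finally show ?thesis .
qed

lemma finite_rings:
  assumes "counting_path c"
  shows "finite {u \<in> {0<..t}. rings c u}"
proof (rule inj_on_finite[where f = c and B = "{..c t}"])
  show "inj_on c {u \<in> {0<..t}. rings c u}"
  proof (rule linorder_inj_onI')
    fix u v assume "u \<in> {u \<in> {0<..t}. rings c u}" "v \<in> {u \<in> {0<..t}. rings c u}" "u < v"
    then have "c u < c v" by (auto simp: rings_def)
    then show "c u \<noteq> c v" by simp
  qed
  show "c ` {u \<in> {0<..t}. rings c u} \<subseteq> {..c t}"
    using assms by (auto simp: counting_path_def intro!: mono_onD[of "{0..}" c])
qed simp

lemma finite_ring_times: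
  assumes "\<And>j. counting_path (c j)"
  shows "finite {u \<in> {0<..t}. ringing_sites c {i..j} u \<noteq> {}}"
proof -
  have "{u \<in> {0<..t}. ringing_sites c {i..j} u \<noteq> {}} = (\<Union>s\<in>{i..j}. {u \<in> {0<..t}. rings (c s) u})"
    by (auto simp: ringing_sites_def)
  then show ?thesis using finite_rings[OF assms] by simp
qed

lemma box_chain_const:
  assumes "u \<le> t" "\<And>v. u < v \<Longrightarrow> v \<le> t \<Longrightarrow> ringing_sites c {leftmost w..j} v = {}"
  shows "box_chain c w j t = box_chain c w j u"
proof -
  have "{v \<in> {0<..t}. ringing_sites c {leftmost w..j} v \<noteq> {}}
      = {v \<in> {0<..u}. ringing_sites c {leftmost w..j} v \<noteq> {}}"
    using assms by force
  then show ?thesis by (simp add: box_chain_def)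
qed

lemma sorted_list_of_set_insert_last:
  assumes "finite A" "\<And>a. a \<in> A \<Longrightarrow> a < t"
  shows "sorted_list_of_set (insert t A) = sorted_list_of_set A @ [t]"
proof (rule sorted_distinct_set_unique)
  show "sorted (sorted_list_of_set A @ [t])"
    using assms by (auto simp: sorted_append less_imp_le)
  show "distinct (sorted_list_of_set A @ [t])"
    using assms by auto
  have "finite (insert t A)" using assms by simp
  then show "set (sorted_list_of_set (insert t A)) = set (sorted_list_of_set A @ [t])"
    by (simp only: set_sorted_list_of_set) (use assms in auto)
qed simp_all

lemma box_chain_ring:
  assumes "\<And>j. counting_path (c j)"
    and "0 < t" "u < t" "\<And>v. u < v \<Longrightarrow> v < t \<Longrightarrow> ringing_sites c {leftmost w..j} v = {}"
  shows "box_chain c w j t =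
    fold flip (sorted_list_of_set (ringing_sites c {leftmost w..j} t)) (box_chain c w j u)"
proof (cases "ringing_sites c {leftmost w..j} t = {}")
  case True
  then have "box_chain c w j t = box_chain c w j u"
    using assms by (intro box_chain_const) (auto simp: less_le)
  with True show ?thesis by simp
next
  case False
  let ?T = "\<lambda>t. {v \<in> {0<..t}. ringing_sites c {leftmost w..j} v \<noteq> {}}"
  have "?T t = insert t (?T u)"
  proof (rule set_eqI)
    fix v
    consider "v \<le> u" | "u < v" "v < t" | "v = t" | "t < v" by linarith
    then show "v \<in> ?T t \<longleftrightarrow> v \<in> insert t (?T u)"
      by cases (use assms(2-4) False in auto)
  qed
  moreover have "sorted_list_of_set (insert t (?T u)) = sorted_list_of_set (?T u) @ [t]"
    using finite_ring_times[of c, OF assms(1)] \<open>u < t\<close>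
    by (intro sorted_list_of_set_insert_last) auto
  ultimately show ?thesis by (simp add: box_chain_def)
qed

text \<open>
  The explicit construction obeys the flip rule at ring times, with the configuration just before
  the ring taken as a bitwise left limit.
\<close>

theorem chain_update:
  assumes cp: "\<And>j. counting_path (c j)" and "0 < t" and "leftmost w \<le> s"
    and ring: "\<And>r. rings (c r) t \<longleftrightarrow> r = s"
  shows "chain c w t = flip s (\<lambda>k. Lim (at_left t) (\<lambda>u. chain c w u k))"
proof -
  have left: "\<exists>a<t. \<forall>v. a < v \<longrightarrow> v < t \<longrightarrow> ringing_sites c {leftmost w..j} v = {}" for j
  proof -
    let ?T = "insert 0 {v \<in> {0<..t}. ringing_sites c {leftmost w..j} v \<noteq> {}} - {t}"
    have fin: "finite ?T" using finite_ring_times[OF cp] by simp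
    have "Max ?T \<in> ?T" using fin \<open>0 < t\<close> by (intro Max_in) auto
    moreover have "ringing_sites c {leftmost w..j} v = {}" if "Max ?T < v" "v < t" for v
    proof (rule ccontr)
      assume "\<not> ?thesis"
      moreover have "0 < v"
        using that(1) \<open>0 < t\<close> Max_ge[OF fin, of 0] by simp
      ultimately have "v \<in> ?T" using that by auto
      with Max_ge[OF fin, of v] that(1) show False by simp
    qed
    moreover have "m < t" if "m \<in> ?T" for m
      using that \<open>0 < t\<close> by auto
    ultimately show ?thesis by blast
  qed
  define p where "p k = Lim (at_left t) (\<lambda>u. chain c w u k)" for k
  have p: "\<exists>a<t. \<forall>u. a < u \<longrightarrow> u < t \<longrightarrow> box_chain c w j u k = p k" if "k \<le> j" for j k
  proof -
    from left[of j] obtain a where a: "a < t"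
      "\<And>v. a < v \<Longrightarrow> v < t \<Longrightarrow> ringing_sites c {leftmost w..j} v = {}" by blast
    define b where "b = (a + t) / 2"
    have b: "a < b" "b < t" using a(1) by (auto simp: b_def)
    have const: "box_chain c w j u k = box_chain c w j b k" if "a < u" "u < t" for u
    proof (cases "u \<le> b")
      case True
      then show ?thesis using a(2) b that by (subst box_chain_const[of u b]) auto
    next
      case False
      then show ?thesis using a(2) b that by (subst box_chain_const[of b u]) auto
    qed
    have "((\<lambda>u. chain c w u k) \<longlongrightarrow> box_chain c w j b k) (at_left t)"
    proof (rule tendsto_eventually)
      show "\<forall>\<^sub>F u in at_left t. chain c w u k = box_chain c w j b k"
        using eventually_at_left_real[OF a(1)]
      proof eventually_elim
        case (elim u)
        then show ?case
          using const[of u] box_chain_consistent[OF finite_ring_times[OF cp] that]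
          by (simp add: chain_def)
      qed
    qed
    then have "p k = box_chain c w j b k"
      unfolding p_def by (intro tendsto_Lim) simp_all
    with const have "\<forall>u. a < u \<longrightarrow> u < t \<longrightarrow> box_chain c w j u k = p k" by simp
    with a(1) show ?thesis by (intro exI[of _ a] conjI)
  qed
  have "chain c w t k = flip s p k" for k
  proof -
    define j where "j = max s k"
    have R: "ringing_sites c {leftmost w..j} t = {s}"
      using ring \<open>leftmost w \<le> s\<close> by (auto simp: ringing_sites_def j_def)
    from left[of j] obtain a where a: "a < t"
      "\<And>v. a < v \<Longrightarrow> v < t \<Longrightarrow> ringing_sites c {leftmost w..j} v = {}" by blast
    from p[of k j] obtain a1 where a1: "a1 < t" "\<And>u. a1 < u \<Longrightarrow> u < t \<Longrightarrow> box_chain c w j u k = p k"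
      by (auto simp: j_def)
    from p[of s j] obtain a2 where a2: "a2 < t" "\<And>u. a2 < u \<Longrightarrow> u < t \<Longrightarrow> box_chain c w j u s = p s"
      by (auto simp: j_def)
    obtain u where u: "max a (max a1 a2) < u" "u < t"
      using dense[of "max a (max a1 a2)" t] a(1) a1(1) a2(1) by auto
    have "chain c w t k = box_chain c w j t k"
      using box_chain_consistent[OF finite_ring_times[OF cp], of k j] by (simp add: chain_def j_def)
    also have "\<dots> = flip s (box_chain c w j u) k"
      using a u by (subst box_chain_ring[OF cp \<open>0 < t\<close>, of u]) (auto simp: R)
    also have "\<dots> = flip s p k"
      using a1(2)[of u] a2(2)[of u] u by (simp add: flip_def)
    finally show ?thesis .
  qed
  then have "chain c w t = flip s p" by (rule ext)
  then show ?thesis unfolding p_def .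
qed

definition ones :: "(nat \<Rightarrow> bool) \<Rightarrow> enat" where
  "ones x = (INF j\<in>{j. 1 \<le> j \<and> \<not> x j}. enat j)"

text \<open>
  \<open>sigma\<close>, \<open>front\<close>, \<open>jump\<close> are $\sigma_n$, $i_n$, $\mathrm{jump}_n$; \<open>jump\<close> is meaningful for
  \<open>n \<ge> 1\<close>. The left limit is taken bitwise, bits carrying the discrete topology. A jump may a
  priori be infinite; after an infinite jump \<open>front\<close> is junk, but \<open>spd\<close> stays infinite.
\<close>

fun sigma :: "(int \<Rightarrow> real \<Rightarrow> nat) \<Rightarrow> (int \<Rightarrow> bool) \<Rightarrow> nat \<Rightarrow> real"
  and front :: "(int \<Rightarrow> real \<Rightarrow> nat) \<Rightarrow> (int \<Rightarrow> bool) \<Rightarrow> nat \<Rightarrow> int"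
  and jump :: "(int \<Rightarrow> real \<Rightarrow> nat) \<Rightarrow> (int \<Rightarrow> bool) \<Rightarrow> nat \<Rightarrow> enat"
where
  "sigma c w 0 = 0"
| "sigma c w (Suc n) = next_ring (c (front c w n)) (sigma c w n)"
| "front c w 0 = leftmost w"
| "front c w (Suc n) = front c w n + int (the_enat (jump c w (Suc n)))"
| "jump c w 0 = 0"
| "jump c w (Suc n) =
     ones (\<lambda>j. Lim (at_left (sigma c w (Suc n))) (\<lambda>u. chain c w u (front c w n + int j)))"

definition spd :: "(int \<Rightarrow> real \<Rightarrow> nat) \<Rightarrow> (int \<Rightarrow> bool) \<Rightarrow> nat \<Rightarrow> ereal" where
  "spd c w n = (\<Sum>j=1..n. ereal_of_enat (jump c w j)) / ereal (sigma c w n)"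

end

theory Submission
  imports Defs "HOL-Real_Asymp.Real_Asymp"
begin

text \<open>
  Up to a correction depending on the bits just behind the front, the position of the leftmost 1 has
  drift at most \<open>2.88\<close> and at least \<open>1.647\<close>, whatever the configuration. For the upper bound the
  correction is a function of the lengths of the first three runs of equal bits, tabulated for short
  runs and slowly growing in the long ones; for the lower bound it is a function of the nine bits
  behind the front, the bits that enter this window after a jump being chosen adversarially. Both
  drift inequalities reduce to finite integer checks.

  Long runs of ones make the second moments of the increments unbounded, but they also make the
  drift of the upper correction more negative, and this surplus pays for them. Chebyshev's inequality
  then bounds the probability of a linear deviation at time \<open>n ^ 8\<close> by \<open>O(1 / n\<^sup>2)\<close>, so that
  Borel--Cantelli applies along these times; as the front only moves right and
  \<open>(n + 1) ^ 8 / n ^ 8 \<longlonglongrightarrow> 1\<close>, monotonicity fills the gaps.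

  Expectations are computed in a finite box, whose right end is out of reach before time \<open>n ^ 8\<close>, and
  after cutting time into \<open>K\<close> slots: with probability \<open>1 - O(1 / K)\<close> no slot contains two rings, and
  then the chain in the box is a function of independent bits, one for each site and slot.
\<close>

section \<open>Drift bounds for the chain in discrete time\<close>

text \<open>The drift bounds hold for each configuration separately, so no stationary law enters; in
  return the potentials must cope with the worst case. For the lower bound increments can be kept
  bounded, since counting a long jump as a shorter one is harmless. For the upper bound a run of k
  ones may cause a jump of length k, with square k ^ 2. The weights \<open>coef\<close> therefore
  contain a constant and a small multiple of the fourth root, both divided by the index: the
  constant part cancels the jump length, the fourth root leaves a surplus drift of order k powr
  (5/4). In a box of length L this gives k ^ 2 \<le> const * L powr (3/4) * surplus up to a
  constant, while the correction itself grows only like L powr (1/4). With L of order T, Chebyshev's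
  inequality at time T leaves T powr (3/4) * T / T ^ 2, that is T powr (-1/4); T = n ^ 8 makes this
  summable and keeps all exponents integral. A surplus merely proportional to k would leave a bound
  that does not tend to 0.\<close>

text \<open>
  \<open>expect\<close> is the expectation when the sites of the list ring one after the other, each with
  probability \<open>p\<close>.
\<close>

fun expect :: "real \<Rightarrow> int list \<Rightarrow> ((int \<Rightarrow> bool) \<Rightarrow> real) \<Rightarrow> (int \<Rightarrow> bool) \<Rightarrow> real" where
  "expect p [] u z = u z"
| "expect p (s # ss) u z = (1 - p) * expect p ss u z + p * expect p ss u (flip s z)"

text \<open>Bounds on the potentials hold only on a suitable set of configurations, later
  \<open>boxed\<close>; this set has to be stable under every flip that a slot may perform.\<close>

definition closed_under_flips :: "int set \<Rightarrow> (int \<Rightarrow> bool) set \<Rightarrow> bool" where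
  "closed_under_flips B I \<longleftrightarrow> (\<forall>z\<in>I. \<forall>s\<in>B. flip s z \<in> I)"

lemma closed_under_flipsD: "closed_under_flips B I \<Longrightarrow> z \<in> I \<Longrightarrow> s \<in> B \<Longrightarrow> flip s z \<in> I"
  by (simp add: closed_under_flips_def)

lemma expect_append: "expect p (xs @ ys) u z = expect p xs (expect p ys u) z"
  by (induction xs arbitrary: z) auto

lemma expect_affine: "expect p ss (\<lambda>z. a * u z + c) z = a * expect p ss u z + c"
  by (induction ss arbitrary: z) (auto simp: algebra_simps)

lemma expect_mono:
  assumes "0 \<le> p" "p \<le> 1" "closed_under_flips (set ss) I" "z \<in> I" "\<And>z. z \<in> I \<Longrightarrow> u z \<le> v z"
  shows "expect p ss u z \<le> expect p ss v z"
  using assms(3,4)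
proof (induction ss arbitrary: z)
  case (Cons s ss)
  have "closed_under_flips (set ss) I" "flip s z \<in> I"
    using Cons.prems by (auto simp: closed_under_flips_def)
  then show ?case
    using Cons assms(1,2) by (auto intro!: add_mono mult_left_mono)
qed (use assms in auto)

lemma expect_bounds:
  assumes "0 \<le> p" "p \<le> 1" "closed_under_flips (set ss) I" "z \<in> I" "\<And>z. z \<in> I \<Longrightarrow> \<bar>u z\<bar> \<le> M"
  shows "\<bar>expect p ss u z\<bar> \<le> M"
proof -
  have c: "expect p ss (\<lambda>_. a) z = a" for a
    using expect_affine[of p ss 0 "\<lambda>_. 0" a z] by simp
  have "expect p ss u z \<le> expect p ss (\<lambda>_. M) z" "expect p ss (\<lambda>_. - M) z \<le> expect p ss u z"
    by (rule expect_mono[OF assms(1-4)], use assms(5) in force)+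
  then show ?thesis unfolding c by linarith
qed

lemma expect_close:
  assumes p: "0 \<le> p" "p \<le> 1" and M: "\<And>z. z \<in> I \<Longrightarrow> \<bar>u z\<bar> \<le> M"
    and "closed_under_flips (set ss) I" "z \<in> I"
  shows "\<bar>expect p ss u z - u z\<bar> \<le> 2 * M * p * length ss"
  using assms(4,5)
proof (induction ss arbitrary: z)
  case (Cons s ss)
  have c: "closed_under_flips (set ss) I" "flip s z \<in> I"
    using Cons.prems by (auto simp: closed_under_flips_def)
  have "\<bar>expect p ss u (flip s z)\<bar> \<le> M" "\<bar>expect p ss u z\<bar> \<le> M"
    using c Cons.prems by (auto intro!: expect_bounds[OF p] M)
  then have "\<bar>expect p ss u (flip s z) - expect p ss u z\<bar> \<le> 2 * M" by linarith
  then have "p * \<bar>expect p ss u (flip s z) - expect p ss u z\<bar> \<le> p * (2 * M)"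
    using p by (intro mult_left_mono)
  moreover have "\<bar>expect p ss u z - u z\<bar> \<le> 2 * M * p * length ss"
    using Cons c by blast
  moreover have "expect p (s # ss) u z - u z
      = (expect p ss u z - u z) + p * (expect p ss u (flip s z) - expect p ss u z)"
    by (simp add: algebra_simps)
  moreover have "\<bar>p * (expect p ss u (flip s z) - expect p ss u z)\<bar>
      = p * \<bar>expect p ss u (flip s z) - expect p ss u z\<bar>"
    using p by (simp add: abs_mult)
  ultimately have "\<bar>expect p (s # ss) u z - u z\<bar> \<le> 2 * M * p * length ss + p * (2 * M)"
    by linarith
  then show ?case by (simp add: algebra_simps)
qed auto

text \<open>Expansion of one slot to first order in p: the generator, that is the sum over single
  flips, plus the effect of two or more rings, of order p ^ 2. Over K slots with p of order 1 / K
  the latter adds up to O(1 / K).\<close>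

lemma expect_round:
  assumes p: "0 \<le> p" "p \<le> 1" and M: "\<And>z. z \<in> I \<Longrightarrow> \<bar>u z\<bar> \<le> M"
    and "closed_under_flips (set ss) I" "z \<in> I"
  shows "expect p ss u z \<le> u z + p * (\<Sum>s\<leftarrow>ss. u (flip s z) - u z) + 4 * M * p\<^sup>2 * (real (length ss))\<^sup>2"
  using assms(4,5)
proof (induction ss arbitrary: z)
  case (Cons s ss)
  let ?n = "real (length ss)"
  have c: "closed_under_flips (set ss) I" "flip s z \<in> I"
    using Cons.prems by (auto simp: closed_under_flips_def)
  have M0: "0 \<le> M" using M[OF Cons.prems(2)] by linarith
  have "\<bar>expect p ss u (flip s z) - u (flip s z)\<bar> \<le> 2 * M * p * ?n"
    "\<bar>expect p ss u z - u z\<bar> \<le> 2 * M * p * ?n"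
    using c Cons.prems by (auto intro!: expect_close[OF p] M)
  then have "expect p ss u (flip s z) - expect p ss u z \<le> (u (flip s z) - u z) + 4 * M * p * ?n"
    by linarith
  then have "p * (expect p ss u (flip s z) - expect p ss u z)
      \<le> p * ((u (flip s z) - u z) + 4 * M * p * ?n)"
    using p by (intro mult_left_mono)
  moreover have "expect p (s # ss) u z
      = expect p ss u z + p * (expect p ss u (flip s z) - expect p ss u z)"
    by (simp add: algebra_simps)
  moreover have "expect p ss u z \<le> u z + p * (\<Sum>s\<leftarrow>ss. u (flip s z) - u z) + 4 * M * p\<^sup>2 * ?n\<^sup>2"
    using Cons c by blast
  ultimately have "expect p (s # ss) u z \<le> u z + p * (\<Sum>s\<leftarrow>s # ss. u (flip s z) - u z)
      + (4 * M * p\<^sup>2) * (?n\<^sup>2 + ?n)"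
    by (simp add: algebra_simps power2_eq_square)
  also have "(4 * M * p\<^sup>2) * (?n\<^sup>2 + ?n) \<le> (4 * M * p\<^sup>2) * (real (length (s # ss)))\<^sup>2"
    using M0 by (intro mult_left_mono) (auto simp: power2_eq_square algebra_simps)
  finally show ?case by simp
qed auto

text \<open>The potential \<open>U k\<close> varies with the slot because the line c * t will be
  subtracted from it. In the induction j counts the slots still to come, so the slot peeled off
  leads from index K - Suc j to K - j.\<close>

lemma expect_rounds:
  assumes p: "0 \<le> p" "p \<le> 1" and cl: "closed_under_flips (set ss) I"
    and step: "\<And>k z. k < K \<Longrightarrow> z \<in> I \<Longrightarrow> expect p ss (U (Suc k)) z \<le> U k z + e"
    and "z \<in> I"
  shows "expect p (concat (replicate K ss)) (U K) z \<le> U 0 z + real K * e"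
proof -
  have "expect p (concat (replicate j ss)) (U K) z \<le> U (K - j) z + real j * e"
    if "j \<le> K" "z \<in> I" for j z
    using that
  proof (induction j arbitrary: z)
    case (Suc j)
    have "expect p (concat (replicate (Suc j) ss)) (U K) z
        = expect p ss (expect p (concat (replicate j ss)) (U K)) z"
      by (simp add: expect_append)
    also have "\<dots> \<le> expect p ss (\<lambda>z. 1 * U (K - j) z + real j * e) z"
      using Suc by (intro expect_mono[OF p cl]) auto
    also have "\<dots> = expect p ss (U (K - j)) z + real j * e"
      by (subst expect_affine) simp
    also have "expect p ss (U (K - j)) z \<le> U (K - Suc j) z + e"
      using step[of "K - Suc j" z] Suc.prems by (simp add: Suc_diff_Suc)
    finally show ?case by (simp add: algebra_simps)
  qed simp
  from this[of K z] assms(5) show ?thesis by simp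
qed

text \<open>The increment e is known only through its upper bound d. The square of the positive part
  is nondecreasing and its second derivative is at most 2, so the first and second moments of d
  suffice.\<close>

lemma pos_part_square_step:
  fixes x d e :: real
  assumes "e \<le> d"
  shows "(max 0 (x + e))\<^sup>2 \<le> (max 0 x)\<^sup>2 + 2 * max 0 x * d + d\<^sup>2"
proof -
  have "(max 0 (x + e))\<^sup>2 \<le> (max 0 (x + d))\<^sup>2"
    using assms by (intro power_mono) auto
  also have "\<dots> \<le> (max 0 x)\<^sup>2 + 2 * max 0 x * d + d\<^sup>2"
  proof (cases "0 \<le> x")
    case True
    then have "(max 0 (x + d))\<^sup>2 \<le> (x + d)\<^sup>2" by (auto simp: max_def)
    with True show ?thesis by (simp add: power2_sum max_def algebra_simps split: if_splits)
  next
    case False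
    then have "(max 0 (x + d))\<^sup>2 \<le> d\<^sup>2"
      by (cases "0 \<le> x + d") (auto intro!: power_mono simp: max_def)
    with False show ?thesis by (simp add: max_def)
  qed
  finally show ?thesis .
qed

text \<open>Convexity: the graph lies above its tangents. This handles the deterministic shift by c
  * h during a slot without an error of order h ^ 2.\<close>

lemma pos_part_square_tangent:
  fixes x d :: real
  shows "(max 0 x)\<^sup>2 + 2 * max 0 x * d \<le> (max 0 (x + d))\<^sup>2"
proof (cases "0 \<le> x")
  case True
  show ?thesis
  proof (cases "0 \<le> x + d")
    case True
    with \<open>0 \<le> x\<close> show ?thesis by (simp add: power2_sum max_def)
  next
    case False
    have "x\<^sup>2 + 2 * x * d = x * (x + d) + x * d" by (simp add: power2_eq_square algebra_simps)
    also have "\<dots> \<le> 0"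
      using True False mult_nonneg_nonpos[of x "x + d"] mult_nonneg_nonpos[of x d] by linarith
    finally have "x\<^sup>2 + 2 * x * d \<le> 0" .
    moreover have "max 0 x = x" "max 0 (x + d) = 0" using \<open>0 \<le> x\<close> False by auto
    ultimately show ?thesis by simp
  qed
qed (simp add: max_def)

text \<open>
  Along the chain, \<open>(max 0 (W z - W w - c * t))\<^sup>2 + b * (W z - c * t)\<close> grows at rate at most \<open>c2\<close>,
  because the surplus drift \<open>q\<close> pays for the second moments. The first alternative of \<open>drift\<close> is for
  configurations at the end of the box, where \<open>W\<close> is frozen at a low value.
\<close>

lemma drift_tail:
  fixes W q :: "(int \<Rightarrow> bool) \<Rightarrow> real" and D :: "int \<Rightarrow> (int \<Rightarrow> bool) \<Rightarrow> real"
  assumes cl: "closed_under_flips (set ss) I" and dist: "distinct ss" and w: "w \<in> I" and T: "0 < T"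
    and M: "\<And>z. z \<in> I \<Longrightarrow> \<bar>W z\<bar> \<le> M"
    and jump: "\<And>z s. z \<in> I \<Longrightarrow> s \<in> set ss \<Longrightarrow> z s \<Longrightarrow> W (flip s z) \<le> W z + D s z"
    and drift: "\<And>z. z \<in> I \<Longrightarrow>
        (b = 0 \<and> (\<forall>t\<in>{0..T}. W z \<le> W w + c * t) \<and> (\<forall>s. D s z = 0)) \<or>
        ((\<Sum>s | s \<in> set ss \<and> z s. D s z) \<le> c - q z \<and>
         (\<Sum>s | s \<in> set ss \<and> z s. (D s z)\<^sup>2) \<le> c2 + b * q z)"
    and q: "\<And>z. z \<in> I \<Longrightarrow> 0 \<le> q z" and b: "0 \<le> b" and c2: "0 \<le> c2" and eps: "0 < \<epsilon>" and eta: "0 < \<eta>"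
  shows "\<exists>K0>0. \<forall>K\<ge>K0. expect (1 - exp (- (T / real K))) (concat (replicate K ss))
      (\<lambda>z. of_bool (W w + c * T + \<epsilon> * T \<le> W z)) w \<le> (c2 * T + b * (2 * M + \<bar>c\<bar> * T)) / (\<epsilon> * T)\<^sup>2 + \<eta>"
proof -
  define a where "a = W w"
  \<comment> \<open>Only the positive part is squared: deviations above the line are all that
    matters, and W may be frozen far below it. The linear term has drift at most - b * q, which
    absorbs the b * q in the bound for the second moments.\<close>
  define \<Phi> where "\<Phi> t z = (max 0 (W z - a - c * t))\<^sup>2 + b * (W z - c * t)" for t z
  define Y where "Y = 2 * M + \<bar>c\<bar> * T"
  define M' where "M' = Y\<^sup>2 + b * Y"
  define G where "G = (2 * Y + b) * \<bar>c\<bar> + 4 * M' * (real (length ss))\<^sup>2"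
  have M0: "0 \<le> M" using M[OF w] by linarith
  have Y0: "0 \<le> Y" using M0 T by (simp add: Y_def)
  have ct: "\<bar>c * t\<bar> \<le> \<bar>c\<bar> * T" if "t \<in> {0..T}" for t
    using that by (auto simp: abs_mult intro!: mult_left_mono)
  have yb: "max 0 (W z - a - c * t) \<le> Y" if "z \<in> I" "t \<in> {0..T}" for z t
    using M[OF that(1)] M[OF w] ct[OF that(2)] Y0 unfolding a_def Y_def by linarith
  have \<Phi>b: "\<bar>\<Phi> t z\<bar> \<le> M'" if "z \<in> I" "t \<in> {0..T}" for z t
  proof -
    have "(max 0 (W z - a - c * t))\<^sup>2 \<le> Y\<^sup>2"
      using yb[OF that] by (intro power_mono) auto
    moreover have "\<bar>b * (W z - c * t)\<bar> \<le> b * Y"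
      unfolding abs_mult using b M[OF that(1)] ct[OF that(2)] M0
      by (auto intro!: mult_left_mono simp: Y_def)
    ultimately show ?thesis unfolding \<Phi>_def M'_def
      using zero_le_power2[of "max 0 (W z - a - c * t)"] by linarith
  qed
  have M'0: "0 \<le> M'" using Y0 b by (simp add: M'_def)
  have G0: "0 \<le> G" using Y0 b M'0 by (simp add: G_def)
  have step: "expect p ss (\<Phi> (t + h)) z \<le> \<Phi> t z + (c2 * h + G * h\<^sup>2)"
    if h: "0 < h" "t \<in> {0..T}" "t + h \<in> {0..T}" and p_def: "p = 1 - exp (- h)" and z: "z \<in> I" for h t z p
  proof -
    have p: "0 \<le> p" "p \<le> 1" "p \<le> h" "h - h\<^sup>2 \<le> p"
    proof -
      show "0 \<le> p" "p \<le> 1" using h by (auto simp: p_def)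
      show "p \<le> h" using exp_ge_add_one_self[of "-h"] by (simp add: p_def)
      have "exp (- h) * exp h = 1" by (simp flip: exp_add)
      moreover have "exp (-h) * (1 + h) \<le> exp (-h) * exp h"
        by (intro mult_left_mono) auto
      ultimately have "exp (-h) * (1 + h) \<le> 1" by simp
      moreover have "1 \<le> (1 - h + h\<^sup>2) * (1 + h)"
        using h by (simp add: algebra_simps power2_eq_square)
      ultimately have "exp (-h) * (1 + h) \<le> (1 - h + h\<^sup>2) * (1 + h)" by linarith
      then have "exp (-h) \<le> 1 - h + h\<^sup>2" using h by simp
      then show "h - h\<^sup>2 \<le> p" by (simp add: p_def)
    qed
    define y where "y = max 0 (W z - a - c * (t + h))"
    have y: "0 \<le> y" "y \<le> Y" using yb[OF z h(3)] by (auto simp: y_def)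
    let ?A = "{s. s \<in> set ss \<and> z s}"
    have inc: "\<Phi> (t + h) (flip s z) - \<Phi> (t + h) z \<le> (2 * y + b) * D s z + (D s z)\<^sup>2" if s: "s \<in> ?A" for s
    proof -
      have j: "W (flip s z) - W z \<le> D s z" using jump[OF z] s by force
      have "(max 0 (W (flip s z) - a - c * (t + h)))\<^sup>2 \<le> y\<^sup>2 + 2 * y * D s z + (D s z)\<^sup>2"
        using pos_part_square_step[OF j, of "W z - a - c * (t + h)"] by (simp add: y_def algebra_simps)
      moreover have "b * (W (flip s z) - W z) \<le> b * D s z" using j b by (intro mult_left_mono)
      ultimately show ?thesis by (simp add: \<Phi>_def y_def algebra_simps)
    qed
    have "(\<Sum>s\<leftarrow>ss. \<Phi> (t + h) (flip s z) - \<Phi> (t + h) z) = (\<Sum>s\<in>set ss. \<Phi> (t + h) (flip s z) - \<Phi> (t + h) z)"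
      using dist by (simp add: sum_list_distinct_conv_sum_set)
    also have "\<dots> = (\<Sum>s\<in>?A. \<Phi> (t + h) (flip s z) - \<Phi> (t + h) z)"
      by (rule sum.mono_neutral_right) (auto simp: flip_def)
    also have "\<dots> \<le> (\<Sum>s\<in>?A. (2 * y + b) * D s z + (D s z)\<^sup>2)"
      using inc by (intro sum_mono)
    also have "\<dots> = (2 * y + b) * (\<Sum>s\<in>?A. D s z) + (\<Sum>s\<in>?A. (D s z)\<^sup>2)"
      by (simp add: sum.distrib sum_distrib_left)
    finally have S: "(\<Sum>s\<leftarrow>ss. \<Phi> (t + h) (flip s z) - \<Phi> (t + h) z)
        \<le> (2 * y + b) * (\<Sum>s\<in>?A. D s z) + (\<Sum>s\<in>?A. (D s z)\<^sup>2)" .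
    have "expect p ss (\<Phi> (t + h)) z \<le> \<Phi> (t + h) z
        + p * (\<Sum>s\<leftarrow>ss. \<Phi> (t + h) (flip s z) - \<Phi> (t + h) z) + 4 * M' * p\<^sup>2 * (real (length ss))\<^sup>2"
      by (rule expect_round[OF p(1,2) _ cl z]) (use \<Phi>b h(3) in auto)
    moreover have "p * (\<Sum>s\<leftarrow>ss. \<Phi> (t + h) (flip s z) - \<Phi> (t + h) z)
        \<le> p * ((2 * y + b) * (\<Sum>s\<in>?A. D s z) + (\<Sum>s\<in>?A. (D s z)\<^sup>2))"
      using S p by (intro mult_left_mono)
    moreover have "4 * M' * p\<^sup>2 * (real (length ss))\<^sup>2 \<le> 4 * M' * h\<^sup>2 * (real (length ss))\<^sup>2"
      using p M'0 by (intro mult_right_mono mult_left_mono power_mono) auto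
    moreover have "\<Phi> (t + h) z \<le> \<Phi> t z - c * h * (2 * y + b)"
      using pos_part_square_tangent[of "W z - a - c * (t + h)" "c * h"]
      by (simp add: \<Phi>_def y_def algebra_simps)
    moreover have "p * ((2 * y + b) * (\<Sum>s\<in>?A. D s z) + (\<Sum>s\<in>?A. (D s z)\<^sup>2)) - c * h * (2 * y + b)
        \<le> c2 * h + (2 * Y + b) * \<bar>c\<bar> * h\<^sup>2"
      using drift[OF z]
    proof
      assume *: "b = 0 \<and> (\<forall>t\<in>{0..T}. W z \<le> W w + c * t) \<and> (\<forall>s. D s z = 0)"
      then have "W z \<le> W w + c * (t + h)" using h(3) by blast
      then have "y = 0" by (simp add: y_def a_def)
      with * c2 h(1) Y0 show ?thesis by simp
    next
      assume *: "(\<Sum>s\<in>?A. D s z) \<le> c - q z \<and> (\<Sum>s\<in>?A. (D s z)\<^sup>2) \<le> c2 + b * q z"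
      have 1: "(2 * y + b) * (\<Sum>s\<in>?A. D s z) + (\<Sum>s\<in>?A. (D s z)\<^sup>2)
          \<le> (2 * y + b) * (c - q z) + (c2 + b * q z)"
        using * y b by (intro add_mono mult_left_mono) auto
      \<comment> \<open>The two terms b * q cancel, and - 2 * y * q is dropped because y and q are
        nonnegative.\<close>
      also have "\<dots> \<le> (2 * y + b) * c + c2"
        using y(1) q[OF z] by (simp add: algebra_simps)
      finally have "p * ((2 * y + b) * (\<Sum>s\<in>?A. D s z) + (\<Sum>s\<in>?A. (D s z)\<^sup>2))
          \<le> p * ((2 * y + b) * c + c2)" using p by (intro mult_left_mono)
      moreover have "p * c2 \<le> h * c2" using p c2 by (intro mult_right_mono)
      \<comment> \<open>The flips produce drift at rate p, whereas c * h is subtracted. As c may be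
        negative, the lower bound h - p \<le> h ^ 2 enters besides p \<le> h.\<close>
      moreover have "(2 * y + b) * (c * (p - h)) \<le> (2 * y + b) * (\<bar>c\<bar> * h\<^sup>2)"
      proof (rule mult_left_mono)
        have "c * (p - h) \<le> \<bar>c * (p - h)\<bar>" by simp
        also have "\<dots> = \<bar>c\<bar> * \<bar>p - h\<bar>" by (simp add: abs_mult)
        also have "\<dots> \<le> \<bar>c\<bar> * h\<^sup>2" using p by (intro mult_left_mono) auto
        finally show "c * (p - h) \<le> \<bar>c\<bar> * h\<^sup>2" .
      qed (use y b in auto)
      moreover have "(2 * y + b) * (\<bar>c\<bar> * h\<^sup>2) \<le> (2 * Y + b) * (\<bar>c\<bar> * h\<^sup>2)"
        using y by (intro mult_right_mono) auto
      ultimately show ?thesis by (simp add: algebra_simps)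
    qed
    ultimately show ?thesis by (simp add: G_def algebra_simps)
  qed
  define K0 where "K0 = nat \<lceil>T\<^sup>2 * G / (\<eta> * (\<epsilon> * T)\<^sup>2)\<rceil> + 1"
  have "expect (1 - exp (- (T / real K))) (concat (replicate K ss))
      (\<lambda>z. of_bool (W w + c * T + \<epsilon> * T \<le> W z)) w \<le> (c2 * T + b * (2 * M + \<bar>c\<bar> * T)) / (\<epsilon> * T)\<^sup>2 + \<eta>"
    if K: "K0 \<le> K" for K
  proof -
    define h where "h = T / real K"
    have K1: "0 < K" using K by (simp add: K0_def)
    have h: "0 < h" "real K * h = T" using K1 T by (auto simp: h_def)
    let ?p = "1 - exp (- h)"
    have p: "0 \<le> ?p" "?p \<le> 1" using h by auto
    have cl': "closed_under_flips (set (concat (replicate K ss))) I"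
      using cl by (auto simp: closed_under_flips_def set_concat split: if_splits)
    have mono: "real k * h \<le> T" if "k \<le> K" for k
    proof -
      have "real k * h \<le> real K * h" using that h(1) by (intro mult_right_mono) auto
      then show ?thesis using h(2) by simp
    qed
    have E: "expect ?p (concat (replicate K ss)) (\<Phi> (real K * h)) w \<le> \<Phi> (real 0 * h) w + real K * (c2 * h + G * h\<^sup>2)"
    proof (rule expect_rounds[where U = "\<lambda>k. \<Phi> (real k * h)", OF p cl _ w])
      fix k z assume kz: "k < K" "z \<in> I"
      have e: "real (Suc k) * h = real k * h + h" by (simp add: algebra_simps)
      show "expect ?p ss (\<Phi> (real (Suc k) * h)) z \<le> \<Phi> (real k * h) z + (c2 * h + G * h\<^sup>2)"
        unfolding e
        by (rule step[OF h(1) _ _ refl kz(2)]) (use h(1) mono[of k] mono[of "Suc k", unfolded e] kz(1) in auto)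
    qed
    have \<Phi>0: "\<Phi> (real 0 * h) w \<le> b * M"
      using M[OF w] b by (auto simp: \<Phi>_def a_def intro!: mult_left_mono)
    have KG: "real K * (c2 * h + G * h\<^sup>2) = c2 * T + T\<^sup>2 * G / real K"
      using K1 by (simp add: h_def field_simps power2_eq_square)
    have "expect ?p (concat (replicate K ss)) (\<lambda>z. of_bool (W w + c * T + \<epsilon> * T \<le> W z)) w
        \<le> expect ?p (concat (replicate K ss)) (\<lambda>z. (1 / (\<epsilon> * T)\<^sup>2) * \<Phi> T z + b * (M + \<bar>c\<bar> * T) / (\<epsilon> * T)\<^sup>2) w"
    proof (rule expect_mono[OF p cl' w])
      fix z assume z: "z \<in> I"
      \<comment> \<open>The linear term of \<Phi> has no sign, so Markov's inequality is applied
        after adding b * (M + \<bar>c\<bar> * T), a bound for its modulus. Together with the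
        starting value of \<Phi>, at most b * M, this accounts for the 2 * M in the
        conclusion.\<close>
      have nn: "0 \<le> b * (W z - c * T) + b * (M + \<bar>c\<bar> * T)"
      proof -
        have "0 \<le> b * ((W z - c * T) + (M + \<bar>c\<bar> * T))"
          using M[OF z] ct[of T] T b by (intro mult_nonneg_nonneg) auto
        then show ?thesis by (simp add: algebra_simps)
      qed
      have "of_bool (W w + c * T + \<epsilon> * T \<le> W z) * (\<epsilon> * T)\<^sup>2 \<le> (max 0 (W z - a - c * T))\<^sup>2"
        using eps T by (auto simp: a_def intro!: power_mono)
      then have "of_bool (W w + c * T + \<epsilon> * T \<le> W z) * (\<epsilon> * T)\<^sup>2 \<le> \<Phi> T z + b * (M + \<bar>c\<bar> * T)"
        using nn unfolding \<Phi>_def by linarith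
      then show "of_bool (W w + c * T + \<epsilon> * T \<le> W z) \<le> (1 / (\<epsilon> * T)\<^sup>2) * \<Phi> T z + b * (M + \<bar>c\<bar> * T) / (\<epsilon> * T)\<^sup>2"
        using eps T by (simp add: field_simps)
    qed
    also have "\<dots> = (1 / (\<epsilon> * T)\<^sup>2) * expect ?p (concat (replicate K ss)) (\<Phi> T) w + b * (M + \<bar>c\<bar> * T) / (\<epsilon> * T)\<^sup>2"
      by (rule expect_affine)
    also have "\<dots> \<le> (1 / (\<epsilon> * T)\<^sup>2) * (b * M + (c2 * T + T\<^sup>2 * G / real K)) + b * (M + \<bar>c\<bar> * T) / (\<epsilon> * T)\<^sup>2"
      using E \<Phi>0 unfolding KG h(2) by (intro add_right_mono mult_left_mono) auto
    also have "\<dots> = (c2 * T + b * (2 * M + \<bar>c\<bar> * T)) / (\<epsilon> * T)\<^sup>2 + T\<^sup>2 * G / (\<epsilon> * T)\<^sup>2 / real K"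
      by (simp add: add_divide_distrib algebra_simps)
    also have "T\<^sup>2 * G / (\<epsilon> * T)\<^sup>2 / real K \<le> \<eta>"
    proof -
      have "T\<^sup>2 * G / (\<eta> * (\<epsilon> * T)\<^sup>2) \<le> real K"
        using K by (simp add: K0_def) linarith
      moreover have "0 < \<eta> * (\<epsilon> * T)\<^sup>2" using eps T eta by simp
      ultimately have "T\<^sup>2 * G \<le> real K * (\<eta> * (\<epsilon> * T)\<^sup>2)"
        by (subst (asm) pos_divide_le_eq) auto
      then have "T\<^sup>2 * G \<le> (\<eta> * real K) * (\<epsilon> * T)\<^sup>2" by (simp only: ac_simps)
      moreover have "0 < (\<epsilon> * T)\<^sup>2" using eps T by simp
      ultimately have "T\<^sup>2 * G / (\<epsilon> * T)\<^sup>2 \<le> \<eta> * real K"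
        by (subst pos_divide_le_eq) auto
      then show ?thesis using K1 by (subst pos_divide_le_eq) auto
    qed
    finally show ?thesis by (simp add: h_def)
  qed
  moreover have "0 < K0" by (simp add: K0_def)
  ultimately show ?thesis by blast
qed

section \<open>Discretising the Poisson clocks\<close>

fun exec :: "int list \<Rightarrow> bool list \<Rightarrow> (int \<Rightarrow> bool) \<Rightarrow> (int \<Rightarrow> bool)" where
  "exec (s # ss) (b # bs) z = exec ss bs (if b then flip s z else z)"
| "exec _ _ z = z"

fun weight :: "real \<Rightarrow> bool list \<Rightarrow> real" where
  "weight p [] = 1"
| "weight p (b # bs) = (if b then p else 1 - p) * weight p bs"

lemma exec_append:
  "length xs = length as \<Longrightarrow> exec (xs @ ys) (as @ bs) z = exec ys bs (exec xs as z)"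
  by (induction xs as arbitrary: z rule: list_induct2) auto

lemma exec_map: "exec ss (map \<beta> ss) z = fold flip (filter \<beta> ss) z"
  by (induction ss arbitrary: z) auto

lemma weight_append: "weight p (xs @ ys) = weight p xs * weight p ys"
  by (induction xs) auto

text \<open>Unfolds the recursion into a sum over all outcomes of the ringing bits, the form that
  can be matched with the law of the discretised clocks.\<close>

lemma expect_exec:
  "expect p ss u z = (\<Sum>bs | length bs = length ss. weight p bs * u (exec ss bs z))"
proof (induction ss arbitrary: z)
  case (Cons s ss)
  let ?L = "{bs :: bool list. length bs = length ss}"
  have fin: "finite ?L" using finite_lists_length_eq[of "UNIV :: bool set" "length ss"] by simp
  have eq: "{bs. length bs = length (s # ss)} = (#) False ` ?L \<union> (#) True ` ?L"
  proof -
    have "bs \<in> (#) False ` ?L \<union> (#) True ` ?L" if "length bs = Suc (length ss)" for bs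
      using that by (cases bs; cases "hd bs") auto
    then show ?thesis by auto
  qed
  have "(\<Sum>bs | length bs = length (s # ss). weight p bs * u (exec (s # ss) bs z))
      = (\<Sum>bs\<in>(#) False ` ?L. weight p bs * u (exec (s # ss) bs z))
      + (\<Sum>bs\<in>(#) True ` ?L. weight p bs * u (exec (s # ss) bs z))"
    unfolding eq using fin by (intro sum.union_disjoint) auto
  also have "\<dots> = (\<Sum>bs\<in>?L. (1 - p) * (weight p bs * u (exec ss bs z)))
      + (\<Sum>bs\<in>?L. p * (weight p bs * u (exec ss bs (flip s z))))"
    by (subst (1 2) sum.reindex) (auto simp: mult.assoc)
  also have "\<dots> = expect p (s # ss) u z"
    by (simp add: Cons.IH sum_distrib_left)
  finally show ?case ..
qed simp

definition bits :: "int list \<Rightarrow> (nat \<Rightarrow> int \<Rightarrow> bool) \<Rightarrow> nat \<Rightarrow> bool list" where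
  "bits ss \<beta> K = concat (map (\<lambda>k. map (\<beta> k) ss) [0..<K])"

lemma bits_0 [simp]: "bits ss \<beta> 0 = []"
  by (simp add: bits_def)

lemma bits_Suc: "bits ss \<beta> (Suc K) = bits ss \<beta> K @ map (\<beta> K) ss"
  by (simp add: bits_def)

lemma length_bits [simp]: "length (bits ss \<beta> K) = K * length ss"
  by (induction K) (auto simp: bits_Suc)

lemma length_rounds [simp]: "length (concat (replicate K ss)) = K * length ss"
  by (induction K) auto

lemma rounds_Suc: "concat (replicate (Suc K) ss) = concat (replicate K ss) @ ss"
  by (induction K) auto

lemma bits_cong: "(\<And>k. k < K \<Longrightarrow> \<beta> k = \<gamma> k) \<Longrightarrow> bits ss \<beta> K = bits ss \<gamma> K"
  by (induction K) (auto simp: bits_Suc)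

lemma bits_eq_iff: "bits ss \<beta> K = bits ss \<gamma> K \<longleftrightarrow> (\<forall>k<K. \<forall>s\<in>set ss. \<beta> k s = \<gamma> k s)"
  by (induction K) (auto simp: bits_Suc less_Suc_eq)

lemma bits_surj:
  assumes "distinct ss" "length bs = K * length ss"
  obtains \<beta> where "bs = bits ss \<beta> K"
proof -
  have "\<exists>\<beta>. bs = bits ss \<beta> K"
    using assms(2)
  proof (induction K arbitrary: bs)
    case (Suc K)
    let ?a = "take (K * length ss) bs" and ?b = "drop (K * length ss) bs"
    have len: "length ?b = length ss" using Suc.prems by simp
    have "length ?a = K * length ss" using Suc.prems by simp
    then obtain \<beta> where \<beta>: "?a = bits ss \<beta> K" using Suc.IH by blast
    define \<gamma> where "\<gamma> = \<beta>(K := \<lambda>s. the (map_of (zip ss ?b) s))"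
    have "map (\<gamma> K) ss = ?b"
      using len by (intro nth_equalityI) (auto simp: \<gamma>_def map_of_zip_nth assms(1))
    moreover have "bits ss \<gamma> K = ?a"
      unfolding \<beta> by (intro bits_cong) (auto simp: \<gamma>_def)
    ultimately have "bs = bits ss \<gamma> (Suc K)" by (simp add: bits_Suc)
    then show ?case by blast
  qed simp
  then show ?thesis using that by blast
qed

lemma weight_bits:
  assumes "distinct ss"
  shows "weight p (bits ss \<beta> K) = (\<Prod>k<K. \<Prod>s\<in>set ss. if \<beta> k s then p else 1 - p)"
proof (induction K)
  case (Suc K)
  have "weight p (map f xs) = (\<Prod>s\<leftarrow>xs. if f s then p else 1 - p)" for f :: "int \<Rightarrow> bool" and xs
    by (induction xs) auto
  then show ?case
    using Suc assms by (simp add: bits_Suc weight_append prod.distinct_set_conv_list)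
qed simp

text \<open>The ring is found at the first time u at which c reaches the level c b. By right
  continuity the level is attained at u; otherwise c would stay below it for a while after
  u.\<close>

lemma ring_exists:
  assumes cp: "counting_path c" and a: "0 \<le> a" and ab: "a < b" and c: "c a < c b"
  shows "\<exists>u\<in>{a<..b}. rings c u"
proof -
  define S where "S = {v \<in> {a..b}. c b \<le> c v}"
  define u where "u = Inf S"
  have mono: "c x \<le> c y" if "0 \<le> x" "x \<le> y" for x y
    using cp that by (auto simp: counting_path_def intro!: mono_onD[of "{0..}" c])
  have S: "b \<in> S" "bdd_below S" using ab by (auto simp: S_def intro!: bdd_belowI[of _ a])
  have u: "a \<le> u" "u \<le> b"
    unfolding u_def using S by (auto intro!: cInf_greatest cInf_lower simp: S_def)
  have below: "c v < c b" if "a \<le> v" "v < u" for v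
  proof (rule ccontr)
    assume "\<not> c v < c b"
    then have "v \<in> S" using that u by (auto simp: S_def)
    then have "u \<le> v" unfolding u_def using S by (intro cInf_lower)
    with that show False by simp
  qed
  have right: "\<exists>e>x. \<forall>v. x < v \<longrightarrow> v < e \<longrightarrow> c v = c x" if "0 \<le> x" for x
  proof -
    have "(c \<longlongrightarrow> c x) (at_right x)"
      using cp that by (auto simp: counting_path_def continuous_within)
    then have "\<forall>\<^sub>F v in at_right x. c v = c x"
      by (simp add: tendsto_discrete)
    then show ?thesis by (auto simp: eventually_at_right_field)
  qed
  have cu: "c u = c b"
  proof (rule ccontr)
    assume "c u \<noteq> c b"
    then have lt: "c u < c b" using mono[of u b] u a by simp
    obtain e where e: "u < e" "\<And>v. u < v \<Longrightarrow> v < e \<Longrightarrow> c v = c u"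
      using right[of u] u a by auto
    have "e \<le> v" if "v \<in> S" for v
    proof (rule ccontr)
      assume "\<not> e \<le> v"
      have "u \<le> v" unfolding u_def using S that by (intro cInf_lower)
      then have "c v = c u" using e(2)[of v] \<open>\<not> e \<le> v\<close> by (cases "u = v") auto
      with lt that show False by (simp add: S_def)
    qed
    then have "e \<le> u" unfolding u_def using S by (intro cInf_greatest) auto
    with e(1) show False by simp
  qed
  have "a \<noteq> u" using cu c by auto
  then have "a < u" using u by simp
  moreover have "c v < c u" if "v \<in> {0..<u}" for v
    using below[of v] mono[of v a] that c cu by (cases "a \<le> v") auto
  ultimately show ?thesis
    using u a unfolding rings_def by (intro bexI[of _ u]) auto
qed

lemma rings_less:
  assumes "rings c v" "0 \<le> a" "a < v"
  shows "c a < c v"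
  using assms by (simp add: rings_def)

lemma counting_path_mono: "counting_path c \<Longrightarrow> 0 \<le> x \<Longrightarrow> x \<le> y \<Longrightarrow> c x \<le> c y"
  by (auto simp: counting_path_def intro!: mono_onD[of "{0..}" c])

text \<open>When at most one clock of the box rings in the slot, and at most once, the chain makes
  at most one flip there. Then neither the exact ring time nor the order in which
  \<open>exec\<close> visits the sites matters.\<close>

lemma box_chain_slot:
  assumes cp: "\<And>j. counting_path (c j)" and ab: "0 \<le> a" "a < b"
    and ss: "ss = sorted_list_of_set {leftmost w..j}"
    and one: "\<And>s. s \<in> set ss \<Longrightarrow> c s b \<le> c s a + 1"
    and two: "\<And>s s'. s \<in> set ss \<Longrightarrow> s' \<in> set ss \<Longrightarrow> s \<noteq> s' \<Longrightarrow> c s b = c s a \<or> c s' b = c s' a"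
  shows "box_chain c w j b = exec ss (map (\<lambda>s. 0 < c s b - c s a) ss) (box_chain c w j a)"
proof -
  have set: "set ss = {leftmost w..j}" by (simp add: ss)
  have ring: "c s a < c s v \<and> c s v \<le> c s b" if "rings (c s) v" "a < v" "v \<le> b" for s v
    using rings_less[OF that(1) ab(1) that(2)] counting_path_mono[OF cp, of v b s] that ab by auto
  show ?thesis
  proof (cases "\<exists>s\<in>set ss. c s a < c s b")
    case False
    then have "ringing_sites c {leftmost w..j} v = {}" if "a < v" "v \<le> b" for v
      using ring[OF _ that] that set by (force simp: ringing_sites_def)
    then have "box_chain c w j b = box_chain c w j a"
      using ab by (intro box_chain_const) auto
    moreover have "filter (\<lambda>s. 0 < c s b - c s a) ss = []"
      using False by (auto simp: filter_empty_conv)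
    ultimately show ?thesis by (simp add: exec_map)
  next
    case True
    then obtain s where s: "s \<in> set ss" "c s a < c s b" by blast
    have others: "c r b = c r a" if "r \<in> set ss" "r \<noteq> s" for r
      using two[OF s(1) that(1)] that(2) s(2) by auto
    obtain u where u: "a < u" "u \<le> b" "rings (c s) u"
      using ring_exists[OF cp ab s(2)] by auto
    have uniq: "r = s \<and> v = u" if "rings (c r) v" "a < v" "v \<le> b" "r \<in> set ss" for r v
    proof
      show "r = s" using ring[OF that(1-3)] others[OF that(4)] by auto
      then have v: "rings (c s) v" using that by simp
      have "c s b \<le> c s a + 1" using one s(1) by blast
      then show "v = u"
        using ring[OF v that(2,3)] ring[OF u(3,1,2)] rings_less[OF v, of u] rings_less[OF u(3), of v] u(1) that(2) ab
        by (cases u v rule: linorder_cases) auto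
    qed
    have R: "ringing_sites c {leftmost w..j} v = (if v = u then {s} else {})" if "a < v" "v \<le> b" for v
    proof (rule set_eqI)
      fix r
      show "r \<in> ringing_sites c {leftmost w..j} v \<longleftrightarrow> r \<in> (if v = u then {s} else {})"
        using uniq[of r v] that u s(1) by (cases "v = u") (auto simp: ringing_sites_def set)
    qed
    have "box_chain c w j b = box_chain c w j u"
      using u R by (intro box_chain_const) auto
    also have "\<dots> = fold flip (sorted_list_of_set (ringing_sites c {leftmost w..j} u)) (box_chain c w j a)"
      using u R ab by (intro box_chain_ring[OF cp]) auto
    also have "\<dots> = flip s (box_chain c w j a)"
      using R[of u] u by simp
    also have "filter (\<lambda>s. 0 < c s b - c s a) ss = [s]"
    proof -
      have "filter (\<lambda>s. 0 < c s b - c s a) ss = sorted_list_of_set {r \<in> {leftmost w..j}. 0 < c r b - c r a}"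
        unfolding ss by (rule filter_sorted_list_of_set) simp
      also have "{r \<in> {leftmost w..j}. 0 < c r b - c r a} = {s}"
      proof (rule set_eqI)
        fix r
        show "r \<in> {r \<in> {leftmost w..j}. 0 < c r b - c r a} \<longleftrightarrow> r \<in> {s}"
          using s others[of r] by (cases "r = s") (auto simp: set)
      qed
      finally show ?thesis by simp
    qed
    then have "flip s (box_chain c w j a) = exec ss (map (\<lambda>s. 0 < c s b - c s a) ss) (box_chain c w j a)"
      by (simp add: exec_map)
    finally show ?thesis .
  qed
qed

lemma diff_nat_measurable:
  fixes f g :: "'a \<Rightarrow> nat"
  assumes "f \<in> measurable M (count_space UNIV)" "g \<in> measurable M (count_space UNIV)"
  shows "(\<lambda>x. f x - g x) \<in> measurable M (count_space UNIV)"
  by (rule measurable_compose_countable'[where f = "\<lambda>m x. m - g x" and g = f and I = UNIV])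
     (auto intro!: measurable_compose[OF assms(2)] assms(1))

section \<open>Law of the slot increments and the cost of the discretisation\<close>

locale clocks = prob_space M for M :: "'a measure" and N :: "int \<Rightarrow> real \<Rightarrow> 'a \<Rightarrow> nat" +
  assumes ic: "independent_clocks M N"
begin

lemma pp: "poisson_process 1 M (N j)"
  using ic by (simp add: independent_clocks_def)

lemma N_measurable [measurable]: "0 \<le> t \<Longrightarrow> N j t \<in> measurable M (count_space UNIV)"
  using pp[of j] by (simp add: poisson_process_def)

lemma AE_counting: "AE x in M. \<forall>j. counting_path (\<lambda>t. N j t x)"
  using pp by (simp add: poisson_process_def AE_all_countable)

definition inc :: "real \<Rightarrow> nat \<Rightarrow> int \<Rightarrow> 'a \<Rightarrow> nat" where
  "inc h k s x = N s (real (Suc k) * h) x - N s (real k * h) x"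

lemma inc_measurable [measurable]: "0 < h \<Longrightarrow> inc h k s \<in> measurable M (count_space UNIV)"
  unfolding inc_def by (intro diff_nat_measurable) auto

lemma inc_prob:
  assumes "0 < h"
  shows "prob {x \<in> space M. inc h k s x \<in> A} = measure_pmf.prob (poisson_pmf h) A"
proof -
  have "\<forall>u t. 0 \<le> u \<longrightarrow> u < t \<longrightarrow>
      distr M (count_space UNIV) (\<lambda>x. N s t x - N s u x) = measure_pmf (poisson_pmf (1 * (t - u)))"
    using pp[of s] unfolding poisson_process_def by blast
  moreover have "0 \<le> real k * h" "real k * h < real (Suc k) * h" using assms by (auto simp: algebra_simps)
  ultimately have "distr M (count_space UNIV) (inc h k s)
      = measure_pmf (poisson_pmf (1 * (real (Suc k) * h - real k * h)))"
    unfolding inc_def by blast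
  also have "1 * (real (Suc k) * h - real k * h) = h" by (simp add: algebra_simps)
  finally have "measure (distr M (count_space UNIV) (inc h k s)) A = measure_pmf.prob (poisson_pmf h) A"
    by simp
  then show ?thesis
    by (subst (asm) measure_distr) (use assms in \<open>auto simp: vimage_def Int_def conj_commute\<close>)
qed

lemma inc_zero_prob:
  assumes "0 < h"
  shows "prob {x \<in> space M. (0 < inc h k s x) = \<beta>} = (if \<beta> then 1 - exp (- h) else exp (- h))"
proof -
  have 0: "prob {x \<in> space M. inc h k s x \<in> {0}} = exp (- h)"
    unfolding inc_prob[OF assms] using assms by (simp add: measure_pmf_single)
  have "prob {x \<in> space M. inc h k s x \<in> - {0}} = 1 - exp (- h)"
    unfolding inc_prob[OF assms]
    using measure_pmf.prob_compl[of "{0}" "poisson_pmf h"] assms by (simp add: measure_pmf_single Compl_eq_Diff_UNIV)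
  with 0 show ?thesis by (cases \<beta>) auto
qed

lemma inc_two_prob:
  assumes "0 < h"
  shows "prob {x \<in> space M. 2 \<le> inc h k s x} \<le> h\<^sup>2"
proof -
  have "- {n. 2 \<le> n} = {0, 1 :: nat}" by auto
  then have "measure_pmf.prob (poisson_pmf h) (- {n. 2 \<le> n}) = exp (- h) + h * exp (- h)"
    using assms by (simp add: measure_measure_pmf_finite)
  moreover have "measure_pmf.prob (poisson_pmf h) (- {n. 2 \<le> n}) = 1 - measure_pmf.prob (poisson_pmf h) {n. 2 \<le> n}"
    using measure_pmf.prob_compl[of "{n. 2 \<le> n}" "poisson_pmf h"] by (simp add: Compl_eq_Diff_UNIV)
  ultimately have "measure_pmf.prob (poisson_pmf h) {n. 2 \<le> n} = 1 - (1 + h) * exp (- h)"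
    by (simp add: algebra_simps)
  also have "\<dots> \<le> h\<^sup>2"
  proof -
    have "(1 + h) * (1 - h) \<le> (1 + h) * exp (- h)"
      using exp_ge_add_one_self[of "-h"] assms by (intro mult_left_mono) auto
    then show ?thesis by (simp add: algebra_simps power2_eq_square)
  qed
  finally show ?thesis using inc_prob[OF assms, of k s "{n. 2 \<le> n}"] by simp
qed

lemma slots_one_site:
  assumes "0 < h"
  shows "prob {x \<in> space M. \<forall>k<K. (0 < inc h k s x) = \<beta> k} = (\<Prod>k<K. if \<beta> k then 1 - exp (- h) else exp (- h))"
proof (cases "K = 0")
  case True
  then show ?thesis by (simp add: prob_space)
next
  case False
  have "indep_vars (\<lambda>k::nat. count_space UNIV) (\<lambda>k x. inc h k s x) UNIV"
  proof -
    have "\<forall>T. 0 \<le> T 0 \<longrightarrow> incseq T \<longrightarrow>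
        indep_vars (\<lambda>k::nat. count_space UNIV) (\<lambda>k x. N s (T (Suc k)) x - N s (T k) x) UNIV"
      using pp[of s] unfolding poisson_process_def by blast
    from spec[OF this, of "\<lambda>k. real k * h"]
    have "incseq (\<lambda>k. real k * h) \<Longrightarrow>
        indep_vars (\<lambda>k::nat. count_space UNIV) (\<lambda>k x. N s (real (Suc k) * h) x - N s (real k * h) x) UNIV"
      by (simp del: of_nat_Suc)
    moreover have "incseq (\<lambda>k. real k * h)" using assms by (intro incseq_SucI) (auto simp: algebra_simps)
    ultimately show ?thesis by (simp only: inc_def)
  qed
  then have "prob (\<Inter>k\<in>{..<K}. (\<lambda>x. inc h k s x) -` {n. (0 < n) = \<beta> k} \<inter> space M)
      = (\<Prod>k<K. prob ((\<lambda>x. inc h k s x) -` {n. (0 < n) = \<beta> k} \<inter> space M))"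
    by (rule indep_varsD) (use False in auto)
  also have "(\<Inter>k\<in>{..<K}. (\<lambda>x. inc h k s x) -` {n. (0 < n) = \<beta> k} \<inter> space M)
      = {x \<in> space M. \<forall>k<K. (0 < inc h k s x) = \<beta> k}" using False by auto
  also have "(\<Prod>k<K. prob ((\<lambda>x. inc h k s x) -` {n. (0 < n) = \<beta> k} \<inter> space M))
      = (\<Prod>k<K. if \<beta> k then 1 - exp (- h) else exp (- h))"
  proof (rule prod.cong[OF refl])
    fix k
    have "(\<lambda>x. inc h k s x) -` {n. (0 < n) = \<beta> k} \<inter> space M = {x \<in> space M. (0 < inc h k s x) = \<beta> k}" by auto
    then show "prob ((\<lambda>x. inc h k s x) -` {n. (0 < n) = \<beta> k} \<inter> space M) = (if \<beta> k then 1 - exp (- h) else exp (- h))"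
      using inc_zero_prob[OF assms, of k s "\<beta> k"] by simp
  qed
  finally show ?thesis .
qed

text \<open>Two independences are combined: that of whole paths for different sites, and that of the
  increments along one path. For the first, the event at a site is written as the preimage of a set
  \<open>C s\<close> of paths, measurable because finitely many coordinates decide it.\<close>

lemma slots_sites:
  assumes h: "0 < h" and S: "finite S"
  shows "prob {x \<in> space M. \<forall>s\<in>S. \<forall>k<K. (0 < inc h k s x) = \<beta> k s}
    = (\<Prod>s\<in>S. \<Prod>k<K. if \<beta> k s then 1 - exp (- h) else exp (- h))"
proof (cases "S = {}")
  case True
  then show ?thesis by (simp add: prob_space)
next
  case False
  let ?P = "\<Pi>\<^sub>M t\<in>{0::real..}. count_space (UNIV :: nat set)"
  let ?X = "\<lambda>j x. \<lambda>t\<in>{0..}. N j t x"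
  define C where "C s = {f \<in> space ?P. \<forall>k<K. (0 < f (real (Suc k) * h) - f (real k * h)) = \<beta> k s}" for s
  have ind: "indep_vars (\<lambda>j. ?P) ?X UNIV"
    using ic by (simp add: independent_clocks_def)
  have C: "C s \<in> sets ?P" for s
  proof -
    have [measurable]: "(\<lambda>f. f t) \<in> measurable ?P (count_space UNIV)" if "0 \<le> t" for t
      using that by (intro measurable_component_singleton) auto
    have "Measurable.pred ?P (\<lambda>f. (0 < f (real (Suc k) * h) - f (real k * h)) = \<beta> k s)" for k
    proof -
      have "(\<lambda>f. f (real (Suc k) * h) - f (real k * h)) \<in> measurable ?P (count_space UNIV)"
        using h by (intro diff_nat_measurable) auto
      then show ?thesis
        by (rule measurable_compose[where g = "\<lambda>n. (0 < n) = \<beta> k s"]) simp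
    qed
    then show ?thesis unfolding C_def by measurable
  qed
  have X: "?X s x \<in> C s \<longleftrightarrow> (\<forall>k<K. (0 < inc h k s x) = \<beta> k s)" for s x
    using h by (auto simp: C_def inc_def space_PiM)
  have "prob (\<Inter>s\<in>S. ?X s -` C s \<inter> space M) = (\<Prod>s\<in>S. prob (?X s -` C s \<inter> space M))"
    by (rule indep_varsD[OF ind]) (use False S C in auto)
  also have "(\<Inter>s\<in>S. ?X s -` C s \<inter> space M) = {x \<in> space M. \<forall>s\<in>S. \<forall>k<K. (0 < inc h k s x) = \<beta> k s}"
    using False by (auto simp: X)
  also have "(\<Prod>s\<in>S. prob (?X s -` C s \<inter> space M)) = (\<Prod>s\<in>S. \<Prod>k<K. if \<beta> k s then 1 - exp (- h) else exp (- h))"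
  proof (rule prod.cong[OF refl])
    fix s
    have "?X s -` C s \<inter> space M = {x \<in> space M. \<forall>k<K. (0 < inc h k s x) = \<beta> k s}"
      by (auto simp: X)
    then show "prob (?X s -` C s \<inter> space M) = (\<Prod>k<K. if \<beta> k s then 1 - exp (- h) else exp (- h))"
      using slots_one_site[OF h, of K s "\<lambda>k. \<beta> k s"] by simp
  qed
  finally show ?thesis .
qed

text \<open>The finitely many outcomes of the bit list partition the space, and each has its product
  weight by \<open>slots_sites\<close>; measurability and probability of the event follow by
  summation.\<close>

lemma exec_prob:
  fixes w :: "int \<Rightarrow> bool" and K :: nat
  assumes h: "0 < h" and ss: "distinct ss"
  defines "Z \<equiv> \<lambda>x. exec (concat (replicate K ss)) (bits ss (\<lambda>k s. 0 < inc h k s x) K) w"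
  shows "{x \<in> space M. Z x \<in> A} \<in> events"
    and "prob {x \<in> space M. Z x \<in> A} = expect (1 - exp (- h)) (concat (replicate K ss)) (\<lambda>z. of_bool (z \<in> A)) w"
proof -
  let ?SS = "concat (replicate K ss)"
  let ?L = "{bs :: bool list. length bs = K * length ss}"
  define E where "E bs = {x \<in> space M. bits ss (\<lambda>k s. 0 < inc h k s x) K = bs}" for bs
  have fin: "finite ?L" using finite_lists_length_eq[of "UNIV :: bool set" "K * length ss"] by simp
  have E: "E bs \<in> events \<and> prob (E bs) = weight (1 - exp (- h)) bs" if bs: "bs \<in> ?L" for bs
  proof -
    obtain \<beta> where \<beta>: "bs = bits ss \<beta> K" using bits_surj[OF ss] bs by auto
    have eq: "E bs = {x \<in> space M. \<forall>s\<in>set ss. \<forall>k<K. (0 < inc h k s x) = \<beta> k s}"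
      by (auto simp: E_def \<beta> bits_eq_iff)
    have "E bs \<in> events" unfolding eq using h by measurable
    moreover have "prob (E bs) = (\<Prod>s\<in>set ss. \<Prod>k<K. if \<beta> k s then 1 - exp (- h) else exp (- h))"
      unfolding eq by (rule slots_sites[OF h finite_set])
    then have "prob (E bs) = weight (1 - exp (- h)) bs"
      unfolding \<beta> weight_bits[OF ss] by (subst prod.swap) (simp cong: if_cong)
    ultimately show ?thesis ..
  qed
  let ?L' = "{bs \<in> ?L. exec ?SS bs w \<in> A}"
  have eq: "{x \<in> space M. Z x \<in> A} = (\<Union>bs\<in>?L'. E bs)"
    by (auto simp: E_def Z_def)
  show "{x \<in> space M. Z x \<in> A} \<in> events"
    unfolding eq using fin E by (intro sets.finite_UN) auto
  have "prob (\<Union>bs\<in>?L'. E bs) = (\<Sum>bs\<in>?L'. prob (E bs))"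
  proof (rule finite_measure_finite_Union)
    show "finite ?L'" using fin by simp
    show "E ` ?L' \<subseteq> events" using E by auto
    show "disjoint_family_on E ?L'" by (auto simp: disjoint_family_on_def E_def)
  qed
  also have "\<dots> = (\<Sum>bs\<in>?L'. weight (1 - exp (- h)) bs * of_bool (exec ?SS bs w \<in> A))"
    using E by (intro sum.cong) auto
  also have "\<dots> = (\<Sum>bs\<in>?L. weight (1 - exp (- h)) bs * of_bool (exec ?SS bs w \<in> A))"
    using fin by (intro sum.mono_neutral_left) auto
  also have "\<dots> = expect (1 - exp (- h)) ?SS (\<lambda>z. of_bool (z \<in> A)) w"
    by (simp add: expect_exec)
  finally show "prob {x \<in> space M. Z x \<in> A} = expect (1 - exp (- h)) ?SS (\<lambda>z. of_bool (z \<in> A)) w"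
    unfolding eq .
qed

text \<open>Some slot contains two rings, of one clock or of two. With h = T / K the probability is
  of order K * h ^ 2, which vanishes as K grows.\<close>

definition crowded :: "int set \<Rightarrow> real \<Rightarrow> nat \<Rightarrow> 'a set" where
  "crowded S h K = (\<Union>k<K. (\<Union>s\<in>S. {x \<in> space M. 2 \<le> inc h k s x}) \<union>
     (\<Union>(s, s')\<in>{(s, s') \<in> S \<times> S. s \<noteq> s'}. {x \<in> space M. 0 < inc h k s x \<and> 0 < inc h k s' x}))"

lemma crowded_prob:
  assumes h: "0 < h" and S: "finite S"
  shows "crowded S h K \<in> events" "prob (crowded S h K) \<le> 2 * real K * (real (card S))\<^sup>2 * h\<^sup>2"
proof -
  have m1: "{x \<in> space M. 2 \<le> inc h k s x} \<in> events" for k s using h by measurable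
  have m2: "{x \<in> space M. 0 < inc h k s x \<and> 0 < inc h k s' x} \<in> events" for k s s' using h by measurable
  let ?P = "{(s, s') \<in> S \<times> S. s \<noteq> s'}"
  have finP: "finite ?P" using S by (auto intro: finite_subset[of _ "S \<times> S"])
  let ?A = "\<lambda>k. \<Union>s\<in>S. {x \<in> space M. 2 \<le> inc h k s x}"
  let ?B = "\<lambda>k. \<Union>(s, s')\<in>?P. {x \<in> space M. 0 < inc h k s x \<and> 0 < inc h k s' x}"
  have A: "?A k \<in> events" for k using m1 S by (intro sets.finite_UN) auto
  have B: "?B k \<in> events" for k using m2 finP by (intro sets.finite_UN) auto
  have AB: "?A k \<union> ?B k \<in> events" for k
    by (rule sets.Un[OF A B])
  show ev: "crowded S h K \<in> events"
    unfolding crowded_def by (rule sets.finite_UN[OF finite_lessThan AB])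
  have pair: "prob {x \<in> space M. 0 < inc h k s x \<and> 0 < inc h k s' x} \<le> h\<^sup>2" if "s \<noteq> s'" for k s s'
  proof -
    let ?\<beta> = "\<lambda>k' (r::int). True"
    have ind: "indep_vars (\<lambda>j. \<Pi>\<^sub>M t\<in>{0::real..}. count_space (UNIV :: nat set)) (\<lambda>j x. \<lambda>t\<in>{0..}. N j t x) UNIV"
      using ic by (simp add: independent_clocks_def)
    let ?Q = "\<Pi>\<^sub>M t\<in>{0::real..}. count_space (UNIV :: nat set)"
    define C where "C = {f \<in> space ?Q. 0 < f (real (Suc k) * h) - f (real k * h)}"
    have C: "C \<in> sets ?Q"
    proof -
      have [measurable]: "(\<lambda>f. f t) \<in> measurable ?Q (count_space UNIV)" if "0 \<le> t" for t
        using that by (intro measurable_component_singleton) auto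
      have "(\<lambda>f. f (real (Suc k) * h) - f (real k * h)) \<in> measurable ?Q (count_space UNIV)"
        using h by (intro diff_nat_measurable) auto
      then have "Measurable.pred ?Q (\<lambda>f. 0 < f (real (Suc k) * h) - f (real k * h))"
        by (rule measurable_compose[where g = "\<lambda>n. 0 < n"]) simp
      then show ?thesis unfolding C_def by measurable
    qed
    have X: "(\<lambda>t\<in>{0..}. N r t x) \<in> C \<longleftrightarrow> 0 < inc h k r x" for r x
      using h by (auto simp: C_def inc_def space_PiM)
    have "prob (\<Inter>r\<in>{s, s'}. (\<lambda>x. \<lambda>t\<in>{0..}. N r t x) -` C \<inter> space M)
        = (\<Prod>r\<in>{s, s'}. prob ((\<lambda>x. \<lambda>t\<in>{0..}. N r t x) -` C \<inter> space M))"
      by (rule indep_varsD[OF ind]) (use C in auto)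
    moreover have "(\<lambda>x. \<lambda>t\<in>{0..}. N r t x) -` C \<inter> space M = {x \<in> space M. (0 < inc h k r x) = True}" for r
      by (auto simp: X)
    moreover have "(\<Inter>r\<in>{s, s'}. {x \<in> space M. (0 < inc h k r x) = True}) = {x \<in> space M. 0 < inc h k s x \<and> 0 < inc h k s' x}"
      by auto
    ultimately have "prob {x \<in> space M. 0 < inc h k s x \<and> 0 < inc h k s' x} = (1 - exp (- h))\<^sup>2"
      using that inc_zero_prob[OF h, of k s True] inc_zero_prob[OF h, of k s' True] by (simp add: power2_eq_square)
    also have "\<dots> \<le> h\<^sup>2"
      using exp_ge_add_one_self[of "-h"] h by (intro power_mono) auto
    finally show ?thesis .
  qed
  have pA: "prob (?A k) \<le> real (card S) * h\<^sup>2" for k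
  proof -
    have "prob (?A k) \<le> (\<Sum>s\<in>S. prob {x \<in> space M. 2 \<le> inc h k s x})"
      using m1 S by (intro finite_measure_subadditive_finite) auto
    also have "\<dots> \<le> (\<Sum>s\<in>S. h\<^sup>2)" by (intro sum_mono inc_two_prob h)
    finally show ?thesis by simp
  qed
  have cardP: "real (card ?P) + real (card S) \<le> 2 * (real (card S))\<^sup>2"
  proof -
    have "card ?P \<le> card (S \<times> S)" using S by (intro card_mono) auto
    then have "real (card ?P) \<le> (real (card S))\<^sup>2"
      by (simp add: card_cartesian_product power2_eq_square flip: of_nat_mult)
    moreover have "real (card S) \<le> (real (card S))\<^sup>2"
      by (cases "card S = 0") (auto simp: power2_eq_square)
    ultimately show ?thesis by linarith
  qed
  have pB: "prob (?B k) \<le> real (card ?P) * h\<^sup>2" for k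
  proof -
    have "prob (?B k) \<le> (\<Sum>(s, s')\<in>?P. prob {x \<in> space M. 0 < inc h k s x \<and> 0 < inc h k s' x})"
      using m2 finP finite_measure_subadditive_finite[of ?P "\<lambda>(s, s'). {x \<in> space M. 0 < inc h k s x \<and> 0 < inc h k s' x}"]
      by (auto simp: case_prod_unfold)
    also have "\<dots> \<le> (\<Sum>(s, s')\<in>?P. h\<^sup>2)" using pair by (intro sum_mono) auto
    finally show ?thesis by (simp add: case_prod_unfold)
  qed
  have pk: "prob (?A k \<union> ?B k) \<le> 2 * (real (card S))\<^sup>2 * h\<^sup>2" for k
  proof -
    have "prob (?A k \<union> ?B k) \<le> prob (?A k) + prob (?B k)"
      using A B by (rule measure_Un_le)
    also have "\<dots> \<le> (real (card ?P) + real (card S)) * h\<^sup>2"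
      using pA[of k] pB[of k] by (simp add: algebra_simps)
    also have "\<dots> \<le> 2 * (real (card S))\<^sup>2 * h\<^sup>2" using cardP by (intro mult_right_mono) auto
    finally show ?thesis .
  qed
  have "prob (crowded S h K) \<le> (\<Sum>k<K. prob (?A k \<union> ?B k))"
    unfolding crowded_def by (rule finite_measure_subadditive_finite) (use AB in blast)+
  also have "\<dots> \<le> (\<Sum>k<K. 2 * (real (card S))\<^sup>2 * h\<^sup>2)" by (intro sum_mono pk)
  finally show "prob (crowded S h K) \<le> 2 * real K * (real (card S))\<^sup>2 * h\<^sup>2" by simp
qed

lemma box_chain_eq_exec:
  fixes w j h K
  assumes h: "0 < h" and x: "x \<in> space M" "\<And>j. counting_path (\<lambda>t. N j t x)"
    and nc: "x \<notin> crowded {leftmost w..j} h K"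
  defines "ss \<equiv> sorted_list_of_set {leftmost w..j}"
  shows "box_chain (\<lambda>j t. N j t x) w j (real K * h)
    = exec (concat (replicate K ss)) (bits ss (\<lambda>k s. 0 < inc h k s x) K) w"
proof -
  let ?c = "\<lambda>j t. N j t x"
  have "box_chain ?c w j (real k * h) = exec (concat (replicate k ss)) (bits ss (\<lambda>k s. 0 < inc h k s x) k) w"
    if "k \<le> K" for k
    using that
  proof (induction k)
    case 0
    have "{0 :: real<..0} = {}" by simp
    then show ?case by (simp add: box_chain_def)
  next
    case (Suc k)
    have "box_chain ?c w j (real (Suc k) * h)
        = exec ss (map (\<lambda>s. 0 < ?c s (real (Suc k) * h) - ?c s (real k * h)) ss) (box_chain ?c w j (real k * h))"
    proof (rule box_chain_slot[OF x(2)])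
      show "0 \<le> real k * h" "real k * h < real (Suc k) * h" using h by (auto simp: algebra_simps)
      show "ss = sorted_list_of_set {leftmost w..j}" by (simp add: ss_def)
      have k: "k < K" using Suc.prems by simp
      show "?c s (real (Suc k) * h) \<le> ?c s (real k * h) + 1" if "s \<in> set ss" for s
      proof -
        have "\<not> 2 \<le> inc h k s x" using nc that k x(1) by (force simp: crowded_def ss_def)
        then show ?thesis by (simp add: inc_def)
      qed
      show "?c s (real (Suc k) * h) = ?c s (real k * h) \<or> ?c s' (real (Suc k) * h) = ?c s' (real k * h)"
        if s: "s \<in> set ss" "s' \<in> set ss" "s \<noteq> s'" for s s'
      proof -
        have "\<not> (0 < inc h k s x \<and> 0 < inc h k s' x)"
          using nc s k x(1) unfolding crowded_def ss_def by fastforce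
        moreover have mono: "?c r (real k * h) \<le> ?c r (real (Suc k) * h)" for r
          using h by (intro counting_path_mono[OF x(2)]) (auto simp: algebra_simps)
        ultimately show ?thesis using mono[of s] mono[of s'] unfolding inc_def by linarith
      qed
    qed
    moreover have "exec (concat (replicate (Suc k) ss)) (bits ss (\<lambda>k s. 0 < inc h k s x) (Suc k)) w
        = exec ss (map (\<lambda>s. 0 < inc h k s x) ss) (exec (concat (replicate k ss)) (bits ss (\<lambda>k s. 0 < inc h k s x) k) w)"
      unfolding rounds_Suc bits_Suc by (rule exec_append) simp
    moreover have "k \<le> K" using Suc.prems by simp
    ultimately show ?case using Suc.IH by (simp only: inc_def)
  qed
  then show ?thesis by simp
qed

text \<open>A measurable event E covering the bad outcomes is exhibited, which avoids any claim
  about the measurability of the box chain itself. Outside E, for counting paths, the box chain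
  agrees with the discretised one.\<close>

theorem box_chain_tail:
  fixes w j T and A :: "(int \<Rightarrow> bool) set"
  assumes T: "0 < T" and K: "0 < K"
  defines "ss \<equiv> sorted_list_of_set {leftmost w..j}"
  shows "\<exists>E\<in>events. prob E \<le> expect (1 - exp (- (T / real K))) (concat (replicate K ss)) (\<lambda>z. of_bool (z \<in> A)) w
      + 2 * (real (card {leftmost w..j}))\<^sup>2 * T\<^sup>2 / real K \<and>
    (\<forall>x\<in>space M. (\<forall>j. counting_path (\<lambda>t. N j t x)) \<longrightarrow> x \<notin> E \<longrightarrow> box_chain (\<lambda>j t. N j t x) w j T \<notin> A)"
proof -
  define h where "h = T / real K"
  have h: "0 < h" "real K * h = T" using T K by (auto simp: h_def)
  define Z where "Z x = exec (concat (replicate K ss)) (bits ss (\<lambda>k s. 0 < inc h k s x) K) w" for x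
  define E where "E = {x \<in> space M. Z x \<in> A} \<union> crowded {leftmost w..j} h K"
  note ep = exec_prob[OF h(1), of ss K w A, folded Z_def]
  have ss: "distinct ss" by (simp add: ss_def)
  note cr = crowded_prob[OF h(1), of "{leftmost w..j}" K]
  have "prob E \<le> prob {x \<in> space M. Z x \<in> A} + prob (crowded {leftmost w..j} h K)"
    unfolding E_def using ep(1)[OF ss] cr(1) by (intro measure_Un_le) auto
  also have "2 * real K * (real (card {leftmost w..j}))\<^sup>2 * h\<^sup>2 = 2 * (real (card {leftmost w..j}))\<^sup>2 * T\<^sup>2 / real K"
    using K by (simp add: h_def field_simps power2_eq_square)
  then have "prob (crowded {leftmost w..j} h K) \<le> 2 * (real (card {leftmost w..j}))\<^sup>2 * T\<^sup>2 / real K"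
    using cr(2) by simp
  finally have "prob E \<le> expect (1 - exp (- h)) (concat (replicate K ss)) (\<lambda>z. of_bool (z \<in> A)) w
      + 2 * (real (card {leftmost w..j}))\<^sup>2 * T\<^sup>2 / real K"
    unfolding ep(2)[OF ss] by linarith
  moreover have "E \<in> events" using ep(1)[OF ss] cr(1) by (auto simp: E_def)
  moreover have "box_chain (\<lambda>j t. N j t x) w j T \<notin> A"
    if "x \<in> space M" "\<forall>j. counting_path (\<lambda>t. N j t x)" "x \<notin> E" for x
    using box_chain_eq_exec[OF h(1) that(1), of w j K] that h(2) by (auto simp: E_def Z_def ss_def)
  ultimately show ?thesis unfolding h_def by blast
qed

text \<open>A common ring by time m puts two rings into one slot of every subdivision of the
  interval up to m + 1. It thus lies in all the corresponding events \<open>crowded\<close>, whose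
  probabilities are at most 8 * (m + 1) ^ 2 / K for each K.\<close>

lemma AE_no_simultaneous: "AE x in M. \<forall>s s' t. s \<noteq> s' \<longrightarrow> \<not> (rings (\<lambda>t. N s t x) t \<and> rings (\<lambda>t. N s' t x) t)"
proof -
  have "AE x in M. \<forall>m s s'. s \<noteq> s' \<longrightarrow> (\<exists>K>0. x \<notin> crowded {s, s'} (real (Suc m) / real K) K)"
  proof (unfold AE_all_countable, intro allI impI)
    fix m :: nat and s s' :: int
    show "AE x in M. s \<noteq> s' \<longrightarrow> (\<exists>K>0. x \<notin> crowded {s, s'} (real (Suc m) / real K) K)"
    proof (cases "s = s'")
      case False
      let ?F = "\<Inter>K\<in>{0<..}. crowded {s, s'} (real (Suc m) / real K) K"
      have h: "0 < real (Suc m) / real K" if "0 < K" for K using that by simp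
      have ev: "?F \<in> events" using crowded_prob(1)[OF h] by (intro sets.countable_INT) auto
      have le: "prob ?F \<le> 8 * (real (Suc m))\<^sup>2 / real K" if "0 < K" for K
      proof -
        have "prob ?F \<le> prob (crowded {s, s'} (real (Suc m) / real K) K)"
          using that crowded_prob(1)[OF h[OF that]] by (intro finite_measure_mono) auto
        also have "\<dots> \<le> 2 * real K * (real (card {s, s'}))\<^sup>2 * (real (Suc m) / real K)\<^sup>2"
          by (rule crowded_prob(2)[OF h[OF that]]) simp
        also have "\<dots> = 8 * (real (Suc m))\<^sup>2 / real K"
          using that False by (simp add: power2_eq_square field_simps)
        finally show ?thesis .
      qed
      have "prob ?F \<le> 0"
      proof (rule field_le_epsilon)
        fix e :: real assume e: "0 < e"
        obtain K :: nat where K: "8 * (real (Suc m))\<^sup>2 / e < real K" using reals_Archimedean2 by blast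
        have K0: "0 < K"
        proof (rule ccontr)
          assume "\<not> 0 < K"
          moreover have "0 \<le> 8 * (real (Suc m))\<^sup>2 / e" using e by simp
          ultimately show False using K by simp
        qed
        have "8 * (real (Suc m))\<^sup>2 / real K \<le> e"
          using K K0 e by (simp add: field_simps)
        with le[OF K0] show "prob ?F \<le> 0 + e" by simp
      qed
      then have "prob ?F = 0" using measure_nonneg[of M ?F] by linarith
      then have "?F \<in> null_sets M" using ev by (simp only: null_sets_def emeasure_eq_measure) simp
      from AE_not_in[OF this] show ?thesis by (rule eventually_mono) (simp, blast)
    qed simp
  qed
  with AE_counting AE_space show ?thesis
  proof (eventually_elim, intro allI impI notI)
    fix x and s s' :: int and t
    assume x: "x \<in> space M" and cp: "\<forall>j. counting_path (\<lambda>t. N j t x)"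
      and nc: "\<forall>m s s'. s \<noteq> s' \<longrightarrow> (\<exists>K>0. x \<notin> crowded {s, s'} (real (Suc m) / real K) K)"
      and ne: "s \<noteq> s'" and r: "rings (\<lambda>t. N s t x) t \<and> rings (\<lambda>t. N s' t x) t"
    have t: "0 < t" using r by (simp add: rings_def)
    obtain m where m: "t \<le> real m" using real_arch_simple by blast
    obtain K where K: "0 < K" "x \<notin> crowded {s, s'} (real (Suc m) / real K) K"
      using nc ne by blast
    define h where "h = real (Suc m) / real K"
    have h: "0 < h" "real K * h = real (Suc m)" using K(1) by (auto simp: h_def)
    \<comment> \<open>Slots are open on the left and closed on the right, hence the ceiling; it is
      at least 1 because t is positive.\<close>
    define k where "k = nat \<lceil>t / h\<rceil> - 1"
    have c1: "1 \<le> \<lceil>t / h\<rceil>" using t h by (simp add: one_le_ceiling)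
    then have "1 \<le> nat \<lceil>t / h\<rceil>" by linarith
    then have "real k = real (nat \<lceil>t / h\<rceil>) - 1" unfolding k_def by (subst of_nat_diff) auto
    also have "real (nat \<lceil>t / h\<rceil>) = of_int \<lceil>t / h\<rceil>" using c1 by linarith
    finally have rk: "real k = of_int \<lceil>t / h\<rceil> - 1" .
    have "real k < t / h" "t / h \<le> real k + 1" unfolding rk by linarith+
    then have tk: "real k * h < t" "t \<le> real (Suc k) * h"
      using h(1) by (auto simp: field_simps)
    have "real k * h < real K * h" using tk(1) m h(2) by linarith
    then have k: "k < K" using h(1) by simp
    have "0 < inc h k r' x" if "rings (\<lambda>t. N r' t x) t" for r'
    proof -
      have "N r' (real k * h) x < N r' t x"
        using rings_less[OF that, of "real k * h"] tk h by simp
      also have "\<dots> \<le> N r' (real (Suc k) * h) x"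
        using counting_path_mono[OF spec[OF cp], of t "real (Suc k) * h" r'] t tk by simp
      finally show ?thesis by (simp add: inc_def)
    qed
    then have "x \<in> crowded {s, s'} h K"
      using r ne k x unfolding crowded_def by (intro UN_I[of k] UnI2 UN_I[of "(s, s')"]) auto
    with K(2) show False by (simp add: h_def)
  qed
qed

end

section \<open>The potential for the upper bound\<close>

text \<open>
  The correction, in hundredths, for runs of \<open>k\<close> ones, \<open>m\<close> zeros and \<open>l\<close> ones, where \<open>8\<close> stands for
  all longer runs as well. The numbers come from a numerical minimisation of the drift.
\<close>

definition upper_table :: "int list list list" where
  "upper_table =
   [[[0,4,12,20,27,34,43,51],
     [13,16,23,30,36,46,50,57],
     [33,37,44,50,61,65,68,74],
     [56,60,66,79,83,86,89,94],
     [78,83,97,101,105,108,111,116],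
     [101,116,121,125,128,131,134,138],
     [139,141,145,149,152,155,158,162],
     [201,203,207,210,212,214,216,218]],
    [[35,37,42,47,52,56,64,71],
     [43,44,48,52,56,63,66,71],
     [57,58,61,65,73,76,78,82],
     [72,73,76,85,87,89,91,95],
     [86,87,97,100,102,103,105,109],
     [101,110,112,114,116,117,119,122],
     [126,126,128,130,132,133,134,137],
     [179,179,180,181,182,183,184,185]],
    [[69,69,73,77,81,84,91,96],
     [74,74,77,80,83,89,91,95],
     [85,85,87,90,96,98,99,103],
     [96,96,98,105,106,108,109,113],
     [107,107,114,115,117,118,119,122],
     [119,124,126,127,128,129,130,133],
     [136,136,137,138,139,140,141,144],
     [181,180,181,181,182,182,183,183]],
    [[99,99,102,105,109,111,117,122],
     [103,103,105,107,109,114,116,120],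
     [112,111,113,115,120,121,122,126],
     [121,120,122,127,128,129,130,134],
     [131,130,135,136,138,139,139,142],
     [139,143,144,145,146,147,148,150],
     [153,152,153,153,154,155,156,158],
     [191,190,190,191,191,191,192,192]],
    [[127,126,129,132,134,137,141,146],
     [129,129,131,133,135,139,140,144],
     [137,136,138,139,143,144,145,149],
     [146,145,146,150,151,152,153,156],
     [153,153,157,158,159,159,160,163],
     [160,163,164,165,165,166,167,169],
     [171,170,170,171,172,172,173,175],
     [204,204,204,204,204,204,205,205]],
    [[151,151,153,156,158,160,164,168],
     [154,153,155,156,158,161,163,166],
     [161,161,162,163,166,167,168,171],
     [168,168,169,172,173,174,174,177],
     [175,174,177,178,179,180,180,182],
     [181,183,183,184,184,185,186,188],
     [189,188,189,189,190,190,191,193],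
     [219,218,218,218,219,219,219,219]],
    [[174,174,176,178,180,182,185,189],
     [177,177,178,180,181,184,185,188],
     [183,183,184,185,187,188,189,192],
     [189,189,189,192,193,194,194,197],
     [195,194,196,197,198,199,199,201],
     [200,201,201,202,203,203,204,206],
     [207,206,206,207,207,208,208,210],
     [234,233,233,233,233,233,233,234]],
    replicate 8 (replicate 8 297)]"

definition entry :: "nat \<Rightarrow> nat \<Rightarrow> nat \<Rightarrow> int" where
  "entry k m l = upper_table ! (k - 1) ! (m - 1) ! (l - 1)"

definition recip840 :: "nat \<Rightarrow> int" where
  "recip840 k = [840, 420, 280, 210, 168, 140, 120, 105] ! (k - 1)"

definition cap :: "nat \<Rightarrow> nat" where
  "cap n = min n 8"

definition best :: "nat \<Rightarrow> nat \<Rightarrow> int" where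
  "best a b = max (840 * entry a b 8 + 18 * (recip840 a + recip840 b)) (840 * Max (set (map (entry a b) [1..<8])))"

definition best_of :: "int list list \<Rightarrow> nat \<Rightarrow> nat \<Rightarrow> int" where
  "best_of bs a b = bs ! (a - 1) ! (b - 1)"

text \<open>
  The drift inequality multiplied by \<open>84000\<close>, a hundred times the least common multiple of
  \<open>1, \<dots>, 8\<close>; note \<open>241920 = 2.88 * 84000\<close>. A flip may turn the unknown fourth run into the third
  one, which is why \<open>best\<close> maximises over the last argument. The terms with \<open>36\<close>, \<open>18\<close> (in \<open>best\<close>) and
  \<open>17\<close> bound what the sums \<open>ssum\<close> and \<open>psum\<close> below contribute for runs longer than \<open>8\<close>. The
  check for \<open>k < 16\<close> covers all \<open>k\<close>, since only \<open>cap (k - j)\<close> with \<open>j < 8\<close> occurs.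
\<close>

definition upper_ok :: "int list list \<Rightarrow> nat \<Rightarrow> nat \<Rightarrow> nat \<Rightarrow> bool" where
  "upper_ok bs k m l \<longleftrightarrow>
     (let c = cap k; e = entry c m l; t = best_of bs c (cap (m + l)) - 840 * e in
      0 \<le> t \<and>
      84000 * int c + 840 * (\<Sum>j\<leftarrow>[1..<c]. entry j (cap (k - j)) m - e) + (best_of bs m l - 840 * e) + t
      + 840 * (\<Sum>i\<leftarrow>[1..<l]. entry c m i - e)
      + (if m = 8 then 36 * (\<Sum>j\<leftarrow>[1..<c]. recip840 j) else 0)
      + 17 * recip840 c * int (m + l - 8) \<le> 241920)"

text \<open>\<open>best\<close> in tabular form, so that the check by evaluation need not recompute
  the maxima for each triple of run lengths.\<close>

definition best_table :: "int list list" where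
  "best_table = map (\<lambda>a. map (best a) [1..<9]) [1..<9]"

lemma upper_table_check:
  "list_all (\<lambda>k. list_all (\<lambda>m. list_all (\<lambda>l. upper_ok best_table k m l) [1..<9]) [1..<9]) [1..<16]"
  by code_simp

text \<open>The second fact makes the tabulated part constant for first runs of length 8 or more.
  Cutting such a run at a position j \<ge> 8 then leaves this part unchanged, which reduces a sum
  over arbitrarily many cuts to a bounded one.\<close>

lemma upper_table_range:
  "list_all (\<lambda>k. list_all (\<lambda>m. list_all (\<lambda>l. 0 \<le> entry k m l \<and> entry k m l \<le> 300) [1..<9]) [1..<9]) [1..<9]"
  "list_all (\<lambda>m. list_all (\<lambda>l. entry 8 m l = entry 8 1 1) [1..<9]) [1..<9]"
  by code_simp+

section \<open>The part of the correction that grows with long runs\<close>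

definition qrt :: "nat \<Rightarrow> real" where
  "qrt i = sqrt (sqrt (real i))"

lemma qrt_nonneg [simp]: "0 \<le> qrt i"
  by (simp add: qrt_def)

lemma qrt_pow4: "qrt i ^ 4 = real i"
proof -
  have "qrt i ^ 4 = ((qrt i)\<^sup>2)\<^sup>2" by (simp flip: power_mult)
  then show ?thesis by (simp add: qrt_def)
qed

lemma qrt_mono: "i \<le> j \<Longrightarrow> qrt i \<le> qrt j"
  by (simp add: qrt_def)

lemma qrt_ge_1: "1 \<le> i \<Longrightarrow> 1 \<le> qrt i"
  by (simp add: qrt_def)

lemma qrt_le_sqrt: "qrt i \<le> sqrt (real i)"
proof (cases "i = 0")
  case False
  then have "1 * sqrt (real i) \<le> sqrt (real i) * sqrt (real i)" by (intro mult_right_mono) auto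
  then have "sqrt (real i) \<le> real i" by simp
  then show ?thesis by (simp add: qrt_def)
qed (simp add: qrt_def)

lemma qrt_div_antimono:
  assumes "1 \<le> i" "i \<le> j"
  shows "qrt j / real j \<le> qrt i / real i"
proof -
  have q: "1 \<le> qrt i" "qrt i \<le> qrt j" using assms qrt_ge_1 qrt_mono by auto
  then have "qrt i ^ 3 \<le> qrt j ^ 3" by (intro power_mono) auto
  then have "(qrt i * qrt j) * qrt i ^ 3 \<le> (qrt i * qrt j) * qrt j ^ 3"
    using q by (intro mult_left_mono) auto
  then have "qrt j * qrt i ^ 4 \<le> qrt i * qrt j ^ 4"
    by (simp add: power4_eq_xxxx power3_eq_cube ac_simps)
  then show ?thesis using assms by (simp add: qrt_pow4 field_simps)
qed

text \<open>
  Chosen such that breaking up a run of \<open>k\<close> ones decreases \<open>ssum\<close> at rate \<open>25 / 32 * vsum k\<close> or more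
  (\<open>conv_S_le\<close>), which exceeds the jump length \<open>k\<close>, up to \<open>8\<close>, by \<open>slack k\<close> (\<open>vsum_eq\<close>).
\<close>

definition coef :: "nat \<Rightarrow> real" where
  "coef i = (if i < 8 then 0 else (32 / 25 + qrt i / 200) / real i)"

definition ssum :: "nat \<Rightarrow> real" where
  "ssum n = (\<Sum>i<n. coef i)"

definition psum :: "nat \<Rightarrow> real" where
  "psum n = (\<Sum>i<n. coef i / real i)"

definition vsum :: "nat \<Rightarrow> real" where
  "vsum n = (\<Sum>i<n. real i * coef i)"

text \<open>The divisor is 200 * 32 / 25, from multiplying \<open>vsum\<close> by 25 / 32. The sum
  is of order n powr (5/4); this superlinear growth is what pays for squared jump lengths at a price
  b of smaller order than the box.\<close>

definition slack :: "nat \<Rightarrow> real" where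
  "slack n = (\<Sum>i\<in>{8..<n}. qrt i) / 256"

lemma coef_nonneg [simp]: "0 \<le> coef i"
  by (simp add: coef_def)

lemma ssum_Suc: "ssum (Suc n) = ssum n + coef n" by (simp add: ssum_def)
lemma psum_Suc: "psum (Suc n) = psum n + coef n / real n" by (simp add: psum_def)
lemma vsum_Suc: "vsum (Suc n) = vsum n + real n * coef n" by (simp add: vsum_def)

lemma ssum_mono: "m \<le> n \<Longrightarrow> ssum m \<le> ssum n"
  unfolding ssum_def by (intro sum_mono2) auto

lemma psum_mono: "m \<le> n \<Longrightarrow> psum m \<le> psum n"
  unfolding psum_def by (intro sum_mono2) auto

lemma ssum_small: "n \<le> 8 \<Longrightarrow> ssum n = 0" by (simp add: ssum_def coef_def)
lemma psum_small: "n \<le> 8 \<Longrightarrow> psum n = 0" by (simp add: psum_def coef_def)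
lemma vsum_small: "n \<le> 8 \<Longrightarrow> vsum n = 0" by (simp add: vsum_def coef_def)

lemma ssum_nonneg [simp]: "0 \<le> ssum n" by (simp add: ssum_def sum_nonneg)
lemma psum_nonneg [simp]: "0 \<le> psum n" by (simp add: psum_def sum_nonneg)
lemma slack_nonneg [simp]: "0 \<le> slack n" by (simp add: slack_def sum_nonneg)

lemma coef_antimono: "8 \<le> i \<Longrightarrow> i \<le> j \<Longrightarrow> coef j \<le> coef i"
proof -
  assume ij: "8 \<le> i" "i \<le> j"
  have "qrt j / real j \<le> qrt i / real i" using ij by (intro qrt_div_antimono) auto
  moreover have "1 / real j \<le> 1 / real i" using ij by (intro divide_left_mono) auto
  moreover have "coef n = 32 / 25 * (1 / real n) + (qrt n / real n) / 200" if "8 \<le> n" for n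
    using that by (simp add: coef_def field_simps)
  ultimately show ?thesis using ij by simp
qed

lemma coef_le: "coef i \<le> 17 / 100"
proof (cases "i < 8")
  case False
  then have "coef i \<le> coef 8" using coef_antimono[of 8 i] by simp
  also have "qrt 8 \<le> qrt 81" by (rule qrt_mono) simp
  then have "qrt 8 \<le> 3" by (simp add: qrt_def real_sqrt_eq_iff[symmetric] flip: real_sqrt_mult)
  then have "coef 8 \<le> 17 / 100" by (simp add: coef_def)
  finally show ?thesis .
qed (simp add: coef_def)

text \<open>Telescoping comparison: 1 / n ^ 2 is at most 1 / (n - 1/2) - 1 / (n + 1/2), and the
  fourth root contributes at most n powr (-3/2), bounded by 2 / sqrt (n - 1) - 2 / sqrt n. The limit
  of the resulting bound is below 9 / 50.\<close>

lemma psum_le: "psum n \<le> 9 / 50"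
proof (cases "n \<le> 8")
  case False
  have "psum n \<le> 32 / 25 * (2 / 15 - 1 / (real n - 1 / 2)) + (2 / sqrt 7 - 2 / sqrt (real n - 1)) / 200"
    using False[unfolded not_le, THEN less_imp_le]
  proof (induction n rule: dec_induct)
    case base
    show ?case by (simp add: psum_small)
  next
    case (step n)
    have n: "8 \<le> n" using step by simp
    show ?case
    proof -
      define r where "r = sqrt (real n)"
      define t where "t = sqrt (real n - 1)"
      have rt: "0 < t" "t \<le> r" "r * r = real n" "t * t = real n - 1"
        using n by (auto simp: r_def t_def)
      have "qrt n / (real n)\<^sup>2 \<le> r / (r * r)\<^sup>2"
        using qrt_le_sqrt[of n] n by (auto simp: rt r_def intro!: divide_right_mono)
      also have "\<dots> = 1 / (r * r * r)"
      proof -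
        have "0 < r" using rt by linarith
        then show ?thesis by (simp add: power2_eq_square)
      qed
      also have "\<dots> = 2 / (r * r * (r + r))"
        by (simp flip: mult_2)
      also have "\<dots> \<le> 2 / (r * t * (r + t))"
        using rt(1,2) by (intro divide_left_mono mult_mono mult_pos_pos add_pos_pos) auto
      also have "\<dots> = 2 / t - 2 / r"
      proof -
        have "(r - t) * (r + t) = 1" using rt by (simp add: algebra_simps)
        moreover have "2 / t - 2 / r = 2 * ((r - t) * (r + t)) / (r * t * (r + t))"
        proof -
          have "t \<noteq> 0" "r \<noteq> 0" "r + t \<noteq> 0" using rt(1,2) by auto
          then show ?thesis by (simp add: divide_simps)
        qed
        ultimately show ?thesis by simp
      qed
      finally have 1: "qrt n / (real n)\<^sup>2 \<le> 2 / t - 2 / r" .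
      have 2: "1 / (real n)\<^sup>2 \<le> 1 / (real n - 1 / 2) - 1 / (real n + 1 / 2)"
        using n by (simp add: divide_simps power2_eq_square) (simp add: algebra_simps)
      have 3: "coef n / real n = 32 / 25 * (1 / (real n)\<^sup>2) + (qrt n / (real n)\<^sup>2) / 200"
        using n by (simp add: coef_def field_simps power2_eq_square)
      have IH: "psum n \<le> 32 / 25 * (2 / 15 - 1 / (real n - 1 / 2)) + (2 / sqrt 7 - 2 / t) / 200"
        using step.IH by (simp add: t_def)
      have e: "real (Suc n) - 1 / 2 = real n + 1 / 2" "sqrt (real (Suc n) - 1) = r" by (auto simp: r_def)
      show ?thesis unfolding psum_Suc 3 e using 1 2 IH by argo
    qed
  qed
  also have "\<dots> \<le> 32 / 25 * (2 / 15) + (2 / sqrt 7) / 200"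
  proof -
    have "0 \<le> 1 / (real n - 1 / 2)" "0 \<le> 2 / sqrt (real n - 1)" using False by auto
    moreover have "32 / 25 * (2 / 15 - u) + (y - v) / 200 \<le> 32 / 25 * (2 / 15) + y / 200"
      if "0 \<le> u" "0 \<le> v" for u v y :: real
      using that by (simp add: field_simps)
    ultimately show ?thesis by blast
  qed
  also have "\<dots> \<le> 9 / 50"
  proof -
    have "2 \<le> sqrt 7" by (rule real_le_rsqrt) simp
    then have "2 / sqrt 7 \<le> 1" by simp
    then have "2 / sqrt 7 / 200 \<le> 1 / 200" by (rule divide_right_mono) simp
    then show ?thesis by linarith
  qed
  finally show ?thesis .
qed (simp add: psum_small)

text \<open>The total loss of \<open>ssum\<close> when a first run of length k is cut once at each
  inner position. Passing from k to k + 1 adds \<open>coef k\<close> to each of k terms.\<close>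

lemma sum_S_diff: "(\<Sum>j\<in>{1..<k}. ssum k - ssum j) = vsum k"
proof (induction k)
  case (Suc k)
  show ?case
  proof (cases "k = 0")
    case False
    have "(\<Sum>j\<in>{1..<Suc k}. ssum (Suc k) - ssum j) = (\<Sum>j\<in>{1..<Suc k}. (ssum k - ssum j) + coef k)"
      by (intro sum.cong) (auto simp: ssum_Suc)
    also have "\<dots> = (\<Sum>j\<in>{1..<Suc k}. ssum k - ssum j) + real k * coef k"
      by (simp add: sum.distrib)
    also have "(\<Sum>j\<in>{1..<Suc k}. ssum k - ssum j) = (\<Sum>j\<in>{1..<k}. ssum k - ssum j)"
      using False by simp
    finally show ?thesis using Suc by (simp add: vsum_Suc)
  qed (simp add: vsum_def)
qed (simp add: vsum_def)

text \<open>\<open>psum\<close> is built for this identity: the cuts of a run of length l lose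
  \<open>ssum l\<close> in total, which balances the terms \<open>ssum l\<close> arising when the
  third run moves forward or is merged.\<close>

lemma sum_P_diff: "(\<Sum>i\<in>{1..<l}. psum l - psum i) = ssum l"
proof (induction l)
  case (Suc k)
  show ?case
  proof (cases "k = 0")
    case False
    have "(\<Sum>j\<in>{1..<Suc k}. psum (Suc k) - psum j) = (\<Sum>j\<in>{1..<Suc k}. (psum k - psum j) + coef k / real k)"
      by (intro sum.cong) (auto simp: psum_Suc)
    also have "\<dots> = (\<Sum>j\<in>{1..<Suc k}. psum k - psum j) + coef k"
      using False by (simp add: sum.distrib)
    also have "(\<Sum>j\<in>{1..<Suc k}. psum k - psum j) = (\<Sum>j\<in>{1..<k}. psum k - psum j)"
      using False by simp
    finally show ?thesis using Suc by (simp add: ssum_Suc)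
  qed (simp add: ssum_def coef_def)
qed (simp add: ssum_def)

definition harm_part :: "nat \<Rightarrow> nat \<Rightarrow> real" where
  "harm_part a b = (\<Sum>j\<in>{a..<b}. 1 / real j)"

lemma harm_part_Suc: "a \<le> b \<Longrightarrow> harm_part a (Suc b) = harm_part a b + 1 / real b"
  by (simp add: harm_part_def)

text \<open>Up to k = 14 the claim is evaluated. From then on the left side grows by at most 1/7 +
  1/14 = 3/14 per step, the right side by 7/32.\<close>

lemma harm_split_le: "8 \<le> k \<Longrightarrow> harm_part 1 (k - 7) + harm_part 8 k \<le> 7 / 32 * real k"
proof -
  have small: "harm_part 1 (k - 7) + harm_part 8 k \<le> 7 / 32 * real k" if "k \<in> {8, 9, 10, 11, 12, 13, 14}" for k
    using that by (auto simp: harm_part_def numeral_eq_Suc atLeastLessThanSuc)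
  assume "8 \<le> k"
  then show ?thesis
  proof (induction k rule: dec_induct)
    case base
    then show ?case by (intro small) simp
  next
    case (step k)
    show ?case
    proof (cases "k < 14")
      case True
      then have "Suc k \<in> {8, 9, 10, 11, 12, 13, 14}" using step by auto
      then show ?thesis by (rule small)
    next
      case False
      have "harm_part 1 (Suc k - 7) = harm_part 1 (k - 7) + 1 / real (k - 7)"
      proof -
        have "Suc k - 7 = Suc (k - 7)" using False by simp
        then show ?thesis using False by (simp only:) (intro harm_part_Suc, simp)
      qed
      moreover have "harm_part 8 (Suc k) = harm_part 8 k + 1 / real k"
        using False by (simp add: harm_part_Suc)
      moreover have "1 / real (k - 7) \<le> 1 / 7" "1 / real k \<le> 1 / 14"
        using False by (auto intro!: divide_left_mono)
      moreover have "a + u + (b + v) \<le> 7 / 32 * (1 + x)"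
        if "u \<le> 1 / 7" "v \<le> 1 / 14" "a + b \<le> 7 / 32 * x" for a b u v x :: real
        using that by simp
      ultimately show ?thesis using step.IH by (simp only: of_nat_Suc)
    qed
  qed
qed

text \<open>From 8 on, i * coef i is nondecreasing, so coef (k - j) \<le> k * coef k / (k - j).
  Partial fractions of 1 / (j * (k - j)) then leave two harmonic sums, whose ranges reflect that
  \<open>coef\<close> vanishes below 8.\<close>

lemma conv_coef_le:
  assumes "8 \<le> k"
  shows "(\<Sum>j\<in>{1..<k}. coef (k - j) / real j) \<le> 7 / 32 * (real k * coef k)"
proof -
  have v: "real i * coef i \<le> real k * coef k" if "i \<le> k" "8 \<le> i" for i
    using that assms qrt_mono[of i k] by (simp add: coef_def)
  have "(\<Sum>j\<in>{1..<k}. coef (k - j) / real j) = (\<Sum>j\<in>{1..<k - 7}. coef (k - j) / real j)"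
    using assms by (intro sum.mono_neutral_right) (auto simp: coef_def)
  also have "\<dots> \<le> (\<Sum>j\<in>{1..<k - 7}. coef k * (1 / real j + 1 / real (k - j)))"
  proof (intro sum_mono)
    fix j assume j: "j \<in> {1..<k - 7}"
    then have "real (k - j) * coef (k - j) \<le> real k * coef k" by (intro v) auto
    then have "coef (k - j) \<le> real k * coef k / real (k - j)"
      using j by (subst pos_le_divide_eq) (auto simp: mult.commute)
    then have "coef (k - j) / real j \<le> real k * coef k / real (k - j) / real j"
      by (intro divide_right_mono) auto
    also have "\<dots> = coef k * (1 / real j + 1 / real (k - j))"
    proof -
      have "j \<le> k" using j unfolding atLeastLessThan_iff by arith
      then have "real k = real j + real (k - j)" by (simp add: of_nat_diff)
      moreover have "real j \<noteq> 0" "real (k - j) \<noteq> 0" using j by auto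
      ultimately show ?thesis by (simp add: field_simps)
    qed
    finally show "coef (k - j) / real j \<le> coef k * (1 / real j + 1 / real (k - j))" .
  qed
  also have "\<dots> = coef k * (harm_part 1 (k - 7) + harm_part 8 k)"
  proof -
    have "(\<Sum>j\<in>{1..<k - 7}. 1 / real (k - j)) = harm_part 8 k"
      unfolding harm_part_def
      by (rule sum.reindex_bij_witness[where i = "\<lambda>i. k - i" and j = "\<lambda>j. k - j"]) auto
    then show ?thesis by (simp add: harm_part_def sum.distrib flip: sum_distrib_left)
  qed
  also have "\<dots> \<le> coef k * (7 / 32 * real k)"
    using harm_split_le[OF assms] by (intro mult_left_mono) auto
  finally show ?thesis by (simp add: algebra_simps)
qed

lemma conv_S_le: "(\<Sum>j\<in>{1..<k}. ssum (k - j) / real j) \<le> 7 / 32 * vsum k"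
proof (induction k)
  case (Suc k)
  show ?case
  proof (cases "k < 8")
    case True
    then show ?thesis by (simp add: ssum_small vsum_small)
  next
    case False
    have "(\<Sum>j\<in>{1..<Suc k}. ssum (Suc k - j) / real j) = (\<Sum>j\<in>{1..<k}. ssum (Suc k - j) / real j)"
      using False by (simp add: ssum_small)
    also have "\<dots> = (\<Sum>j\<in>{1..<k}. ssum (k - j) / real j + coef (k - j) / real j)"
      by (intro sum.cong) (auto simp: ssum_Suc Suc_diff_le add_divide_distrib)
    also have "\<dots> \<le> 7 / 32 * vsum k + 7 / 32 * (real k * coef k)"
      unfolding sum.distrib using Suc conv_coef_le[of k] False by (intro add_mono) auto
    finally show ?thesis by (simp add: vsum_Suc algebra_simps)
  qed
qed (simp add: vsum_def)

lemma vsum_eq: "25 / 32 * vsum n = real (n - 8) + slack n"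
proof (induction n)
  case (Suc n)
  show ?case
  proof (cases "n < 8")
    case False
    have "real n * coef n = 32 / 25 + qrt n / 200" using False by (simp add: coef_def)
    moreover have "slack (Suc n) = slack n + qrt n / 256" using False by (simp add: slack_def add_divide_distrib)
    ultimately show ?thesis using Suc False by (simp add: vsum_Suc Suc_diff_le algebra_simps)
  qed (simp add: vsum_small slack_def)
qed (simp add: vsum_def slack_def)

text \<open>A cut of the first run at j moves the second run, of length m, to third place and
  creates psum m * (1 / j + 1 / (k - j)). Summed over j this is at most 9/25 times a harmonic sum,
  which \<open>coef\<close> dominates termwise from index 8 on.\<close>

lemma harm_P_le: "8 \<le> k \<Longrightarrow> 2 * harm_part 1 k * psum m \<le> ssum k + 9 / 25 * harm_part 1 8"
proof -
  assume k: "8 \<le> k"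
  have "9 / 25 * harm_part 1 k \<le> ssum k + 9 / 25 * harm_part 1 8"
    using k
  proof (induction k rule: dec_induct)
    case (step k)
    have "9 / 25 \<le> 32 / 25 + qrt k / 200" using qrt_nonneg[of k] by linarith
    then have "9 / 25 / real k \<le> (32 / 25 + qrt k / 200) / real k"
      by (rule divide_right_mono) simp
    also have "\<dots> = coef k" using step by (simp add: coef_def)
    finally have "9 / 25 * (1 / real k) \<le> coef k" by simp
    moreover have "harm_part 1 (Suc k) = harm_part 1 k + 1 / real k"
      using step by (intro harm_part_Suc) simp
    ultimately show ?case using step.IH unfolding ssum_Suc by linarith
  qed simp
  moreover have "2 * harm_part 1 k * psum m \<le> 2 * harm_part 1 k * (9 / 50)"
    using psum_le by (intro mult_left_mono) (auto simp: harm_part_def sum_nonneg)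
  ultimately show ?thesis by simp
qed

text \<open>From 8 on \<open>coef\<close> is nonincreasing, which favours subadditivity; the
  vanishing coefficients below 8 spoil it by at most 8 terms, each at most 17/100. The truncated
  difference cap m + cap l - 8 bounds their number.\<close>

lemma ssum_add_le: "ssum (m + l) \<le> ssum m + ssum l + 17 / 100 * real (cap m + cap l - 8)"
proof (cases "m \<le> 8 \<or> l \<le> 8")
  case False
  have "ssum (m + l) - ssum m - ssum l \<le> 17 / 100 * 8"
    using False[unfolded de_Morgan_disj not_le, THEN conjunct2, THEN less_imp_le]
  proof (induction l rule: dec_induct)
    case base
    have "ssum (m + n) \<le> ssum m + 17 / 100 * real n" for n
    proof (induction n)
      case (Suc n)
      then show ?case using coef_le[of "m + n"]
        unfolding add_Suc_right ssum_Suc of_nat_Suc distrib_left by linarith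
    qed simp
    from this[of 8] show ?case by (simp add: ssum_small)
  next
    case (step l)
    have "coef (m + l) \<le> coef l" using step by (intro coef_antimono) auto
    then show ?case using step by (simp add: ssum_Suc)
  qed
  then show ?thesis using False by (simp add: cap_def min_def)
next
  case True
  have *: "ssum (a + b) \<le> ssum a + ssum b + 17 / 100 * real (cap a + cap b - 8)" if "b \<le> 8" for a b
  proof -
    have "ssum (a + b) \<le> ssum a + 17 / 100 * real (cap a + b - 8)"
    proof (induction b)
      case (Suc b)
      show ?case
      proof (cases "a + b < 8")
        case True
        then show ?thesis by (simp add: ssum_small)
      next
        case False
        then have "cap a + Suc b - 8 = Suc (cap a + b - 8)" by (auto simp: cap_def)
        then show ?thesis using Suc coef_le[of "a + b"]
          by (simp only: add_Suc_right ssum_Suc of_nat_Suc distrib_left)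
      qed
    qed simp
    then show ?thesis using that by (simp add: cap_def min_absorb1 ssum_small)
  qed
  then show ?thesis using True *[of l m] *[of m l] by (auto simp: add.commute)
qed


section \<open>The correction as a function of run lengths, and its drift\<close>

definition cell :: "nat \<Rightarrow> nat \<Rightarrow> nat \<Rightarrow> real" where
  "cell k m l = real_of_int (entry (cap k) (cap m) (cap l)) / 100"

text \<open>Each term anticipates a change. When the front rings, the second run becomes the first
  and ssum m appears; that ring and the k - 1 cuts of the first run each remove ssum m / k, the same
  amount in total. Likewise ssum l / m, created by the ring of the front, and about ssum l / k,
  created by merging, are taken back by the cuts of the third run, which lose ssum l * (1 / k + 1 /
  m) in total.\<close>

definition pot :: "nat \<Rightarrow> nat \<Rightarrow> nat \<Rightarrow> real" where
  "pot k m l = cell k m l + ssum k + ssum m / real k + psum l * (1 / real k + 1 / real m)"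

lemma cap_simps [simp]: "n \<le> 8 \<Longrightarrow> cap n = n" "8 \<le> n \<Longrightarrow> cap n = 8" "cap n \<le> 8" "cap (cap n) = cap n"
  by (auto simp: cap_def)

lemma cap_pos [simp]: "Suc 0 \<le> cap n \<longleftrightarrow> Suc 0 \<le> n"
  by (auto simp: cap_def)

lemma entry_range:
  assumes "1 \<le> k" "1 \<le> m" "1 \<le> l" "k \<le> 8" "m \<le> 8" "l \<le> 8"
  shows "0 \<le> entry k m l" "entry k m l \<le> 300"
proof -
  have "k \<in> {1..<9}" "m \<in> {1..<9}" "l \<in> {1..<9}" using assms by auto
  then show "0 \<le> entry k m l" "entry k m l \<le> 300"
    using upper_table_range(1) unfolding list_all_iff set_upt by blast+
qed

lemma entry_const: "1 \<le> m \<Longrightarrow> 1 \<le> l \<Longrightarrow> m \<le> 8 \<Longrightarrow> l \<le> 8 \<Longrightarrow> entry 8 m l = entry 8 1 1"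
proof -
  assume "1 \<le> m" "1 \<le> l" "m \<le> 8" "l \<le> 8"
  then have "m \<in> {1..<9}" "l \<in> {1..<9}" by auto
  then show ?thesis using upper_table_range(2) unfolding list_all_iff set_upt by blast
qed

lemma cell_range: "1 \<le> k \<Longrightarrow> 1 \<le> m \<Longrightarrow> 1 \<le> l \<Longrightarrow> 0 \<le> cell k m l \<and> cell k m l \<le> 3"
  using entry_range[of "cap k" "cap m" "cap l"] by (auto simp: cell_def)

lemma cell_const: "8 \<le> k \<Longrightarrow> 1 \<le> m \<Longrightarrow> 1 \<le> l \<Longrightarrow> cell k m l = real_of_int (entry 8 1 1) / 100"
  using entry_const[of "cap m" "cap l"] by (simp add: cell_def)

lemma recip840: "1 \<le> k \<Longrightarrow> k \<le> 8 \<Longrightarrow> real_of_int (recip840 k) = 840 / real k"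
proof -
  assume "1 \<le> k" "k \<le> 8"
  then consider "k = 1" | "k = 2" | "k = 3" | "k = 4" | "k = 5" | "k = 6" | "k = 7" | "k = 8" by linarith
  then show ?thesis by cases (simp_all add: recip840_def)
qed

text \<open>For l < 8 the sum \<open>psum l\<close> vanishes and the entry is among those maximised
  in \<open>best\<close>. For l \<ge> 8 the entry is the one for 8, and psum l \<le> 9/50 = 18 * 840
  / 84000 produces the term with 18.\<close>

lemma best_ge:
  assumes "1 \<le> a" "a \<le> 8" "1 \<le> b" "b \<le> 8" "1 \<le> l" "1 \<le> a'" "a \<le> a'" "b \<le> b'"
  shows "real_of_int (entry a b (cap l)) / 100 + psum l * (1 / real a' + 1 / real b') \<le> real_of_int (best a b) / 84000"
proof (cases "l < 8")
  case True
  then have "entry a b l \<in> set (map (entry a b) [1..<8])" using assms by auto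
  then have "840 * entry a b l \<le> best a b" unfolding best_def by (intro max.coboundedI2) (auto intro: Max_ge)
  then have "840 * real_of_int (entry a b l) \<le> real_of_int (best a b)"
    by (metis of_int_le_iff of_int_mult of_int_numeral)
  then show ?thesis using True by (simp add: psum_small)
next
  case False
  have "840 * entry a b 8 + 18 * (recip840 a + recip840 b) \<le> best a b" by (simp add: best_def)
  then have "real_of_int (840 * entry a b 8 + 18 * (recip840 a + recip840 b)) \<le> real_of_int (best a b)"
    by (simp only: of_int_le_iff)
  then have 1: "840 * real_of_int (entry a b 8) + 18 * (840 / real a + 840 / real b) \<le> real_of_int (best a b)"
    using assms by (simp add: recip840)
  have 2: "psum l * (1 / real a' + 1 / real b') \<le> 9 / 50 * (1 / real a + 1 / real b)"
    using assms psum_le by (intro mult_mono add_mono divide_left_mono) auto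
  have "x / 100 + X \<le> B / 84000"
    if "840 * x + 18 * (840 / c + 840 / d) \<le> B" "X \<le> 9 / 50 * (1 / c + 1 / d)" for x X B c d :: real
  proof -
    have "84000 * X \<le> 84000 * (9 / 50 * (1 / c + 1 / d))" using that(2) by (intro mult_left_mono) auto
    also have "\<dots> = 18 * (840 / c + 840 / d)" by simp
    finally show ?thesis using that(1) by simp
  qed
  from this[OF 1 2] show ?thesis using False by simp
qed

lemma cap_le [simp]: "cap n \<le> n"
  by (simp add: cap_def)

lemma nth_map_upt_1: "1 \<le> n \<Longrightarrow> n \<le> 8 \<Longrightarrow> map f [1..<9] ! (n - 1) = f n"
  by (subst nth_map_upt) auto

lemma best_of_table: "1 \<le> a \<Longrightarrow> a \<le> 8 \<Longrightarrow> 1 \<le> b \<Longrightarrow> b \<le> 8 \<Longrightarrow> best_of best_table a b = best a b"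
  unfolding best_of_def best_table_def by (simp only: nth_map_upt_1)

lemma upper_ok_table:
  assumes "1 \<le> k" "k \<le> 15" "1 \<le> m" "m \<le> 8" "1 \<le> l" "l \<le> 8"
  shows "upper_ok best_table k m l"
proof -
  have "k \<in> {1..<16}" "m \<in> {1..<9}" "l \<in> {1..<9}" using assms by auto
  then show ?thesis
    using upper_table_check unfolding list_all_iff set_upt by blast
qed

text \<open>The terms are the jump length, the cuts of the first run, the ring of the front, the
  merging of second and third run, and the cuts of the third run. What grows with lengths beyond 8
  cancels or is absorbed, and the tabulated inequality remains. Merging enters through
  \<open>max 0\<close> because its site may lie outside the box and then does not ring.\<close>

theorem pot_drift:
  assumes pos: "1 \<le> k" "1 \<le> m" "1 \<le> l" "1 \<le> l'"
  shows "real k + (\<Sum>j\<in>{1..<k}. pot j (k - j) m - pot k m l) + (pot m l l' - pot k m l)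
      + max 0 (pot k (m + l) l' - pot k m l) + (\<Sum>i\<in>{1..<l}. pot k m i - pot k m l) \<le> 288 / 100 - slack k"
proof -
  let ?c = "cap k" and ?m = "cap m" and ?l = "cap l"
  let ?e = "entry ?c ?m ?l"
  let ?B = "\<lambda>a b. real_of_int (best a b) / 84000"
  have c: "1 \<le> ?c" "1 \<le> ?m" "1 \<le> ?l" using pos by auto
  let ?k = "min k 15"
  have cml: "cap (?m + ?l) = cap (m + l)" by (auto simp: cap_def)
  have ck: "cap ?k = ?c" by (auto simp: cap_def)
  have bt: "best_of best_table ?m ?l = best ?m ?l" "best_of best_table ?c (cap (m + l)) = best ?c (cap (m + l))"
    using pos by (auto intro!: best_of_table)
  have "upper_ok best_table ?k ?m ?l"
    using pos by (intro upper_ok_table) auto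
  then have ok: "0 \<le> best ?c (cap (m + l)) - 840 * ?e"
    "84000 * int ?c + 840 * (\<Sum>j\<in>{1..<?c}. entry j (cap (?k - j)) ?m - ?e) + (best ?m ?l - 840 * ?e)
      + (best ?c (cap (m + l)) - 840 * ?e) + 840 * (\<Sum>i\<in>{1..<?l}. entry ?c ?m i - ?e)
      + (if ?m = 8 then 36 * (\<Sum>j\<in>{1..<?c}. recip840 j) else 0) + 17 * recip840 ?c * int (?m + ?l - 8) \<le> 241920"
    unfolding upper_ok_def Let_def cml ck bt interv_sum_list_conv_sum_set_nat set_upt by blast+
  define t where "t = (?B ?c (cap (m + l)) - cell k m l) + (ssum (m + l) - ssum m) / real k"
  have cutsU: "(\<Sum>j\<in>{1..<k}. cell j (k - j) m - cell k m l) = (\<Sum>j\<in>{1..<?c}. entry j (cap (?k - j)) ?m - ?e) / 100"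
  proof -
    have "(\<Sum>j\<in>{1..<k}. cell j (k - j) m - cell k m l) = (\<Sum>j\<in>{1..<?c}. cell j (k - j) m - cell k m l)"
    proof (rule sum.mono_neutral_right)
      show "\<forall>j\<in>{1..<k} - {1..<?c}. cell j (k - j) m - cell k m l = 0"
      proof
        fix j assume "j \<in> {1..<k} - {1..<?c}"
        then have "8 \<le> j" "j < k" by (auto simp: cap_def)
        then show "cell j (k - j) m - cell k m l = 0" using pos by (simp add: cell_const)
      qed
    qed (auto simp: cap_def)
    also have "\<dots> = (\<Sum>j\<in>{1..<?c}. real_of_int (entry j (cap (?k - j)) ?m - ?e) / 100)"
    proof (intro sum.cong refl)
      fix j assume "j \<in> {1..<?c}"
      then have "j < 8" by (simp add: cap_def)
      then have "cap (?k - j) = cap (k - j)" by (auto simp: cap_def)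
      then show "cell j (k - j) m - cell k m l = real_of_int (entry j (cap (?k - j)) ?m - ?e) / 100"
        using \<open>j < 8\<close> by (simp add: cell_def diff_divide_distrib)
    qed
    also have "\<dots> = (\<Sum>j\<in>{1..<?c}. entry j (cap (?k - j)) ?m - ?e) / 100"
      by (simp flip: sum_divide_distrib)
    finally show ?thesis .
  qed
  have cutlU: "(\<Sum>i\<in>{1..<l}. cell k m i - cell k m l) = (\<Sum>i\<in>{1..<?l}. entry ?c ?m i - ?e) / 100"
  proof -
    have "(\<Sum>i\<in>{1..<l}. cell k m i - cell k m l) = (\<Sum>i\<in>{1..<?l}. cell k m i - cell k m l)"
      by (rule sum.mono_neutral_right) (auto simp: cap_def cell_def)
    also have "\<dots> = (\<Sum>i\<in>{1..<?l}. real_of_int (entry ?c ?m i - ?e) / 100)"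
      by (intro sum.cong refl) (auto simp: cell_def cap_def diff_divide_distrib)
    also have "\<dots> = (\<Sum>i\<in>{1..<?l}. entry ?c ?m i - ?e) / 100"
      by (simp flip: sum_divide_distrib)
    finally show ?thesis .
  qed
  have t0: "0 \<le> t"
  proof -
    have "840 * real_of_int ?e \<le> real_of_int (best ?c (cap (m + l)))" using ok(1) by linarith
    then have "cell k m l \<le> ?B ?c (cap (m + l))" by (simp add: cell_def)
    moreover have "0 \<le> (ssum (m + l) - ssum m) / real k" using ssum_mono[of m "m + l"] by simp
    ultimately show ?thesis by (simp add: t_def)
  qed
  have t1: "pot k (m + l) l' - pot k m l \<le> t"
  proof -
    have "cell k (m + l) l' + psum l' * (1 / real k + 1 / real (m + l)) \<le> ?B ?c (cap (m + l))"
      using pos best_ge[of ?c "cap (m + l)" l' k "m + l"] by (simp add: cell_def)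
    moreover have "0 \<le> psum l * (1 / real k + 1 / real m)" by simp
    ultimately show ?thesis unfolding pot_def t_def diff_divide_distrib by linarith
  qed
  have front: "pot m l l' - pot k m l \<le> (?B ?m ?l - cell k m l) + ssum m + ssum l / real m - ssum k - ssum m / real k"
  proof -
    have "cell m l l' + psum l' * (1 / real m + 1 / real l) \<le> ?B ?m ?l"
      using pos best_ge[of ?m ?l l' m l] by (simp add: cell_def)
    moreover have "0 \<le> psum l * (1 / real k + 1 / real m)" by simp
    ultimately show ?thesis unfolding pot_def by linarith
  qed
  have cuts: "(\<Sum>j\<in>{1..<k}. pot j (k - j) m - pot k m l)
      \<le> (\<Sum>j\<in>{1..<k}. cell j (k - j) m - cell k m l) - vsum k + 7 / 32 * vsum k + 2 * harm_part 1 k * psum m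
        - (real k - 1) * (ssum m / real k)"
  proof -
    have "(\<Sum>j\<in>{1..<k}. pot j (k - j) m - pot k m l)
        \<le> (\<Sum>j\<in>{1..<k}. (cell j (k - j) m - cell k m l) - (ssum k - ssum j) + ssum (k - j) / real j
            + psum m * (1 / real j + 1 / real (k - j)) - ssum m / real k)"
    proof (intro sum_mono)
      fix j
      have "0 \<le> psum l * (1 / real k + 1 / real m)" by simp
      moreover have "a + b + c + d - (e + f + g + h) \<le> (a - e) - (f - b) + c + d - g" if "0 \<le> h"
        for a b c d e f g h :: real
        using that by simp
      ultimately show "pot j (k - j) m - pot k m l \<le> (cell j (k - j) m - cell k m l) - (ssum k - ssum j) + ssum (k - j) / real j
            + psum m * (1 / real j + 1 / real (k - j)) - ssum m / real k"
        unfolding pot_def by blast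
    qed
    also have "\<dots> = (\<Sum>j\<in>{1..<k}. cell j (k - j) m - cell k m l) - vsum k + (\<Sum>j\<in>{1..<k}. ssum (k - j) / real j)
        + psum m * (\<Sum>j\<in>{1..<k}. 1 / real j + 1 / real (k - j)) - (real k - 1) * (ssum m / real k)"
    proof -
      have "(\<Sum>j\<in>{1..<k}. ssum m / real k) = (real k - 1) * (ssum m / real k)"
        by (simp only: sum_constant card_atLeastLessThan of_nat_diff[OF pos(1)] of_nat_1)
      moreover have "(\<Sum>j\<in>{1..<k}. psum m * (1 / real j + 1 / real (k - j)))
          = psum m * (\<Sum>j\<in>{1..<k}. 1 / real j + 1 / real (k - j))"
        by (rule sum_distrib_left[symmetric])
      moreover have "(\<Sum>j\<in>{1..<k}. f j - g j + h j + r j - c j) = sum f {1..<k} - sum g {1..<k}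
          + sum h {1..<k} + sum r {1..<k} - sum c {1..<k}" for f g h r c :: "nat \<Rightarrow> real"
        by (simp only: sum.distrib sum_subtractf)
      ultimately show ?thesis by (simp only: sum_S_diff)
    qed
    also have "(\<Sum>j\<in>{1..<k}. 1 / real j + 1 / real (k - j)) = 2 * harm_part 1 k"
    proof -
      have "(\<Sum>j\<in>{1..<k}. 1 / real (k - j)) = harm_part 1 k"
        unfolding harm_part_def
        by (rule sum.reindex_bij_witness[where i = "\<lambda>i. k - i" and j = "\<lambda>j. k - j"]) auto
      then show ?thesis by (simp add: harm_part_def sum.distrib)
    qed
    finally show ?thesis using conv_S_le[of k] by (simp add: algebra_simps)
  qed
  have cutl: "(\<Sum>i\<in>{1..<l}. pot k m i - pot k m l)
      = (\<Sum>i\<in>{1..<l}. cell k m i - cell k m l) - ssum l * (1 / real k + 1 / real m)"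
  proof -
    have "(\<Sum>i\<in>{1..<l}. pot k m i - pot k m l)
        = (\<Sum>i\<in>{1..<l}. (cell k m i - cell k m l) - (psum l - psum i) * (1 / real k + 1 / real m))"
      by (intro sum.cong refl) (simp add: pot_def algebra_simps)
    also have "\<dots> = (\<Sum>i\<in>{1..<l}. cell k m i - cell k m l) - (\<Sum>i\<in>{1..<l}. psum l - psum i) * (1 / real k + 1 / real m)"
      unfolding sum_distrib_right by (rule sum_subtractf)
    finally show ?thesis unfolding sum_P_diff .
  qed
  define d where "d = real (k - 8)"
  \<comment> \<open>The second runs created by the cuts use up 7/32 of the loss
    \<open>vsum k\<close>; the other 25/32 pays for the jump length beyond 8 and leaves the surplus
    \<open>slack k\<close>.\<close>
  have vsum: "- vsum k + 7 / 32 * vsum k = - d - slack k" using vsum_eq[of k, folded d_def] by argo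
  have kc: "real k = real ?c + d" unfolding d_def by (auto simp: cap_def)
  \<comment> \<open>The loss \<open>ssum k\<close> is supplied by the ring of the front, which
    removes the first run. What is left is at most 9/25 times a harmonic sum, and 36 = 84000 *
    (9/25) / 840.\<close>
  have H: "2 * harm_part 1 k * psum m - ssum k \<le> (if ?m = 8 then 36 * (\<Sum>j\<in>{1..<?c}. real_of_int (recip840 j)) / 84000 else 0)"
  proof (cases "m < 8")
    case True
    then show ?thesis by (simp add: psum_small)
  next
    case m: False
    have r: "(\<Sum>j\<in>{1..<a}. real_of_int (recip840 j)) = 840 * harm_part 1 a" if "a \<le> 8" for a
      unfolding harm_part_def sum_distrib_left using that by (intro sum.cong) (auto simp: recip840)
    have "2 * harm_part 1 k * psum m - ssum k \<le> 9 / 25 * harm_part 1 ?c"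
    proof (cases "8 \<le> k")
      case True
      then show ?thesis using harm_P_le[OF True, of m] by simp
    next
      case False
      have "2 * harm_part 1 k * psum m \<le> 2 * harm_part 1 k * (9 / 50)"
        using psum_le by (intro mult_left_mono) (auto simp: harm_part_def sum_nonneg)
      moreover have "?c = k" using False by simp
      ultimately show ?thesis using ssum_nonneg[of k] unfolding \<open>?c = k\<close> by linarith
    qed
    also have "\<dots> = 36 * (\<Sum>j\<in>{1..<?c}. real_of_int (recip840 j)) / 84000"
    proof -
      have "?c \<le> 8" by simp
      show ?thesis unfolding r[OF \<open>?c \<le> 8\<close>] by algebra
    qed
    finally have "2 * harm_part 1 k * psum m - ssum k \<le> 36 * (\<Sum>j\<in>{1..<?c}. real_of_int (recip840 j)) / 84000" .
    moreover have "?m = 8" using m by simp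
    ultimately show ?thesis by simp
  qed
  define y where "y = real_of_int (17 * recip840 ?c * int (?m + ?l - 8)) / 84000"
  have A: "(ssum (m + l) - ssum m - ssum l) / real k \<le> y"
  proof -
    have "(ssum (m + l) - ssum m - ssum l) / real k \<le> (17 / 100 * real (?m + ?l - 8)) / real k"
      using ssum_add_le[of m l] by (intro divide_right_mono) auto
    also have "\<dots> \<le> (17 / 100 * real (?m + ?l - 8)) / real ?c"
      using c pos by (intro divide_left_mono) (auto simp: cap_def)
    also have "\<dots> = y"
      using c unfolding y_def of_int_mult of_int_of_nat_eq by (simp add: recip840)
    finally show ?thesis .
  qed
  define X where "X = 84000 * int ?c + 840 * (\<Sum>j\<in>{1..<?c}. entry j (cap (?k - j)) ?m - ?e) + (best ?m ?l - 840 * ?e)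
      + (best ?c (cap (m + l)) - 840 * ?e) + 840 * (\<Sum>i\<in>{1..<?l}. entry ?c ?m i - ?e)
      + (if ?m = 8 then 36 * (\<Sum>j\<in>{1..<?c}. recip840 j) else 0) + 17 * recip840 ?c * int (?m + ?l - 8)"
  define zc where "zc = (\<Sum>j\<in>{1..<?c}. entry j (cap (?k - j)) ?m - ?e) / 100"
  define zl where "zl = (\<Sum>i\<in>{1..<?l}. entry ?c ?m i - ?e) / 100"
  define zm where "zm = (if ?m = 8 then 36 * (\<Sum>j\<in>{1..<?c}. real_of_int (recip840 j)) / 84000 else 0)"
  have X: "real_of_int X / 84000 = real ?c + zc
      + (?B ?m ?l - cell k m l) + (?B ?c (cap (m + l)) - cell k m l) + zl + zm + y"
    unfolding X_def cell_def zc_def zl_def zm_def y_def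
    by (simp add: add_divide_distrib diff_divide_distrib del: of_nat_diff)
  have "real_of_int X \<le> 241920" using ok(2) unfolding X_def[symmetric] by linarith
  then have X288: "real_of_int X / 84000 \<le> 288 / 100" by simp
  have Sm: "ssum m - ssum m / real k - (real k - 1) * (ssum m / real k) = 0"
    using pos(1) by (simp add: field_simps)
  have split: "(ssum (m + l) - ssum m - ssum l) / real k = (ssum (m + l) - ssum m) / real k - ssum l / real k"
    by (simp add: diff_divide_distrib)
  have Sl: "ssum l * (1 / real k + 1 / real m) = ssum l / real k + ssum l / real m" by (simp add: algebra_simps)
  have "max 0 (pot k (m + l) l' - pot k m l) \<le> t" using t0 t1 by simp
  then show ?thesis
    using cuts[unfolded cutsU, folded zc_def] front cutl[unfolded cutlU Sl, folded zl_def] vsum H[folded zm_def]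
      A[unfolded split] X X288 Sm kc t_def by linarith
qed

text \<open>
  Letting the bits alternate from \<open>J\<close> on keeps all runs finite, and flips in the box preserve it.
\<close>

definition boxed :: "int \<Rightarrow> int \<Rightarrow> (int \<Rightarrow> bool) set" where
  "boxed i J = {z. (\<forall>s<i. \<not> z s) \<and> (\<forall>s\<ge>J. z (s + 1) = (\<not> z s))}"

lemma closed_boxed: "closed_under_flips {i..J} (boxed i J)"
proof -
  have "flip s z \<in> boxed i J" if "z \<in> boxed i J" "i \<le> s" "s \<le> J" for z s
  proof -
    have "\<not> flip s z r" if "r < i" for r
      using \<open>z \<in> boxed i J\<close> \<open>i \<le> s\<close> that by (simp add: boxed_def flip_def)
    moreover have "flip s z (r + 1) = (\<not> flip s z r)" if "J \<le> r" for r
      using \<open>z \<in> boxed i J\<close> \<open>s \<le> J\<close> that by (simp add: boxed_def flip_def)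
    ultimately show ?thesis by (simp add: boxed_def)
  qed
  then show ?thesis by (simp add: closed_under_flips_def)
qed

section \<open>Leftmost ones, runs of equal bits, and the effect of a flip on them\<close>

lemma is_leftmost_unique: "is_leftmost z i \<Longrightarrow> is_leftmost z j \<Longrightarrow> i = j"
  unfolding is_leftmost_def by (meson linorder_neqE)

lemma leftmost_eq: "is_leftmost z i \<Longrightarrow> leftmost z = i"
  unfolding leftmost_def by (rule the_equality) (simp_all add: is_leftmost_unique)

lemma is_leftmost_exists:
  assumes z: "\<forall>s<i. \<not> z s" "z j"
  shows "\<exists>k. is_leftmost z k \<and> i \<le> k \<and> k \<le> j"
proof -
  define A where "A = {s \<in> {i..j}. z s}"
  define k where "k = Min A"
  have "i \<le> j" using z not_le by blast
  then have A: "finite A" "j \<in> A"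
    using z by (auto simp: A_def intro: finite_subset[of _ "{i..j}"])
  have k: "k \<in> A" unfolding k_def using A by (intro Min_in) auto
  have "\<not> z s" if "s < k" for s
  proof
    assume "z s"
    then have "\<not> s < i" using z(1) by blast
    then have "s \<in> A" using that k \<open>z s\<close> by (simp add: A_def)
    then have "k \<le> s" unfolding k_def using A(1) by (intro Min_le)
    with that show False by simp
  qed
  then have "is_leftmost z k" using k by (simp add: is_leftmost_def A_def)
  then show ?thesis using k by (auto simp: A_def)
qed

text \<open>Alternation from J on places a one at J or at J + 1, so the front can leave the box by
  one site at most.\<close>

lemma boxed_leftmost:
  assumes "z \<in> boxed i J" "i \<le> J + 1"
  shows "is_leftmost z (leftmost z) \<and> i \<le> leftmost z \<and> leftmost z \<le> J + 1"
proof -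
  have "z J \<or> z (J + 1)" and 0: "\<forall>s<i. \<not> z s" using assms(1) by (auto simp: boxed_def)
  then have "\<exists>j. j \<le> J + 1 \<and> z j" by (metis order_refl le_add_same_cancel1 zero_le_one)
  then have "\<exists>k. is_leftmost z k \<and> i \<le> k \<and> k \<le> J + 1"
    using is_leftmost_exists[OF 0] by (meson order_trans)
  then show ?thesis using leftmost_eq by auto
qed

text \<open>The block is maximal on the right only; therefore a flip at or to the left of its start
  turns it into a block of the complementary bit.\<close>

definition seg :: "(int \<Rightarrow> bool) \<Rightarrow> int \<Rightarrow> nat \<Rightarrow> bool \<Rightarrow> bool" where
  "seg z a n b \<longleftrightarrow> 1 \<le> n \<and> (\<forall>s. a \<le> s \<longrightarrow> s < a + int n \<longrightarrow> z s = b) \<and> z (a + int n) = (\<not> b)"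

definition run :: "(int \<Rightarrow> bool) \<Rightarrow> int \<Rightarrow> nat" where
  "run z a = (LEAST n. z (a + int n) \<noteq> z a)"

lemma run_eq:
  assumes "seg z a n b"
  shows "run z a = n"
  unfolding run_def
proof (rule Least_equality)
  have za: "z a = b" using assms by (auto simp: seg_def)
  then show "z (a + int n) \<noteq> z a" using assms by (simp add: seg_def)
  show "n \<le> y" if "z (a + int y) \<noteq> z a" for y
  proof (rule ccontr)
    assume "\<not> n \<le> y"
    then have "z (a + int y) = b" using assms by (simp add: seg_def)
    with that za show False by simp
  qed
qed

lemma seg_exists:
  assumes z: "z \<in> boxed i J"
  shows "\<exists>n. seg z a n (z a)"
proof -
  obtain n where n: "z (a + int n) \<noteq> z a"
  proof (cases "a \<le> J")
    case True
    have alt: "z (J + 1) = (\<not> z J)" using z by (simp add: boxed_def)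
    have e: "a + int (nat (J - a)) = J" "a + int (nat (J + 1 - a)) = J + 1" using True by simp_all
    show ?thesis
    proof (cases "z J = z a")
      case True
      then show ?thesis using that[of "nat (J + 1 - a)"] alt unfolding e by simp
    next
      case False
      then show ?thesis using that[of "nat (J - a)"] unfolding e by simp
    qed
  next
    case False
    then have "z (a + 1) \<noteq> z a" using z by (simp add: boxed_def)
    then show ?thesis using that[of 1] by simp
  qed
  define n0 where "n0 = (LEAST n. z (a + int n) \<noteq> z a)"
  have 1: "z (a + int n0) \<noteq> z a" unfolding n0_def using n by (rule LeastI)
  have 2: "z s = z a" if "a \<le> s" "s < a + int n0" for s
  proof -
    have "nat (s - a) < n0" using that by linarith
    then have "\<not> z (a + int (nat (s - a))) \<noteq> z a" unfolding n0_def by (rule not_less_Least)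
    then show ?thesis using that(1) by simp
  qed
  have "n0 \<noteq> 0" using 1 by (cases n0) simp_all
  then have "1 \<le> n0" by simp
  moreover have "z (a + int n0) = (\<not> z a)" using 1 by blast
  ultimately have "seg z a n0 (z a)" unfolding seg_def using 2 by blast
  then show ?thesis ..
qed

definition fpot :: "(int \<Rightarrow> bool) \<Rightarrow> real" where
  "fpot z = (let i = leftmost z; k = run z i; m = run z (i + int k) in
     real_of_int i + pot k m (run z (i + int k + int m)))"

lemma fpot_eq:
  assumes "is_leftmost z i" "seg z i k True" "seg z (i + int k) m False" "seg z (i + int k + int m) l True"
  shows "fpot z = real_of_int i + pot k m l"
  using leftmost_eq[OF assms(1)] run_eq[OF assms(2)] run_eq[OF assms(3)] run_eq[OF assms(4)]
  by (simp add: fpot_def Let_def)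

lemma seg_flip_left: "z s \<Longrightarrow> s \<le> a \<Longrightarrow> seg z a n b \<Longrightarrow> seg (flip s z) a n (\<not> b)"
  unfolding seg_def flip_def by auto

lemma seg_flip_right: "z s \<Longrightarrow> a + int n < s \<Longrightarrow> seg z a n b \<Longrightarrow> seg (flip s z) a n b"
  unfolding seg_def flip_def by auto

lemma seg_flip_cut:
  assumes "seg z a n True" "1 \<le> j" "j < n"
  shows "seg (flip (a + int j) z) a j True" "seg (flip (a + int j) z) (a + int j) (n - j) False"
  using assms unfolding seg_def flip_def by (auto simp: of_nat_diff)

lemma seg_flip_merge:
  assumes "seg z a n False" "seg z (a + int n) l True"
  shows "seg (flip (a + int n) z) a (n + l) False"
  using assms unfolding seg_def flip_def by (auto simp: add.assoc)

lemma leftmost_flip: "is_leftmost z i \<Longrightarrow> i < s \<Longrightarrow> is_leftmost (flip s z) i"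
  unfolding is_leftmost_def flip_def by auto

lemma leftmost_flip_front:
  assumes "is_leftmost z i" "seg z i k True"
  shows "is_leftmost (flip i z) (i + int k)"
  using assms unfolding is_leftmost_def seg_def flip_def by (auto simp: not_less)

text \<open>The correction reads three runs, but a ring of the front or the merging of the second
  and third run brings a fourth one, of length l', into view.\<close>

locale runs =
  fixes z :: "int \<Rightarrow> bool" and i J i0 :: int and k m l l' :: nat
  assumes box: "z \<in> boxed i0 J" and iJ: "i0 \<le> i" "i \<le> J"
    and lm: "is_leftmost z i"
    and s1: "seg z i k True" and s2: "seg z (i + int k) m False" and s3: "seg z (i + int k + int m) l True"
    and s4: "seg z (i + int k + int m + int l) l' False"
begin

lemma fpot: "fpot z = real_of_int i + pot k m l"
  using lm s1 s2 s3 by (rule fpot_eq)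

lemma pos: "1 \<le> k" "1 \<le> m" "1 \<le> l" "1 \<le> l'"
  using s1 s2 s3 s4 by (auto simp: seg_def)

lemma zi: "z i" using lm by (simp add: is_leftmost_def)

lemma flip_front: "fpot (flip i z) = real_of_int i + real k + pot m l l'"
proof -
  have "fpot (flip i z) = real_of_int (i + int k) + pot m l l'"
    using seg_flip_left[OF zi _ s2] seg_flip_left[OF zi _ s3] seg_flip_left[OF zi _ s4] leftmost_flip_front[OF lm s1]
    by (intro fpot_eq) (auto simp: add.assoc)
  then show ?thesis by simp
qed

lemma flip_cut:
  assumes "1 \<le> j" "j < k"
  shows "fpot (flip (i + int j) z) = real_of_int i + pot j (k - j) m"
proof (rule fpot_eq)
  have zj: "z (i + int j)" using s1 assms by (simp add: seg_def)
  have e: "i + int j + int (k - j) = i + int k" using assms by simp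
  show "is_leftmost (flip (i + int j) z) i" using assms by (intro leftmost_flip[OF lm]) simp
  show "seg (flip (i + int j) z) i j True" "seg (flip (i + int j) z) (i + int j) (k - j) False"
    using seg_flip_cut[OF s1 assms] .
  show "seg (flip (i + int j) z) (i + int j + int (k - j)) m True"
    unfolding e using seg_flip_left[OF zj _ s2] assms by simp
qed

lemma flip_merge: "fpot (flip (i + int k + int m) z) = real_of_int i + pot k (m + l) l'"
proof (rule fpot_eq)
  let ?s = "i + int k + int m"
  have zs: "z ?s" using s3 by (simp add: seg_def)
  show "is_leftmost (flip ?s z) i" using pos by (intro leftmost_flip[OF lm]) simp
  show "seg (flip ?s z) i k True" using seg_flip_right[OF zs _ s1] pos by simp
  show "seg (flip ?s z) (i + int k) (m + l) False" using seg_flip_merge[OF s2 s3] .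
  have "seg (flip ?s z) (i + int k + int m + int l) l' True" using seg_flip_left[OF zs _ s4] by simp
  then show "seg (flip ?s z) (i + int k + int (m + l)) l' True" by (simp add: add.assoc)
qed

lemma flip_last:
  assumes "1 \<le> r" "r < l"
  shows "fpot (flip (i + int k + int m + int r) z) = real_of_int i + pot k m r"
proof (rule fpot_eq)
  let ?s = "i + int k + int m + int r"
  have zs: "z ?s" using s3 assms by (simp add: seg_def)
  show "is_leftmost (flip ?s z) i" using pos by (intro leftmost_flip[OF lm]) simp
  show "seg (flip ?s z) i k True" using seg_flip_right[OF zs _ s1] pos by simp
  show "seg (flip ?s z) (i + int k) m False" using seg_flip_right[OF zs _ s2] assms by simp
  show "seg (flip ?s z) (i + int k + int m) r True" using seg_flip_cut(1)[OF s3 assms] .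
qed

lemma flip_far:
  assumes "z s" "i + int k + int m + int l \<le> s"
  shows "fpot (flip s z) = fpot z"
proof -
  have "\<not> z (i + int k + int m + int l)" using s3 by (simp add: seg_def)
  then have s: "i + int k + int m + int l < s" using assms by (cases "s = i + int k + int m + int l") auto
  have "fpot (flip s z) = real_of_int i + pot k m l"
  proof (rule fpot_eq)
    show "is_leftmost (flip s z) i" using s pos by (intro leftmost_flip[OF lm]) simp
    show "seg (flip s z) i k True" using seg_flip_right[OF assms(1) _ s1] s by simp
    show "seg (flip s z) (i + int k) m False" using seg_flip_right[OF assms(1) _ s2] s by simp
    show "seg (flip s z) (i + int k + int m) l True" using seg_flip_right[OF assms(1) _ s3] s by simp
  qed
  then show ?thesis by (simp add: fpot)
qed

text \<open>Alternation makes long runs impossible beyond J: a run that starts by J, or is longer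
  than 1, ends by J + 1. So every site at which the first or third run can be cut lies in the box;
  only the first site of the third run may fall outside.\<close>

lemma in_box: "i + int k \<le> J + 1" "r < l \<Longrightarrow> 1 \<le> r \<Longrightarrow> i + int k + int m + int r \<le> J"
  "i + int k + int m + int l \<le> J + 3"
proof -
  have alt: "z (s + 1) = (\<not> z s)" if "J \<le> s" for s using box that by (simp add: boxed_def)
  have long: "a + int n \<le> J + 1" if "seg z a n b" "1 < n \<or> a \<le> J" for a n b
  proof (rule ccontr)
    assume *: "\<not> a + int n \<le> J + 1"
    have "1 < n" using that(2) * by auto
    then have "a \<le> a + int n - 2" "J \<le> a + int n - 2" using * by auto
    moreover have "z (a + int n - 2) = b" "z (a + int n - 1) = b"
      using that(1) \<open>1 < n\<close> by (auto simp: seg_def)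
    ultimately show False using alt[of "a + int n - 2"] by simp
  qed
  show 1: "i + int k \<le> J + 1" using long[OF s1] iJ by simp
  show "i + int k + int m + int r \<le> J" if "r < l" "1 \<le> r"
    using long[OF s3] that by auto
  have 2: "i + int k + int m \<le> J + 2"
    using long[OF s2] 1 pos by (cases "1 < m") auto
  show "i + int k + int m + int l \<le> J + 3"
    using long[OF s3] 2 pos by (cases "1 < l") auto
qed

lemma sum_active:
  fixes H :: "int \<Rightarrow> real"
  assumes "\<And>s. z s \<Longrightarrow> i + int k + int m + int l \<le> s \<Longrightarrow> H s = 0"
  shows "(\<Sum>s | s \<in> {i0..J} \<and> z s. H s) = (\<Sum>j\<in>{1..<k}. H (i + int j)) + H i
    + (if i + int k + int m \<le> J then H (i + int k + int m) else 0) + (\<Sum>r\<in>{1..<l}. H (i + int k + int m + int r))"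
proof -
  let ?A = "{s. s \<in> {i0..J} \<and> z s}"
  let ?p = "i + int k + int m"
  define A1 where "A1 = (\<lambda>j. i + int j) ` {1..<k}"
  define A3 where "A3 = (if ?p \<le> J then {?p} else {})"
  define A4 where "A4 = (\<lambda>r. ?p + int r) ` {1..<l}"
  have sub: "A1 \<union> {i} \<union> A3 \<union> A4 \<subseteq> ?A"
    using iJ in_box zi s1 s3 unfolding A1_def A3_def A4_def by (auto simp: seg_def)
  have rest: "H s = 0" if "s \<in> ?A - (A1 \<union> {i} \<union> A3 \<union> A4)" for s
  proof (cases "s < ?p + int l")
    case True
    have "\<not> s < i" using that lm by (auto simp: is_leftmost_def)
    moreover have "\<not> (i + int k \<le> s \<and> s < ?p)" using that s2 by (auto simp: seg_def)
    moreover have "\<not> (i < s \<and> s < i + int k)"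
    proof
      assume "i < s \<and> s < i + int k"
      then have "s = i + int (nat (s - i))" "nat (s - i) \<in> {1..<k}" by auto
      then have "s \<in> A1" unfolding A1_def by (rule image_eqI)
      with that show False by simp
    qed
    moreover have "\<not> (?p < s \<and> s < ?p + int l)"
    proof
      assume "?p < s \<and> s < ?p + int l"
      then have "s = ?p + int (nat (s - ?p))" "nat (s - ?p) \<in> {1..<l}" by auto
      then have "s \<in> A4" unfolding A4_def by (rule image_eqI)
      with that show False by simp
    qed
    moreover have "s \<noteq> i" "s \<noteq> ?p" using that by (auto simp: A3_def split: if_splits)
    ultimately have False using True by linarith
    then show ?thesis ..
  next
    case False
    then show ?thesis using that assms by simp
  qed
  have fin: "finite A1" "finite A3" "finite A4" by (auto simp: A1_def A3_def A4_def)
  have dis: "A1 \<inter> {i} = {}" "(A1 \<union> {i}) \<inter> A3 = {}" "(A1 \<union> {i} \<union> A3) \<inter> A4 = {}"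
    using pos by (auto simp: A1_def A3_def A4_def split: if_splits)
  have "(\<Sum>s\<in>?A. H s) = (\<Sum>s\<in>A1 \<union> {i} \<union> A3 \<union> A4. H s)"
  proof (rule sum.mono_neutral_right)
    show "finite ?A" by (rule finite_subset[of _ "{i0..J}"]) auto
  qed (use sub rest in blast)+
  also have "\<dots> = sum H A1 + H i + sum H A3 + sum H A4"
  proof -
    have "sum H (A1 \<union> {i} \<union> A3 \<union> A4) = sum H (A1 \<union> {i} \<union> A3) + sum H A4"
      by (rule sum.union_disjoint) (use fin dis in auto)
    also have "sum H (A1 \<union> {i} \<union> A3) = sum H (A1 \<union> {i}) + sum H A3"
      by (rule sum.union_disjoint) (use fin dis in auto)
    also have "sum H (A1 \<union> {i}) = sum H A1 + H i"
      by (subst sum.union_disjoint) (use fin dis in auto)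
    finally show ?thesis .
  qed
  also have "sum H A1 = (\<Sum>j\<in>{1..<k}. H (i + int j))"
    unfolding A1_def by (subst sum.reindex) (auto simp: inj_on_def)
  also have "sum H A4 = (\<Sum>r\<in>{1..<l}. H (?p + int r))"
    unfolding A4_def by (subst sum.reindex) (auto simp: inj_on_def)
  also have "sum H A3 = (if ?p \<le> J then H ?p else 0)" by (simp add: A3_def)
  finally show ?thesis .
qed

lemma drift: "(\<Sum>s | s \<in> {i0..J} \<and> z s. fpot (flip s z) - fpot z) \<le> 288 / 100 - slack k"
proof -
  have "(\<Sum>s | s \<in> {i0..J} \<and> z s. fpot (flip s z) - fpot z)
      = (\<Sum>j\<in>{1..<k}. fpot (flip (i + int j) z) - fpot z) + (fpot (flip i z) - fpot z)
      + (if i + int k + int m \<le> J then fpot (flip (i + int k + int m) z) - fpot z else 0)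
      + (\<Sum>r\<in>{1..<l}. fpot (flip (i + int k + int m + int r) z) - fpot z)"
    by (rule sum_active) (simp add: flip_far)
  also have "(\<Sum>j\<in>{1..<k}. fpot (flip (i + int j) z) - fpot z) = (\<Sum>j\<in>{1..<k}. pot j (k - j) m - pot k m l)"
    by (intro sum.cong) (auto simp: flip_cut fpot)
  also have "(\<Sum>r\<in>{1..<l}. fpot (flip (i + int k + int m + int r) z) - fpot z) = (\<Sum>r\<in>{1..<l}. pot k m r - pot k m l)"
    by (intro sum.cong) (auto simp: flip_last fpot)
  finally show ?thesis
    using pot_drift[OF pos] by (auto simp: flip_front flip_merge fpot max_def split: if_splits)
qed

text \<open>The surplus drift controls k but not l, so the l - 1 cuts of the third run cannot each
  be charged Mp ^ 2. Instead each square is at most Mp times the modulus of the change, and the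
  moduli sum to at most 21 + 2 * ssum l: table differences, at most 3 each, occur for r < 8 only,
  and the changes of \<open>psum\<close> add up by \<open>sum_P_diff\<close>.\<close>

lemma drift_square:
  assumes Mp: "\<And>a b c. 1 \<le> a \<Longrightarrow> 1 \<le> b \<Longrightarrow> 1 \<le> c \<Longrightarrow> a + b \<le> L \<Longrightarrow> \<bar>pot a b c\<bar> \<le> Mp"
    and L: "J + 3 - i0 \<le> int L" and SL: "ssum L \<le> Mp" and M1: "1 \<le> Mp"
  shows "(\<Sum>s | s \<in> {i0..J} \<and> z s. (fpot (flip s z) - fpot z)\<^sup>2) \<le> real k * Mp\<^sup>2 + 2 * (real k)\<^sup>2 + 4 * Mp\<^sup>2 + 21 * Mp"
proof -
  have kml: "k + m + l \<le> L" using in_box(3) iJ L by linarith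
  have p0: "0 \<le> pot a b c" if "1 \<le> a" "1 \<le> b" "1 \<le> c" for a b c
    using that cell_range[of a b c] by (simp add: pot_def)
  have sq: "(x - y)\<^sup>2 \<le> Mp\<^sup>2" if "0 \<le> x" "0 \<le> y" "\<bar>x\<bar> \<le> Mp" "\<bar>y\<bar> \<le> Mp" for x y
    using that by (intro power2_le_iff_abs_le[THEN iffD2]) auto
  have pk: "0 \<le> pot k m l" "\<bar>pot k m l\<bar> \<le> Mp" using pos kml by (auto intro!: p0 Mp)
  have "(\<Sum>s | s \<in> {i0..J} \<and> z s. (fpot (flip s z) - fpot z)\<^sup>2)
      = (\<Sum>j\<in>{1..<k}. (fpot (flip (i + int j) z) - fpot z)\<^sup>2) + (fpot (flip i z) - fpot z)\<^sup>2
      + (if i + int k + int m \<le> J then (fpot (flip (i + int k + int m) z) - fpot z)\<^sup>2 else 0)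
      + (\<Sum>r\<in>{1..<l}. (fpot (flip (i + int k + int m + int r) z) - fpot z)\<^sup>2)"
    by (rule sum_active) (simp add: flip_far)
  also have "\<dots> \<le> (real k - 1) * Mp\<^sup>2 + (2 * (real k)\<^sup>2 + 2 * Mp\<^sup>2) + Mp\<^sup>2 + (21 * Mp + 2 * Mp\<^sup>2)"
  proof (intro add_mono)
    have "(\<Sum>j\<in>{1..<k}. (fpot (flip (i + int j) z) - fpot z)\<^sup>2) \<le> (\<Sum>j\<in>{1..<k}. Mp\<^sup>2)"
    proof (intro sum_mono)
      fix j assume j: "j \<in> {1..<k}"
      have "(pot j (k - j) m - pot k m l)\<^sup>2 \<le> Mp\<^sup>2"
        using j pos kml by (intro sq p0 Mp pk) auto
      then show "(fpot (flip (i + int j) z) - fpot z)\<^sup>2 \<le> Mp\<^sup>2" using j by (simp add: flip_cut fpot)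
    qed
    then show "(\<Sum>j\<in>{1..<k}. (fpot (flip (i + int j) z) - fpot z)\<^sup>2) \<le> (real k - 1) * Mp\<^sup>2"
      using pos(1) by (simp add: of_nat_diff)
    have "\<bar>pot m l l'\<bar> \<le> Mp" "0 \<le> pot m l l'" using pos kml by (auto intro!: Mp p0)
    then have "(pot m l l' - pot k m l)\<^sup>2 \<le> Mp\<^sup>2" by (intro sq pk)
    moreover have "(real k + x)\<^sup>2 \<le> 2 * (real k)\<^sup>2 + 2 * x\<^sup>2" for x
      using zero_le_power2[of "real k - x"] by (simp add: power2_sum power2_diff)
    from this[of "pot m l l' - pot k m l"]
    have "(real k + (pot m l l' - pot k m l))\<^sup>2 \<le> 2 * (real k)\<^sup>2 + 2 * (pot m l l' - pot k m l)\<^sup>2" .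
    ultimately show "(fpot (flip i z) - fpot z)\<^sup>2 \<le> 2 * (real k)\<^sup>2 + 2 * Mp\<^sup>2"
      by (simp add: flip_front fpot add_diff_eq)
    have "(pot k (m + l) l' - pot k m l)\<^sup>2 \<le> Mp\<^sup>2"
      using pos kml by (intro sq p0 Mp pk) auto
    then show "(if i + int k + int m \<le> J then (fpot (flip (i + int k + int m) z) - fpot z)\<^sup>2 else 0) \<le> Mp\<^sup>2"
      by (simp add: flip_merge fpot)
    have "(\<Sum>r\<in>{1..<l}. (fpot (flip (i + int k + int m + int r) z) - fpot z)\<^sup>2)
        \<le> (\<Sum>r\<in>{1..<l}. Mp * ((if r < 8 then 3 else 0) + (psum l - psum r) * 2))"
    proof (intro sum_mono)
      fix r assume r: "r \<in> {1..<l}"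
      have "\<bar>pot k m r\<bar> \<le> Mp" "0 \<le> pot k m r" using r pos kml by (auto intro!: Mp p0)
      then have M: "\<bar>pot k m r - pot k m l\<bar> \<le> Mp" using pk by linarith
      have "\<bar>cell k m r - cell k m l\<bar> \<le> (if r < 8 then 3 else 0)"
        using cell_range[of k m r] cell_range[of k m l] pos r by (auto simp: cell_def)
      moreover have "0 \<le> psum l - psum r" using psum_mono[of r l] r by simp
      moreover have "1 / real k + 1 / real m \<le> 2"
      proof -
        have "1 / real k \<le> 1" "1 / real m \<le> 1" using pos by simp_all
        then show ?thesis by linarith
      qed
      moreover have "pot k m r - pot k m l = (cell k m r - cell k m l) - (psum l - psum r) * (1 / real k + 1 / real m)"
        by (simp add: pot_def algebra_simps)
      ultimately have "\<bar>pot k m r - pot k m l\<bar> \<le> (if r < 8 then 3 else 0) + (psum l - psum r) * 2"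
      proof -
        assume a: "\<bar>cell k m r - cell k m l\<bar> \<le> (if r < 8 then 3 else 0)" "0 \<le> psum l - psum r" "1 / real k + 1 / real m \<le> 2"
          "pot k m r - pot k m l = (cell k m r - cell k m l) - (psum l - psum r) * (1 / real k + 1 / real m)"
        have "(psum l - psum r) * (1 / real k + 1 / real m) \<le> (psum l - psum r) * 2" using a by (intro mult_left_mono)
        moreover have "0 \<le> (psum l - psum r) * (1 / real k + 1 / real m)" using a(2) by simp
        ultimately show ?thesis using a(1) unfolding a(4) abs_le_iff by linarith
      qed
      then have "\<bar>pot k m r - pot k m l\<bar> * \<bar>pot k m r - pot k m l\<bar> \<le> Mp * ((if r < 8 then 3 else 0) + (psum l - psum r) * 2)"
        using M M1 by (intro mult_mono) auto
      then show "(fpot (flip (i + int k + int m + int r) z) - fpot z)\<^sup>2 \<le> Mp * ((if r < 8 then 3 else 0) + (psum l - psum r) * 2)"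
        using r by (simp add: flip_last fpot power2_eq_square)
    qed
    also have "\<dots> = Mp * ((\<Sum>r\<in>{1..<l}. if r < 8 then 3 else 0) + ssum l * 2)"
      unfolding sum_P_diff[symmetric] sum_distrib_right sum.distrib[symmetric] sum_distrib_left ..
    also have "\<dots> \<le> Mp * (21 + Mp * 2)"
    proof (intro mult_left_mono add_mono)
      have "(\<Sum>r\<in>{1..<l}. if r < 8 then 3 else 0 :: real) = (\<Sum>r\<in>{1..<min l 8}. 3)"
        by (rule sum.mono_neutral_cong_right) auto
      also have "\<dots> \<le> (\<Sum>r\<in>{1..<8::nat}. 3)" by (rule sum_mono2) auto
      finally show "(\<Sum>r\<in>{1..<l}. if r < 8 then 3 else 0 :: real) \<le> 21" by simp
      show "ssum l * 2 \<le> Mp * 2" using ssum_mono[of l L] kml SL by simp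
    qed (use M1 in auto)
    finally show "(\<Sum>r\<in>{1..<l}. (fpot (flip (i + int k + int m + int r) z) - fpot z)\<^sup>2) \<le> 21 * Mp + 2 * Mp\<^sup>2"
      by (simp add: algebra_simps power2_eq_square)
  qed
  also have "\<dots> = real k * Mp\<^sup>2 + 2 * (real k)\<^sup>2 + 4 * Mp\<^sup>2 + 21 * Mp" by (simp add: algebra_simps)
  finally show ?thesis .
qed

end

lemma runs_exist:
  assumes "z \<in> boxed i0 J" "i0 \<le> J + 1" "leftmost z \<le> J"
  obtains k m l l' where "runs z (leftmost z) J i0 k m l l'"
proof -
  let ?i = "leftmost z"
  have lm: "is_leftmost z ?i" "i0 \<le> ?i" using boxed_leftmost[OF assms(1,2)] by auto
  obtain k where k: "seg z ?i k (z ?i)" using seg_exists[OF assms(1)] by blast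
  have 1: "z ?i" using lm by (simp add: is_leftmost_def)
  obtain m where m: "seg z (?i + int k) m (z (?i + int k))" using seg_exists[OF assms(1)] by blast
  have 2: "\<not> z (?i + int k)" using k 1 by (simp add: seg_def)
  obtain l where l: "seg z (?i + int k + int m) l (z (?i + int k + int m))" using seg_exists[OF assms(1)] by blast
  have 3: "z (?i + int k + int m)" using m 2 by (simp add: seg_def)
  obtain l' where l': "seg z (?i + int k + int m + int l) l' (z (?i + int k + int m + int l))"
    using seg_exists[OF assms(1)] by blast
  have 4: "\<not> z (?i + int k + int m + int l)" using l 3 by (simp add: seg_def)
  show ?thesis
    by (rule that[of k m l l']) (use assms lm k m l l' 1 2 3 4 in \<open>unfold_locales, auto\<close>)
qed

section \<open>The potential for the lower bound\<close>

text \<open>A function of n bits, branching on the first bit at the root. A flip complements a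
  suffix of the word, which amounts to mirroring a subtree; thus the drift for all 512 words is
  obtained by one structural recursion.\<close>

datatype trie = Lf int | Nd trie trie

fun look :: "trie \<Rightarrow> bool list \<Rightarrow> int" where
  "look (Lf v) xs = v"
| "look (Nd a b) (x # xs) = look (if x then b else a) xs"
| "look (Nd a b) [] = 0"

fun height :: "nat \<Rightarrow> trie \<Rightarrow> bool" where
  "height 0 (Lf v) = True"
| "height (Suc n) (Nd a b) = (height n a \<and> height n b)"
| "height _ _ = False"

fun mirror :: "trie \<Rightarrow> trie" where
  "mirror (Lf v) = Lf v"
| "mirror (Nd a b) = Nd (mirror b) (mirror a)"

fun shift :: "int \<Rightarrow> trie \<Rightarrow> trie" where
  "shift c (Lf v) = Lf (c + v)"
| "shift c (Nd a b) = Nd (shift c a) (shift c b)"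

fun add :: "trie \<Rightarrow> trie \<Rightarrow> trie" where
  "add (Lf u) (Lf v) = Lf (u + v)"
| "add (Nd a b) (Nd c d) = Nd (add a c) (add b d)"
| "add t _ = t"

fun neg :: "trie \<Rightarrow> trie" where
  "neg (Lf v) = Lf (- v)"
| "neg (Nd a b) = Nd (neg a) (neg b)"

fun least :: "trie \<Rightarrow> int" where
  "least (Lf v) = v"
| "least (Nd a b) = min (least a) (least b)"

text \<open>
  Flipping a one of a word complements it and everything after it; \<open>cuts t\<close> is the sum of the
  resulting changes of \<open>t\<close>. If the front rings and the word behind it starts with \<open>r\<close> ones, then
  \<open>advance c t n 1\<close> is \<open>c\<close> times the jump \<open>r + 1\<close> plus the least value of \<open>t\<close> over all words that
  may follow the new front: \<open>trunc\<close> minimises over the bits beyond the old window.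
\<close>

fun trunc :: "nat \<Rightarrow> trie \<Rightarrow> trie" where
  "trunc (Suc n) (Nd a b) = Nd (trunc n a) (trunc n b)"
| "trunc _ t = Lf (least t)"

fun cuts :: "trie \<Rightarrow> trie" where
  "cuts (Lf v) = Lf 0"
| "cuts (Nd a b) = Nd (cuts a) (add (cuts b) (add (mirror a) (neg b)))"

fun advance :: "int \<Rightarrow> trie \<Rightarrow> nat \<Rightarrow> nat \<Rightarrow> trie" where
  "advance c t 0 k = Lf (c * int k + least t)"
| "advance c t (Suc n) k = Nd (shift (c * int k) (mirror (trunc n t))) (advance c t n (Suc k))"

fun all_trie :: "(int \<Rightarrow> bool) \<Rightarrow> trie \<Rightarrow> bool" where
  "all_trie P (Lf v) = P v"
| "all_trie P (Nd a b) = (all_trie P a \<and> all_trie P b)"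

fun trie_of :: "nat \<Rightarrow> int list \<Rightarrow> trie" where
  "trie_of 0 vs = Lf (hd vs)"
| "trie_of (Suc n) vs = Nd (trie_of n (take (2 ^ n) vs)) (trie_of n (drop (2 ^ n) vs))"

text \<open>
  In units of \<open>1 / 4000\<close>, found numerically; the bound \<open>6588\<close> below is \<open>1.647 * 4000\<close>.
\<close>

definition lower_trie :: trie where
  "lower_trie = trie_of 9
    [8012, 7580, 6867, 7195, 6339, 6084, 6443, 6759, 5744, 5495, 5122, 5337, 5813, 5580, 5954, 6254,
     5065, 4828, 4456, 4654, 4217, 4047, 4290, 4493, 5107, 4880, 4558, 4757, 5241, 5023, 5392, 5674,
     4298, 4075, 3717, 3902, 3464, 3307, 3528, 3714, 3205, 3044, 2808, 2953, 3263, 3111, 3354, 3540,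
     4316, 4102, 3779, 3961, 3577, 3419, 3651, 3839, 4454, 4243, 3951, 4138, 4608, 4404, 4761, 5029,
     3463, 3252, 2911, 3084, 2662, 2514, 2719, 2892, 2379, 2229, 2010, 2143, 2428, 2288, 2509, 2680,
     2088, 1939, 1710, 1839, 1564, 1448, 1614, 1748, 2139, 1995, 1791, 1922, 2228, 2090, 2320, 2491,
     3461, 3258, 2947, 3115, 2730, 2584, 2792, 2964, 2509, 2359, 2146, 2281, 2574, 2432, 2661, 2835,
     3610, 3409, 3115, 3285, 2932, 2783, 3005, 3183, 3781, 3582, 3311, 3488, 3945, 3751, 4098, 4356,
     2664, 2463, 2133, 2297, 1886, 1746, 1940, 2104, 1598, 1457, 1247, 1373, 1643, 1511, 1719, 1880,
     1268, 1130, 914, 1034, 774, 666, 821, 946, 1311, 1177, 986, 1107, 1392, 1263, 1476, 1634, 935,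
     798, 582, 699, 427, 322, 470, 590, 265, 157, 0, 99, 310, 207, 370, 492, 984, 851, 650, 767,
     522, 417, 572, 694, 1082, 950, 767, 887, 1180, 1054, 1273, 1431, 2655, 2462, 2159, 2318, 1939,
     1801, 1996, 2157, 1690, 1550, 1348, 1474, 1744, 1612, 1822, 1982, 1436, 1296, 1085, 1207, 951,
     841, 1001, 1128, 1501, 1365, 1176, 1299, 1592, 1462, 1682, 1845, 2830, 2638, 2349, 2509, 2146,
     2007, 2209, 2374, 1940, 1797, 1595, 1725, 2011, 1875, 2098, 2266, 3036, 2843, 2564, 2728, 2389,
     2246, 2464, 2637, 3232, 3039, 2779, 2952, 3407, 3219, 3565, 3821, 7484, 7068, 6444, 6750, 5999,
     5752, 6094, 6395, 5499, 5254, 4911, 5118, 5569, 5342, 5700, 5989, 4930, 4696, 4350, 4542, 4134,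
     3965, 4205, 4403, 4989, 4764, 4460, 4654, 5119, 4904, 5262, 5539, 4305, 4082, 3745, 3926, 3512,
     3354, 3575, 3759, 3274, 3111, 2884, 3027, 3335, 3182, 3425, 3611, 4361, 4145, 3835, 4014, 3645,
     3486, 3718, 3905, 4506, 4293, 4010, 4195, 4659, 4453, 4809, 5079, 3712, 3495, 3164, 3337, 2926,
     2774, 2985, 3161, 2657, 2503, 2286, 2421, 2712, 2567, 2795, 2970, 2383, 2230, 2002, 2133, 1859,
     1740, 1912, 2049, 2446, 2297, 2093, 2226, 2540, 2397, 2636, 2812, 3786, 3576, 3266, 3438, 3053,
     2902, 3118, 3294, 2838, 2682, 2468, 2606, 2908, 2761, 2999, 3179, 3966, 3756, 3461, 3635, 3279,
     3124, 3356, 3540, 4154, 3945, 3671, 3854, 4328, 4125, 4490, 4762, 7757, 7348, 6752, 7060, 6340,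
     6093, 6437, 6744, 5880, 5633, 5294, 5506, 5962, 5732, 6097, 6396, 5372, 5132, 4787, 4985, 4576,
     4403, 4650, 4858, 5455, 5224, 4916, 5119, 5597, 5377, 5748, 6042, 4883, 4648, 4303, 4494, 4069,
     3904, 4137, 4334, 3833, 3662, 3427, 3580, 3904, 3744, 4001, 4202, 4993, 4764, 4441, 4633, 4247,
     4080, 4327, 4530, 5170, 4943, 4646, 4847, 5346, 5127, 5513, 5814, 8242, 7822, 7240, 7552, 6844,
     6588, 6950, 7267, 6414, 6156, 5813, 6033, 6515, 6273, 6662, 6978, 5997, 5740, 5383, 5593, 5168,
     4984, 5253, 5475, 6123, 5874, 5552, 5769, 6295, 6056, 6469, 6793, 8767, 8338, 7756, 8084, 7376,
     7109, 7497, 7836, 7011, 6736, 6379, 6617, 7147, 6889, 7322, 7674, 9280, 8836, 8257, 8604, 7923,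
     7638, 8075, 8449, 9755, 9300, 8747, 9131, 10191, 9740, 10604, 11350]"

lemma lower_trie_check:
  "height 9 lower_trie"
  "all_trie (\<lambda>v. 0 \<le> v \<and> v \<le> 12000) lower_trie"
  "all_trie (\<lambda>v. 6588 \<le> v) (add (cuts lower_trie) (add (advance 4000 lower_trie 9 1) (neg lower_trie)))"
  by code_simp+

lemma height_Suc_iff: "height (Suc n) t \<longleftrightarrow> (\<exists>a b. t = Nd a b \<and> height n a \<and> height n b)"
  by (cases t) auto

lemma height_0_iff: "height 0 t \<longleftrightarrow> (\<exists>v. t = Lf v)"
  by (cases t) auto

lemma height_ops:
  "height n t \<Longrightarrow> height n (mirror t)"
  "height n t \<Longrightarrow> height n (shift c t)"
  "height n t \<Longrightarrow> height n (neg t)"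
  "height n t \<Longrightarrow> height n u \<Longrightarrow> height n (add t u)"
  by (induction n arbitrary: t u) (auto simp: height_Suc_iff height_0_iff)

lemma height_trunc: "height n t \<Longrightarrow> d \<le> n \<Longrightarrow> height d (trunc d t)"
proof (induction d arbitrary: n t)
  case (Suc d)
  then obtain n' where "n = Suc n'" by (cases n) auto
  with Suc show ?case by (auto simp: height_Suc_iff)
qed simp

lemma height_cuts: "height n t \<Longrightarrow> height n (cuts t)"
  by (induction n arbitrary: t) (auto simp: height_Suc_iff height_0_iff intro!: height_ops)

lemma height_advance: "height n0 t \<Longrightarrow> n \<le> n0 \<Longrightarrow> height n (advance c t n k)"
  by (induction n arbitrary: k) (auto intro!: height_ops height_trunc)

lemma look_ops:
  assumes "height n t" "length xs = n"
  shows "look (mirror t) xs = look t (map Not xs)"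
    and "look (shift c t) xs = c + look t xs"
    and "look (neg t) xs = - look t xs"
    and "height n u \<Longrightarrow> look (add t u) xs = look t xs + look u xs"
    and "least t \<le> look t xs"
    and "all_trie Q t \<Longrightarrow> Q (look t xs)"
proof -
  have "look (mirror t) xs = look t (map Not xs) \<and> look (shift c t) xs = c + look t xs
      \<and> look (neg t) xs = - look t xs \<and> (\<forall>u. height n u \<longrightarrow> look (add t u) xs = look t xs + look u xs)
      \<and> least t \<le> look t xs \<and> (all_trie Q t \<longrightarrow> Q (look t xs))"
    using assms
  proof (induction n arbitrary: t xs)
    case 0
    then show ?case by (auto simp: height_0_iff)
  next
    case (Suc n)
    obtain a b where t: "t = Nd a b" "height n a" "height n b" using Suc.prems by (auto simp: height_Suc_iff)
    obtain x ys where xs: "xs = x # ys" "length ys = n" using Suc.prems by (cases xs) auto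
    show ?case
      using Suc.IH[OF t(2) xs(2)] Suc.IH[OF t(3) xs(2)]
      unfolding t(1) xs(1) by (cases x) (auto simp: height_Suc_iff)
  qed
  then show "look (mirror t) xs = look t (map Not xs)" "look (shift c t) xs = c + look t xs"
    "look (neg t) xs = - look t xs" "height n u \<Longrightarrow> look (add t u) xs = look t xs + look u xs"
    "least t \<le> look t xs" "all_trie Q t \<Longrightarrow> Q (look t xs)" by blast+
qed

lemma look_trunc: "height (length xs + length ys) t \<Longrightarrow> look (trunc (length xs) t) xs \<le> look t (xs @ ys)"
proof (induction xs arbitrary: t)
  case Nil
  then show ?case using look_ops(5)[of "length ys" t ys] by simp
next
  case (Cons x xs)
  then show ?case by (auto simp: height_Suc_iff)
qed

lemma look_cuts:
  "height n t \<Longrightarrow> length xs = n \<Longrightarrow>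
    look (cuts t) xs = (\<Sum>j<n. if xs ! j then look t (take j xs @ map Not (drop j xs)) - look t xs else 0)"
proof (induction n arbitrary: t xs)
  case 0
  then show ?case by (auto simp: height_0_iff)
next
  case (Suc n)
  obtain a b where t: "t = Nd a b" "height n a" "height n b" using Suc.prems by (auto simp: height_Suc_iff)
  obtain x ys where xs: "xs = x # ys" "length ys = n" using Suc.prems by (cases xs) auto
  let ?S = "\<lambda>u. \<Sum>j<n. if ys ! j then look u (take j ys @ map Not (drop j ys)) - look u ys else 0"
  have "(\<Sum>j<Suc n. if xs ! j then look t (take j xs @ map Not (drop j xs)) - look t xs else 0)
      = (if x then look a (map Not ys) - look b ys else 0) + ?S (if x then b else a)"
    unfolding sum.lessThan_Suc_shift by (simp add: xs t if_distrib cong: if_cong)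
  also have "\<dots> = look (cuts t) xs"
    using Suc.IH[OF t(2) xs(2)] Suc.IH[OF t(3) xs(2)] t xs
    by (simp add: look_ops[where n = n] height_ops height_cuts)
  finally show ?case ..
qed

text \<open>For n = 9 and k = 1 the window shows only ones: the jump is at least 10 and nothing is
  known about the new window b, whence the least value of t.\<close>

lemma look_advance_all_ones:
  assumes "height n0 t" "length b = n0"
  shows "look (advance c t n k) (replicate n True) \<le> c * (int k + int n) + look t b"
proof (induction n arbitrary: k)
  case 0
  then show ?case using look_ops(5)[OF assms] by simp
next
  case (Suc n)
  then show ?case using Suc.IH[of "Suc k"] by (simp add: algebra_simps)
qed

text \<open>The first zero behind the front becomes the new leftmost one. The bits ys after it
  reappear complemented, followed by unknown bits b, over which \<open>trunc\<close> has
  minimised.\<close>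

lemma look_advance:
  assumes "height n0 t"
  shows "length ys + length b = n0 \<Longrightarrow>
    look (advance c t (Suc (r + length ys)) k) (replicate r True @ False # ys) \<le> c * (int k + int r) + look t (map Not ys @ b)"
proof (induction r arbitrary: k)
  case 0
  have h: "height (length ys) (trunc (length ys) t)" using 0 assms by (intro height_trunc) auto
  have "look (trunc (length ys) t) (map Not ys) \<le> look t (map Not ys @ b)"
    using look_trunc[of "map Not ys" b t] 0 assms by simp
  then show ?case
    using h by (simp add: look_ops[where n = "length ys"] height_ops)
next
  case (Suc r)
  then show ?case using Suc.IH[of "Suc k"] by (simp add: algebra_simps)
qed

section \<open>The nine bits behind the front\<close>

definition window :: "(int \<Rightarrow> bool) \<Rightarrow> int \<Rightarrow> bool list" where
  "window z i = map (\<lambda>j. z (i + 1 + int j)) [0..<9]"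

definition wval :: "(int \<Rightarrow> bool) \<Rightarrow> int \<Rightarrow> real" where
  "wval z i = real_of_int (look lower_trie (window z i)) / 4000"

lemma length_window [simp]: "length (window z i) = 9"
  by (simp add: window_def)

lemma nth_window: "j < 9 \<Longrightarrow> window z i ! j = z (i + 1 + int j)"
  by (simp add: window_def)

lemma wval_range: "0 \<le> wval z i" "wval z i \<le> 3"
  using look_ops(6)[OF lower_trie_check(1) length_window lower_trie_check(2), of z i]
  by (auto simp: wval_def)

lemma window_flip_cut:
  assumes "j < 9" "z (i + 1 + int j)"
  shows "window (flip (i + 1 + int j) z) i = take j (window z i) @ map Not (drop j (window z i))"
proof (rule nth_equalityI)
  fix r assume "r < length (window (flip (i + 1 + int j) z) i)"
  then show "window (flip (i + 1 + int j) z) i ! r = (take j (window z i) @ map Not (drop j (window z i))) ! r"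
    using assms by (cases "r < j") (auto simp: nth_window nth_append flip_def)
qed (use assms in simp)

lemma window_flip_far: "i + 9 < s \<Longrightarrow> window (flip s z) i = window z i"
  by (auto simp: window_def flip_def)

lemma wval_cuts:
  "(\<Sum>j<9. if z (i + 1 + int j) then wval (flip (i + 1 + int j) z) i - wval z i else 0)
    = real_of_int (look (cuts lower_trie) (window z i)) / 4000"
proof -
  have "real_of_int (look (cuts lower_trie) (window z i))
      = (\<Sum>j<9. if z (i + 1 + int j) then real_of_int (look lower_trie (window (flip (i + 1 + int j) z) i)) - real_of_int (look lower_trie (window z i)) else 0)"
    unfolding look_cuts[OF lower_trie_check(1) length_window] of_int_sum
    by (intro sum.cong refl) (auto simp: nth_window window_flip_cut simp flip: of_int_diff)
  then show ?thesis
    by (simp only: sum_divide_distrib wval_def) (intro sum.cong refl, simp add: diff_divide_distrib)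
qed

text \<open>The window reveals the jump length up to 9; every longer jump is counted as 10. For a
  lower bound on the speed this is legitimate, and it keeps the increments bounded.\<close>

lemma wval_front:
  assumes "z i" "seg z i k True"
  shows "real_of_int (look (advance 4000 lower_trie 9 1) (window z i)) / 4000
    \<le> min (real k) 10 + wval (flip i z) (i + int k)"
proof -
  let ?A = "look (advance 4000 lower_trie 9 1) (window z i)"
  let ?w = "window (flip i z) (i + int k)"
  have k: "1 \<le> k" "\<not> z (i + int k)" "\<And>s. i \<le> s \<Longrightarrow> s < i + int k \<Longrightarrow> z s"
    using assms(2) by (auto simp: seg_def)
  have "?A \<le> 4000 * int (min k 10) + look lower_trie ?w"
  proof (cases "k \<le> 9")
    case True
    define ys where "ys = drop k (window z i)"
    have win: "window z i = replicate (k - 1) True @ False # ys"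
    proof (rule nth_equalityI)
      fix r assume "r < length (window z i)"
      then have r: "r < 9" by simp
      consider "r < k - 1" | "r = k - 1" | "k \<le> r" using k(1) by linarith
      then show "window z i ! r = (replicate (k - 1) True @ False # ys) ! r"
      proof cases
        case 1
        then show ?thesis using k(3)[of "i + 1 + int r"] r by (simp add: nth_window nth_append)
      next
        case 2
        then have "i + 1 + int r = i + int k" using k(1) by simp
        then show ?thesis using k(2) r 2 by (simp add: nth_window nth_append)
      next
        case 3
        then have "r - (k - 1) = Suc (r - k)" "\<not> r < k - 1" using k(1) by auto
        then show ?thesis using 3 r k(1) by (simp add: nth_append ys_def nth_window)
      qed
    qed (use True k(1) in \<open>simp add: ys_def\<close>)
    \<comment> \<open>The 9 - k bits known from the old window come first, complemented by the ring
      of the front; the last k bits of the new window are new.\<close>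
    have w: "?w = map Not ys @ drop (9 - k) ?w"
    proof -
      have "take (9 - k) ?w = map Not ys"
      proof (rule nth_equalityI)
        fix r assume "r < length (take (9 - k) ?w)"
        then have r: "r < 9 - k" by simp
        then have "map Not ys ! r = (\<not> z (i + 1 + int (k + r)))"
          by (simp add: ys_def nth_window)
        moreover have "take (9 - k) ?w ! r = flip i z (i + int k + 1 + int r)"
          using r by (simp add: nth_window)
        moreover have "i + int k + 1 + int r = i + 1 + int (k + r)" by simp
        ultimately show "take (9 - k) ?w ! r = map Not ys ! r"
          using assms(1) by (simp add: flip_def)
      qed (simp add: ys_def)
      then show ?thesis by (metis append_take_drop_id)
    qed
    have "look (advance 4000 lower_trie (Suc (k - 1 + length ys)) 1) (replicate (k - 1) True @ False # ys)
        \<le> 4000 * (int 1 + int (k - 1)) + look lower_trie (map Not ys @ drop (9 - k) ?w)"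
      by (rule look_advance[OF lower_trie_check(1)]) (use True in \<open>simp add: ys_def\<close>)
    also have "Suc (k - 1 + length ys) = 9" using True k(1) by (simp add: ys_def)
    finally show ?thesis using True k(1) unfolding win[symmetric] w[symmetric] by simp
  next
    case False
    have "window z i = replicate 9 True"
    proof (rule nth_equalityI)
      fix r assume "r < length (window z i)"
      then have "r < 9" by simp
      then show "window z i ! r = replicate 9 True ! r"
        using k(3)[of "i + 1 + int r"] False by (subst nth_replicate) (auto simp: nth_window)
    qed simp
    then show ?thesis
      using look_advance_all_ones[OF lower_trie_check(1) length_window[of "flip i z" "i + int k"], of 4000 9 1] False by simp
  qed
  then have "real_of_int ?A \<le> real_of_int (4000 * int (min k 10) + look lower_trie ?w)" by (simp only: of_int_le_iff)
  then show ?thesis by (simp add: wval_def add_divide_distrib min_def split: if_splits)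
qed

lemma wval_drift:
  "1647 / 1000 \<le> (\<Sum>j<9. if z (i + 1 + int j) then wval (flip (i + 1 + int j) z) i - wval z i else 0)
    + (real_of_int (look (advance 4000 lower_trie 9 1) (window z i)) / 4000 - wval z i)"
proof -
  let ?w = "window z i"
  have h: "height 9 (cuts lower_trie)" "height 9 (advance 4000 lower_trie 9 1)" "height 9 (neg lower_trie)"
    using lower_trie_check(1) by (auto intro: height_cuts height_advance height_ops)
  have "6588 \<le> look (add (cuts lower_trie) (add (advance 4000 lower_trie 9 1) (neg lower_trie))) ?w"
    by (rule look_ops(6)[OF _ length_window lower_trie_check(3)]) (intro height_ops h)
  also have "\<dots> = look (cuts lower_trie) ?w + (look (advance 4000 lower_trie 9 1) ?w - look lower_trie ?w)"
    using h lower_trie_check(1) by (simp add: look_ops[where n = 9] height_ops)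
  finally have "real_of_int 6588 \<le> real_of_int (look (cuts lower_trie) ?w + (look (advance 4000 lower_trie 9 1) ?w - look lower_trie ?w))"
    by (simp only: of_int_le_iff)
  then show ?thesis unfolding wval_cuts by (simp add: wval_def field_simps)
qed

section \<open>The front along one realisation of the clocks\<close>

lemma sorted_list_of_set_append:
  fixes A B :: "real set"
  assumes "finite A" "finite B" "\<And>a b. a \<in> A \<Longrightarrow> b \<in> B \<Longrightarrow> a < b"
  shows "sorted_list_of_set (A \<union> B) = sorted_list_of_set A @ sorted_list_of_set B"
proof (rule sorted_distinct_set_unique)
  show "sorted (sorted_list_of_set A @ sorted_list_of_set B)"
    using assms by (auto simp: sorted_append less_imp_le)
  have "A \<inter> B = {}" using assms(3) by fastforce
  then show "distinct (sorted_list_of_set A @ sorted_list_of_set B)" using assms by simp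
qed (simp_all add: assms(1,2))

locale ring_path =
  fixes c :: "int \<Rightarrow> real \<Rightarrow> nat" and w :: "int \<Rightarrow> bool"
  assumes cp: "\<And>j. counting_path (c j)"
    and w: "w \<in> configurations"
begin

definition i0 :: int where "i0 = leftmost w"

lemma w_leftmost: "is_leftmost w i0"
proof -
  obtain i where "is_leftmost w i" using w by (auto simp: configurations_def)
  then show ?thesis unfolding i0_def by (simp only: leftmost_eq)
qed

lemma chain_box: "s \<le> j \<Longrightarrow> chain c w t s = box_chain c w j t s"
  unfolding chain_def by (rule box_chain_consistent[OF finite_ring_times[OF cp], symmetric])

text \<open>Invariance principle: the sorted ring times up to t' split into those up to t, which
  produce the state at time t, and the later ones, whose flips each preserve Q.\<close>

lemma box_chain_preserves:
  assumes t: "0 \<le> t" "t \<le> t'" and P0: "Q (box_chain c w j t)"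
    and step: "\<And>z u r. Q z \<Longrightarrow> t < u \<Longrightarrow> u \<le> t' \<Longrightarrow> i0 \<le> r \<Longrightarrow> r \<le> j \<Longrightarrow> rings (c r) u \<Longrightarrow> Q (flip r z)"
  shows "Q (box_chain c w j t')"
proof -
  let ?R = "ringing_sites c {leftmost w..j}"
  let ?f = "\<lambda>u. fold flip (sorted_list_of_set (?R u))"
  let ?A = "{u \<in> {0<..t}. ?R u \<noteq> {}}" and ?B = "{u \<in> {t<..t'}. ?R u \<noteq> {}}"
  have AB: "{u \<in> {0<..t'}. ?R u \<noteq> {}} = ?A \<union> ?B" using t by auto
  have fin: "finite (?A \<union> ?B)" unfolding AB[symmetric] by (rule finite_ring_times[OF cp])
  then have finA: "finite ?A" and finB: "finite ?B" by (auto intro: finite_subset)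
  have "sorted_list_of_set (?A \<union> ?B) = sorted_list_of_set ?A @ sorted_list_of_set ?B"
    using finA finB by (rule sorted_list_of_set_append) auto
  then have eq: "box_chain c w j t' = fold ?f (sorted_list_of_set ?B) (box_chain c w j t)"
    unfolding box_chain_def AB by simp
  have inner: "Q (fold flip rs z)" if "Q z" "t < u" "u \<le> t'" "set rs \<subseteq> ?R u" for rs z u
    using that(1,4)
  proof (induction rs arbitrary: z)
    case (Cons r rs)
    then have "Q (flip r z)"
      using step[of z u r] that(2,3) by (auto simp: ringing_sites_def i0_def)
    then show ?case using Cons by simp
  qed simp
  have fR: "finite (?R u)" for u
    by (rule finite_subset[of _ "{leftmost w..j}"]) (auto simp: ringing_sites_def)
  have "Q (fold ?f us z)" if "Q z" "set us \<subseteq> ?B" for us z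
    using that
  proof (induction us arbitrary: z)
    case (Cons u us)
    have "Q (?f u z)" using Cons.prems fR by (intro inner[of z u]) auto
    then show ?case using Cons by simp
  qed simp
  from this[OF P0, of "sorted_list_of_set ?B"] finB show ?thesis unfolding eq by simp
qed

lemma zeros_persist:
  assumes "0 \<le> t" "t \<le> t'" "\<And>s. s < p \<Longrightarrow> \<not> chain c w t s" "s < p"
  shows "\<not> chain c w t' s"
proof -
  have "\<forall>k\<le>s. \<not> box_chain c w s t' k"
  proof (rule box_chain_preserves[OF assms(1,2)])
    show "\<forall>k\<le>s. \<not> box_chain c w s t k" using chain_box[of _ s t] assms(3,4) by auto
  next
    fix z u r assume "\<forall>k\<le>s. \<not> z k" "r \<le> s"
    then show "\<forall>k\<le>s. \<not> flip r z k" by (simp add: flip_def)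
  qed
  then show ?thesis by (simp add: chain_def)
qed

lemma leftmost_mono:
  assumes "0 \<le> t" "t \<le> t'" "is_leftmost (chain c w t) p" "is_leftmost (chain c w t') p'"
  shows "p \<le> p'"
proof (rule ccontr)
  assume "\<not> p \<le> p'"
  then have "\<not> chain c w t' p'"
    using assms(3) by (intro zeros_persist[OF assms(1,2), of p]) (auto simp: is_leftmost_def)
  with assms(4) show False by (simp add: is_leftmost_def)
qed

lemma front_persists:
  assumes "0 \<le> t" "t \<le> t'" "is_leftmost (chain c w t) p" "\<And>u. t < u \<Longrightarrow> u \<le> t' \<Longrightarrow> \<not> rings (c p) u"
  shows "is_leftmost (chain c w t') p"
proof -
  have "(\<forall>k<p. \<not> box_chain c w p t' k) \<and> box_chain c w p t' p"
  proof (rule box_chain_preserves[OF assms(1,2)])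
    show "(\<forall>k<p. \<not> box_chain c w p t k) \<and> box_chain c w p t p"
      using assms(3) chain_box[of _ p t] by (auto simp: is_leftmost_def)
  next
    fix z u r assume z: "(\<forall>k<p. \<not> z k) \<and> z p" and u: "t < u" "u \<le> t'" "r \<le> p" "rings (c r) u"
    then have "r \<noteq> p" using assms(4) by blast
    then have "flip r z = z" using z u(3) by (simp add: flip_def)
    then show "(\<forall>k<p. \<not> flip r z k) \<and> flip r z p" using z by simp
  qed
  then show ?thesis using chain_box[of _ p t'] by (auto simp: is_leftmost_def)
qed

lemma chain_0: "chain c w 0 = w"
  by (rule ext) (simp add: chain_def box_chain_def)

text \<open>A counting path rings finitely often in a bounded interval, so the infimum defining
  \<open>next_ring\<close> is a minimum.\<close>

lemma next_ring:
  fixes p :: int and t :: real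
  assumes "0 \<le> t" "\<exists>u>t. rings (c p) u"
  shows "t < next_ring (c p) t" "rings (c p) (next_ring (c p) t)"
    "\<And>u. t < u \<Longrightarrow> u < next_ring (c p) t \<Longrightarrow> \<not> rings (c p) u"
proof -
  let ?S = "{u. t < u \<and> rings (c p) u}"
  obtain u0 where u0: "u0 \<in> ?S" using assms(2) by auto
  let ?F = "{u \<in> ?S. u \<le> u0}"
  have fin: "finite ?F"
    by (rule finite_subset[OF _ finite_rings[OF cp[of p], of u0]]) (auto simp: rings_def)
  have ne: "?F \<noteq> {}" using u0 by auto
  have m: "Min ?F \<in> ?F" using fin ne by (rule Min_in)
  have "Inf ?S = Min ?F"
  proof (rule cInf_eq_minimum)
    show "Min ?F \<in> ?S" using m by simp
    show "Min ?F \<le> u" if "u \<in> ?S" for u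
    proof (cases "u \<le> u0")
      case True
      then have "u \<in> ?F" using that by simp
      then show ?thesis by (rule Min_le[OF fin])
    qed (use m in auto)
  qed
  then have n: "next_ring (c p) t \<in> ?S" using m by (simp add: next_ring_def)
  then show "t < next_ring (c p) t" "rings (c p) (next_ring (c p) t)" by auto
  show "\<not> rings (c p) u" if "t < u" "u < next_ring (c p) t" for u
  proof
    assume "rings (c p) u"
    then have "Inf ?S \<le> u" using that(1) by (intro cInf_lower) (auto intro!: bdd_belowI[of _ t])
    with that(2) show False by (simp add: next_ring_def)
  qed
qed

end

text \<open>These properties hold almost surely. \<open>alive\<close> asks for a leftmost one at
  arbitrarily late times only, which is what the estimates along n ^ 8 provide; it extends to all
  times because a configuration without ones stays so.\<close>

locale good_path = ring_path +
  assumes simple: "\<And>s s' t. s \<noteq> s' \<Longrightarrow> \<not> (rings (c s) t \<and> rings (c s') t)"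
    and endless: "\<And>s t. 0 \<le> t \<Longrightarrow> \<exists>u>t. rings (c s) u"
    and alive: "\<And>t. 0 \<le> t \<Longrightarrow> \<exists>t'\<ge>t. \<exists>p. is_leftmost (chain c w t') p"
begin

lemma leftmost_exists:
  assumes "0 \<le> t"
  shows "\<exists>p. is_leftmost (chain c w t) p"
proof -
  obtain t' p where t': "t \<le> t'" "is_leftmost (chain c w t') p" using alive[OF assms] by blast
  have left: "\<not> chain c w t s" if "s < i0" for s
    using w_leftmost assms that by (intro zeros_persist[of 0 t i0]) (auto simp: chain_0 is_leftmost_def)
  have "\<exists>s. chain c w t s"
  proof (rule ccontr)
    assume "\<nexists>s. chain c w t s"
    then have "\<not> chain c w t' p" using zeros_persist[OF assms t'(1), of "p + 1" p] by simp
    with t'(2) show False by (simp add: is_leftmost_def)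
  qed
  then obtain s where s: "chain c w t s" by blast
  define k where "k = (LEAST k. chain c w t (i0 + int k))"
  have "\<not> s < i0" using left s by blast
  then have "chain c w t (i0 + int (nat (s - i0)))" using s by simp
  then have 1: "chain c w t (i0 + int k)" unfolding k_def by (rule LeastI)
  have 2: "\<not> chain c w t r" if "r < i0 + int k" for r
  proof (cases "r < i0")
    case False
    then have "nat (r - i0) < k" using that by linarith
    then have "\<not> chain c w t (i0 + int (nat (r - i0)))" unfolding k_def by (rule not_less_Least)
    then show ?thesis using False by simp
  qed (use left in simp)
  from 1 2 show ?thesis by (auto simp: is_leftmost_def)
qed

text \<open>Just before the ring the bits are y, with leftmost one at p. The flip complements
  everything from p on, so the new leftmost one, which exists by \<open>leftmost_exists\<close>, is
  the first zero of y behind p, and its distance from p is \<open>ones\<close>.\<close>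

lemma front_step:
  assumes t: "0 \<le> t" "is_leftmost (chain c w t) p"
  defines "t' \<equiv> next_ring (c p) t"
  obtains k where "1 \<le> k" "ones (\<lambda>j. Lim (at_left t') (\<lambda>u. chain c w u (p + int j))) = enat k"
    "is_leftmost (chain c w t') (p + int k)" "t < t'"
proof -
  note nr = next_ring[where p = p, OF t(1) endless[OF t(1)], folded t'_def]
  define y where "y k = Lim (at_left t') (\<lambda>u. chain c w u k)" for k
  have lm: "is_leftmost (chain c w u) p" if "t < u" "u < t'" for u
    using that nr(3) by (intro front_persists[OF t(1) _ t(2)]) auto
  have Lim: "Lim (at_left t') (\<lambda>u. chain c w u k) = b" if "\<And>u. t < u \<Longrightarrow> u < t' \<Longrightarrow> chain c w u k = b" for k b
  proof (intro tendsto_Lim tendsto_eventually)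
    show "\<forall>\<^sub>F u in at_left t'. chain c w u k = b"
      using eventually_at_left_real[OF nr(1)] by eventually_elim (use that in auto)
  qed simp
  have yp: "y p" "\<And>k. k < p \<Longrightarrow> \<not> y k"
    unfolding y_def using Lim[of p True] Lim[of _ False] lm by (auto simp: is_leftmost_def)
  have "i0 \<le> p"
    using leftmost_mono[of 0 t i0 p] t w_leftmost by (simp add: chain_0)
  then have "chain c w t' = flip p y"
    unfolding y_def using nr(1,2) t(1) simple[of _ p t']
    by (intro chain_update[OF cp]) (auto simp: i0_def)
  then have ch: "chain c w t' = (\<lambda>k. if p \<le> k then \<not> y k else y k)"
    using yp(1) by (simp add: flip_def)
  obtain q where q: "is_leftmost (chain c w t') q" using leftmost_exists[of t'] t(1) nr(1) by auto
  have qp: "p < q"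
  proof (rule ccontr)
    assume "\<not> p < q"
    then have "\<not> chain c w t' q" using yp unfolding ch by (cases "q = p") auto
    with q show False by (simp add: is_leftmost_def)
  qed
  define k where "k = nat (q - p)"
  have k: "1 \<le> k" "q = p + int k" using qp by (auto simp: k_def)
  have yq: "\<not> y q" using q qp by (simp add: is_leftmost_def ch)
  have ones_y: "y s" if "p \<le> s" "s < q" for s using q that by (auto simp: is_leftmost_def ch)
  have "ones (\<lambda>j. y (p + int j)) = enat k"
    unfolding ones_def
  proof (rule antisym)
    show "(INF j\<in>{j. 1 \<le> j \<and> \<not> y (p + int j)}. enat j) \<le> enat k"
      using k yq by (intro INF_lower) simp
    show "enat k \<le> (INF j\<in>{j. 1 \<le> j \<and> \<not> y (p + int j)}. enat j)"
    proof (rule INF_greatest)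
      fix j assume "j \<in> {j. 1 \<le> j \<and> \<not> y (p + int j)}"
      then have "\<not> p + int j < q" using ones_y[of "p + int j"] by auto
      then show "enat k \<le> enat j" using k by simp
    qed
  qed
  then show ?thesis using that[OF k(1)] q nr(1) unfolding k(2) y_def by blast
qed

lemma sigma_front:
  "0 \<le> sigma c w n \<and> is_leftmost (chain c w (sigma c w n)) (front c w n) \<and> i0 + int n \<le> front c w n
    \<and> (\<Sum>j=1..n. ereal_of_enat (jump c w j)) = ereal (real_of_int (front c w n - i0))"
proof (induction n)
  case 0
  show ?case using w_leftmost by (simp add: chain_0 i0_def)
next
  case (Suc n)
  then have t: "0 \<le> sigma c w n" "is_leftmost (chain c w (sigma c w n)) (front c w n)" by blast+
  obtain k where k: "1 \<le> k"
    "ones (\<lambda>j. Lim (at_left (next_ring (c (front c w n)) (sigma c w n))) (\<lambda>u. chain c w u (front c w n + int j))) = enat k"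
    "is_leftmost (chain c w (next_ring (c (front c w n)) (sigma c w n))) (front c w n + int k)"
    "sigma c w n < next_ring (c (front c w n)) (sigma c w n)"
    by (rule front_step[OF t])
  have j: "jump c w (Suc n) = enat k" using k(2) by simp
  then have f: "front c w (Suc n) = front c w n + int k" by simp
  have "(\<Sum>j=1..Suc n. ereal_of_enat (jump c w j)) = ereal (real_of_int (front c w n - i0)) + ereal_of_enat (enat k)"
  proof -
    have "(\<Sum>j=1..Suc n. ereal_of_enat (jump c w j)) = (\<Sum>j=1..n. ereal_of_enat (jump c w j)) + ereal_of_enat (jump c w (Suc n))"
      by (simp del: jump.simps)
    then show ?thesis using Suc unfolding j by simp
  qed
  also have "\<dots> = ereal (real_of_int (front c w (Suc n) - i0))" unfolding f by simp
  finally have "(\<Sum>j=1..Suc n. ereal_of_enat (jump c w j)) = ereal (real_of_int (front c w (Suc n) - i0))" .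
  moreover have "is_leftmost (chain c w (sigma c w (Suc n))) (front c w (Suc n))"
    unfolding f using k(3) by simp
  moreover have "0 \<le> sigma c w (Suc n)" using t(1) k(4) by simp
  moreover have "i0 + int (Suc n) \<le> front c w (Suc n)" unfolding f using Suc k(1) by simp
  ultimately show ?case by blast
qed

lemma sigma_less: "sigma c w n < sigma c w (Suc n)"
proof -
  have 0: "0 \<le> sigma c w n" by (rule conjunct1[OF sigma_front])
  have "\<exists>u>sigma c w n. rings (c (front c w n)) u" by (rule endless[OF 0])
  from next_ring(1)[OF 0 this] show ?thesis by (simp only: sigma.simps)
qed

text \<open>The front advances by at least 1 per jump. If all \<open>sigma\<close> stayed below some
  Z, the leftmost one at time Z would lie at or beyond i0 + n for every n.\<close>

lemma sigma_at_top: "filterlim (sigma c w) at_top sequentially"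
proof -
  have "incseq (sigma c w)" by (intro incseq_SucI less_imp_le sigma_less)
  have "\<exists>n. Z \<le> sigma c w n" for Z
  proof (rule ccontr)
    assume "\<nexists>n. Z \<le> sigma c w n"
    then have less: "sigma c w n < Z" for n by (meson not_le)
    then have Z: "0 \<le> Z" using sigma_front[of 0] less[of 0] by linarith
    obtain p where p: "is_leftmost (chain c w Z) p" using leftmost_exists[OF Z] by blast
    have "i0 + int n \<le> p" for n
      using leftmost_mono[of "sigma c w n" Z "front c w n" p] sigma_front[of n] less[of n] p by linarith
    from this[of "nat (p - i0) + 1"] show False by linarith
  qed
  then show ?thesis
    using \<open>incseq (sigma c w)\<close> unfolding filterlim_at_top eventually_sequentially
    by (meson incseqD order_trans)
qed

theorem spd_bounds:
  fixes a b A B :: real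
  assumes lower: "\<forall>\<^sub>F n in sequentially. \<forall>p. is_leftmost (chain c w (real n ^ 8)) p \<longrightarrow> a * real n ^ 8 - A \<le> real_of_int (p - i0)"
    and upper: "\<forall>\<^sub>F n in sequentially. \<forall>p. is_leftmost (chain c w (real n ^ 8)) p \<longrightarrow> real_of_int (p - i0) \<le> b * real n ^ 8 + B * (real n)\<^sup>2"
    and a: "a' < a" and b: "b < b'"
  shows "ereal a' \<le> liminf (spd c w)" "limsup (spd c w) \<le> ereal b'"
proof -
  have lim: "(\<lambda>n. (x * f n + y * g n) / h n) \<longlonglongrightarrow> x"
    if "(\<lambda>n. f n / h n) \<longlonglongrightarrow> 1" "(\<lambda>n. g n / h n) \<longlonglongrightarrow> 0" for x y :: real and f g h :: "nat \<Rightarrow> real"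
  proof -
    have "(\<lambda>n. x * (f n / h n) + y * (g n / h n)) \<longlonglongrightarrow> x * 1 + y * 0"
      using that by (intro tendsto_intros)
    then show ?thesis by (simp add: add_divide_distrib)
  qed
  have "(\<lambda>n. (a * real n ^ 8 + (- A) * 1) / real (Suc n) ^ 8) \<longlonglongrightarrow> a"
    by (rule lim; real_asymp)
  then have l: "\<forall>\<^sub>F n in sequentially. a' < (a * real n ^ 8 - A) / real (Suc n) ^ 8"
    using a order_tendstoD(1) by fastforce
  have "(\<lambda>n. (a * real n ^ 8 + (- A) * 1) / real n ^ 8) \<longlonglongrightarrow> a"
    by (rule lim; real_asymp)
  then have l2: "\<forall>\<^sub>F n in sequentially. a' < (a * real n ^ 8 - A) / real n ^ 8"
    using a order_tendstoD(1) by fastforce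
  have "(\<lambda>n. (b * real (Suc n) ^ 8 + B * (real (Suc n))\<^sup>2) / real n ^ 8) \<longlonglongrightarrow> b"
    by (rule lim; real_asymp)
  then have u: "\<forall>\<^sub>F n in sequentially. (b * real (Suc n) ^ 8 + B * (real (Suc n))\<^sup>2) / real n ^ 8 < b'"
    using b by (rule order_tendstoD)
  have "(\<lambda>n. (b * real (Suc n) ^ 8 + B * (real (Suc n))\<^sup>2) / real (Suc n) ^ 8) \<longlonglongrightarrow> b"
    by (rule lim; real_asymp)
  then have u2: "\<forall>\<^sub>F n in sequentially. (b * real (Suc n) ^ 8 + B * (real (Suc n))\<^sup>2) / real (Suc n) ^ 8 < b'"
    using b by (rule order_tendstoD)
  obtain m0 where m0: "\<And>m. m0 \<le> m \<Longrightarrow>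
      (\<forall>p. is_leftmost (chain c w (real m ^ 8)) p \<longrightarrow> a * real m ^ 8 - A \<le> real_of_int (p - i0)) \<and>
      (\<forall>p. is_leftmost (chain c w (real m ^ 8)) p \<longrightarrow> real_of_int (p - i0) \<le> b * real m ^ 8 + B * (real m)\<^sup>2) \<and>
      a' < (a * real m ^ 8 - A) / real (Suc m) ^ 8 \<and> a' < (a * real m ^ 8 - A) / real m ^ 8 \<and>
      (b * real (Suc m) ^ 8 + B * (real (Suc m))\<^sup>2) / real m ^ 8 < b' \<and>
      (b * real (Suc m) ^ 8 + B * (real (Suc m))\<^sup>2) / real (Suc m) ^ 8 < b'"
    using eventually_conj[OF lower eventually_conj[OF upper eventually_conj[OF l eventually_conj[OF l2 eventually_conj[OF u u2]]]]]
    unfolding eventually_sequentially by blast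
  \<comment> \<open>The numerator may be negative, and then the quotient is largest at the right end
    of the interval. The lower bound on the speed uses the inequality for the negated
    numerator.\<close>
  have between: "x / t \<le> max (x / lo) (x / hi)" if "0 < lo" "lo \<le> t" "t \<le> hi" for x t lo hi :: real
  proof (cases "0 \<le> x")
    case True
    then have "x / t \<le> x / lo" using that by (intro divide_left_mono) auto
    then show ?thesis by simp
  next
    case False
    then have "x / t \<le> x / hi" using that by (intro divide_left_mono_neg) auto
    then show ?thesis by simp
  qed
  have key: "a' \<le> real_of_int (front c w n - i0) / sigma c w n \<and> real_of_int (front c w n - i0) / sigma c w n \<le> b'"
    if n: "real (Suc m0) ^ 8 \<le> sigma c w n" for n
  proof -
    let ?t = "sigma c w n" and ?x = "real_of_int (front c w n - i0)"
    have "1 \<le> real (Suc m0) ^ 8" by (rule one_le_power) simp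
    then have t1: "1 \<le> ?t" using n by linarith
    define m where "m = nat \<lfloor>root 8 ?t\<rfloor>"
    have r0: "0 \<le> root 8 ?t" using t1 by simp
    have r: "real m \<le> root 8 ?t" "root 8 ?t < real m + 1" using r0 unfolding m_def by linarith+
    have rp: "root 8 ?t ^ 8 = ?t" using t1 by simp
    have tm: "real m ^ 8 \<le> ?t" using power_mono[OF r(1), of 8] rp by (simp add: add.commute)
    have tM: "?t \<le> real (Suc m) ^ 8" using power_mono[of "root 8 ?t" "real m + 1" 8] r r0 rp by (simp add: add.commute)
    have "real (Suc m0) \<le> root 8 ?t"
    proof -
      have "root 8 (real (Suc m0) ^ 8) = real (Suc m0)" by (rule real_root_power_cancel) auto
      moreover have "root 8 (real (Suc m0) ^ 8) \<le> root 8 ?t" using n by (intro real_root_le_mono) auto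
      ultimately show ?thesis by linarith
    qed
    then have "real (Suc m0) < real m + 1" using r(2) by linarith
    then have mm: "m0 \<le> m" "1 \<le> m" by simp_all
    obtain p where p: "is_leftmost (chain c w (real m ^ 8)) p" using leftmost_exists[of "real m ^ 8"] by auto
    obtain p' where p': "is_leftmost (chain c w (real (Suc m) ^ 8)) p'" using leftmost_exists[of "real (Suc m) ^ 8"] by auto
    have fr: "is_leftmost (chain c w ?t) (front c w n)" "0 \<le> ?t" using sigma_front[of n] by auto
    have "p \<le> front c w n" using leftmost_mono[OF _ tm p fr(1)] by simp
    then have x1: "a * real m ^ 8 - A \<le> ?x" using m0[OF mm(1)] p by fastforce
    have "front c w n \<le> p'" using leftmost_mono[OF fr(2) tM fr(1) p'] .
    then have x2: "?x \<le> b * real (Suc m) ^ 8 + B * (real (Suc m))\<^sup>2" using m0[of "Suc m"] mm(1) p' by fastforce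
    have pos: "0 < real m ^ 8" using mm(2) by simp
    have "- ((a * real m ^ 8 - A) / ?t) \<le> - a'"
    proof -
      have "- (a * real m ^ 8 - A) / ?t \<le> max (- (a * real m ^ 8 - A) / real m ^ 8) (- (a * real m ^ 8 - A) / real (Suc m) ^ 8)"
        using between[OF pos tm tM] .
      moreover have "a' < (a * real m ^ 8 - A) / real m ^ 8" "a' < (a * real m ^ 8 - A) / real (Suc m) ^ 8"
        using m0[OF mm(1)] by blast+
      ultimately show ?thesis unfolding minus_divide_left[symmetric] by linarith
    qed
    moreover have "(a * real m ^ 8 - A) / ?t \<le> ?x / ?t" using x1 t1 by (intro divide_right_mono) auto
    moreover have "?x / ?t \<le> (b * real (Suc m) ^ 8 + B * (real (Suc m))\<^sup>2) / ?t"
      using x2 t1 by (intro divide_right_mono) auto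
    moreover have "(b * real (Suc m) ^ 8 + B * (real (Suc m))\<^sup>2) / ?t \<le> b'"
      using between[OF pos tm tM, of "b * real (Suc m) ^ 8 + B * (real (Suc m))\<^sup>2"] m0[OF mm(1)] by auto
    ultimately show ?thesis by linarith
  qed
  have "\<forall>\<^sub>F n in sequentially. max 1 (real (Suc m0) ^ 8) \<le> sigma c w n"
    using sigma_at_top unfolding filterlim_at_top by blast
  then have ev: "\<forall>\<^sub>F n in sequentially. ereal a' \<le> spd c w n \<and> spd c w n \<le> ereal b'"
  proof eventually_elim
    case (elim n)
    then have "1 \<le> sigma c w n" by (meson max.boundedE)
    then have "0 < sigma c w n" by linarith
    then have "spd c w n = ereal (real_of_int (front c w n - i0) / sigma c w n)"
      using sigma_front[of n] by (auto simp: spd_def)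
    then show ?case using key[of n] elim by (metis ereal_less_eq(3) max.boundedE)
  qed
  show "ereal a' \<le> liminf (spd c w)" using ev by (intro Liminf_bounded) (auto elim: eventually_mono)
  show "limsup (spd c w) \<le> ereal b'" using ev by (intro Limsup_bounded) (auto elim: eventually_mono)
qed

end

section \<open>The speed\<close>

text \<open>Bits beyond J do not influence the box chain on the sites up to J. Replacing them by
  alternating bits puts the starting configuration into \<open>boxed\<close>.\<close>

definition alt :: "(int \<Rightarrow> bool) \<Rightarrow> int \<Rightarrow> (int \<Rightarrow> bool)" where
  "alt w J s = (if s \<le> J then w s else w J = even (s - J))"

lemma alt_boxed:
  assumes "is_leftmost w i" "i \<le> J"
  shows "alt w J \<in> boxed i J" "is_leftmost (alt w J) i"
proof -
  have "alt w J (s + 1) = (\<not> alt w J s)" if "J \<le> s" for s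
  proof (cases "s = J")
    case False
    then show ?thesis using that by (auto simp: alt_def)
  qed (simp add: alt_def)
  then show "alt w J \<in> boxed i J" using assms by (simp add: boxed_def alt_def is_leftmost_def)
  show "is_leftmost (alt w J) i" using assms by (simp add: alt_def is_leftmost_def)
qed

lemma box_chain_alt:
  assumes "leftmost (alt w J) = leftmost w" "s \<le> J"
  shows "box_chain c (alt w J) J t s = box_chain c w J t s"
proof -
  let ?L = "\<lambda>u. sorted_list_of_set (ringing_sites c {leftmost w..J} u)"
  have fin: "finite (ringing_sites c {leftmost w..J} u)" for u
    by (rule finite_subset[of _ "{leftmost w..J}"]) (auto simp: ringing_sites_def)
  have filt: "filter (\<lambda>r. r \<le> J) (?L u) = ?L u" for u
    using fin by (auto simp: filter_id_conv ringing_sites_def)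
  have *: "fold (\<lambda>u. fold flip (?L u)) us \<eta> k = fold (\<lambda>u. fold flip (?L u)) us \<zeta> k"
    if "\<And>k. k \<le> J \<Longrightarrow> \<eta> k = \<zeta> k" "k \<le> J" for us \<eta> \<zeta> k
    using that
  proof (induction us arbitrary: \<eta> \<zeta>)
    case (Cons u us)
    have "fold flip (?L u) \<eta> k = fold flip (?L u) \<zeta> k" if "k \<le> J" for k
      using fold_flip_agree[of J \<eta> \<zeta> k "?L u"] Cons.prems(1) that unfolding filt by blast
    then show ?case
      using Cons.IH[of "fold flip (?L u) \<eta>" "fold flip (?L u) \<zeta>"] Cons.prems(2)
      unfolding fold.simps comp_def by blast
  qed simp
  show ?thesis
    unfolding box_chain_def assms(1) by (rule *) (use assms(2) in \<open>simp_all add: alt_def\<close>)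
qed

lemma (in ring_path) box_chain_boxed:
  assumes "i0 \<le> J" "0 \<le> t"
  shows "box_chain c (alt w J) J t \<in> boxed i0 J"
proof -
  note ab = alt_boxed[OF w_leftmost assms(1)]
  have "alt w J \<in> configurations" using ab(2) unfolding configurations_def by blast
  then have "ring_path c (alt w J)" using cp by (intro ring_path.intro)
  then interpret alt: ring_path c "alt w J" .
  have i: "alt.i0 = i0" unfolding alt.i0_def using leftmost_eq[OF ab(2)] .
  show ?thesis
  proof (rule alt.box_chain_preserves[of 0 t "\<lambda>z. z \<in> boxed i0 J"])
    show "box_chain c (alt w J) J 0 \<in> boxed i0 J" using ab(1) by (simp add: box_chain_def)
    show "flip r z \<in> boxed i0 J" if "z \<in> boxed i0 J" "alt.i0 \<le> r" "r \<le> J" for z r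
      using closed_under_flipsD[OF closed_boxed that(1), of r] that(2,3) closed_under_flipsD unfolding i
      by (cases "z r") (auto simp: flip_def)
  qed (use assms in auto)
qed

lemma (in ring_path) chain_leftmost_box:
  assumes "i0 \<le> J" "leftmost (box_chain c (alt w J) J t) \<le> J" "0 \<le> t"
  shows "is_leftmost (chain c w t) (leftmost (box_chain c (alt w J) J t))"
proof -
  let ?z = "box_chain c (alt w J) J t"
  have "is_leftmost ?z (leftmost ?z)"
    using boxed_leftmost[OF box_chain_boxed[OF assms(1,3)]] assms(1) by simp
  moreover have "leftmost (alt w J) = leftmost w"
    using leftmost_eq[OF alt_boxed(2)[OF w_leftmost assms(1)]] by (simp add: i0_def)
  then have "chain c w t s = ?z s" if "s \<le> J" for s
    using chain_box[OF that, of t] box_chain_alt[OF _ that] by simp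
  ultimately show ?thesis using assms(2) by (simp add: is_leftmost_def)
qed

section \<open>Orders of magnitude in a box of length about 16 n ^ 8\<close>

lemma ssum_le: "ssum n \<le> 30 * qrt n"
proof (induction n)
  case (Suc n)
  show ?case
  proof (cases "n < 8")
    case True
    then show ?thesis by (simp add: ssum_small)
  next
    case False
    define x y where "x = qrt n" and "y = qrt (Suc n)"
    have x: "1 \<le> x" "x \<le> y" "x ^ 4 = real n" "y ^ 4 = real n + 1"
      using False qrt_ge_1[of n] qrt_mono[of n "Suc n"] qrt_pow4[of n] qrt_pow4[of "Suc n"]
      by (auto simp: x_def y_def)
    have "y ^ 4 \<le> (2 * x) ^ 4" using x(3,4) False by (simp add: power_mult_distrib)
    then have y2: "y \<le> 2 * x" using x by (subst (asm) power_mono_iff) auto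
    \<comment> \<open>As y ^ 4 - x ^ 4 = 1 and y \<le> 2 * x, the fourth root grows by at least 1 /
      (15 * x ^ 3), while \<open>coef n\<close> is at most 2 / x ^ 3; hence the factor 30.\<close>
    have "1 = (y - x) * ((y + x) * (y\<^sup>2 + x\<^sup>2))"
    proof -
      have "(y - x) * ((y + x) * (y\<^sup>2 + x\<^sup>2)) = y ^ 4 - x ^ 4" by algebra
      then show ?thesis using x(3,4) by simp
    qed
    also have "\<dots> \<le> (y - x) * ((2 * x + x) * ((2 * x)\<^sup>2 + x\<^sup>2))"
      using x y2 by (intro mult_left_mono mult_mono add_mono power_mono) auto
    also have "\<dots> = (y - x) * (15 * x ^ 3)" by (simp add: power2_eq_square power3_eq_cube)
    finally have "1 \<le> (y - x) * (15 * x ^ 3)" .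
    then have 1: "2 / x ^ 3 \<le> 30 * (y - x)" 
    proof -
      have "30 * (y - x) * x ^ 3 = 2 * ((y - x) * (15 * x ^ 3))" by (simp add: algebra_simps)
      then have "2 \<le> 30 * (y - x) * x ^ 3" using \<open>1 \<le> (y - x) * (15 * x ^ 3)\<close> by linarith
      moreover have "0 < x ^ 3" using x(1) by simp
      ultimately show ?thesis by (simp only: pos_divide_le_eq)
    qed
    have "coef n = (32 / 25 + x / 200) / x ^ 4" using False x(3) by (simp add: coef_def x_def)
    also have "\<dots> \<le> (2 * x) / x ^ 4" using x(1) by (intro divide_right_mono) auto
    also have "\<dots> = 2 / x ^ 3" using x(1) by (simp add: power4_eq_xxxx power3_eq_cube)
    finally show ?thesis using Suc 1 by (simp add: ssum_Suc x_def y_def)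
  qed
qed (simp add: ssum_def)

lemma slack_lin: "real k \<le> 8 + 256 * slack k"
proof (induction k)
  case (Suc k)
  show ?case
  proof (cases "k < 8")
    case True
    then have "real (Suc k) \<le> 8" by simp
    then show ?thesis using slack_nonneg[of "Suc k"] by linarith
  next
    case False
    then have "256 * slack (Suc k) = 256 * slack k + qrt k" by (simp add: slack_def)
    then show ?thesis using Suc qrt_ge_1[of k] False by simp
  qed
qed (simp add: slack_def)

text \<open>From k to k + 1 the square grows by 2 * k + 1, and k \<le> (L / qrt L) * qrt k because
  qrt k / k is nonincreasing. The numbers 256 and 512 undo the divisor in
  \<open>slack\<close>.\<close>

lemma slack_sq:
  assumes "1 \<le> L" "k \<le> L"
  shows "(real k)\<^sup>2 \<le> 64 + (256 + 512 * (real L / qrt L)) * slack k"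
  using assms(2)
proof (induction k)
  case (Suc k)
  let ?r = "real L / qrt L"
  have qL: "1 \<le> qrt L" using assms(1) by (rule qrt_ge_1)
  show ?case
  proof (cases "k < 8")
    case True
    then have "real (Suc k) \<le> 8" by simp
    then have "(real (Suc k))\<^sup>2 \<le> 8\<^sup>2" by (intro power_mono) auto
    then have "(real (Suc k))\<^sup>2 \<le> 64" by (simp only: power2_eq_square)
    moreover have "0 \<le> (256 + 512 * ?r) * slack (Suc k)" using qL by simp
    ultimately show ?thesis by linarith
  next
    case False
    have "slack (Suc k) = slack k + qrt k / 256" using False by (simp add: slack_def add_divide_distrib)
    then have e: "(256 + 512 * ?r) * slack (Suc k) = (256 + 512 * ?r) * slack k + qrt k + 2 * (?r * qrt k)"
    proof -
      have "(256 + 512 * r) * (slack k + q / 256) = (256 + 512 * r) * slack k + q + 2 * (r * q)" for r q :: real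
        by (simp add: algebra_simps)
      then show ?thesis unfolding \<open>slack (Suc k) = slack k + qrt k / 256\<close> .
    qed
    have "qrt L / real L \<le> qrt k / real k" using False Suc.prems by (intro qrt_div_antimono) auto
    then have "real k \<le> ?r * qrt k" using False Suc.prems qL by (simp add: field_simps)
    moreover have "1 \<le> qrt k" using False by (intro qrt_ge_1) simp
    moreover have "(real (Suc k))\<^sup>2 = (real k)\<^sup>2 + 2 * real k + 1" by (simp add: power2_eq_square algebra_simps)
    moreover have "(real k)\<^sup>2 \<le> 64 + (256 + 512 * ?r) * slack k" using Suc.IH Suc.prems by simp
    ultimately show ?thesis unfolding e by linarith
  qed
qed (simp add: slack_def)

lemma pot_bounds:
  assumes "1 \<le> k" "1 \<le> m" "1 \<le> l" "k \<le> L" "m \<le> L"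
  shows "0 \<le> pot k m l" "pot k m l \<le> 4 + 2 * ssum L"
proof -
  have r: "1 / real k \<le> 1" "1 / real m \<le> 1" "0 \<le> 1 / real k" "0 \<le> 1 / real m" using assms by auto
  show "0 \<le> pot k m l" using cell_range[of k m l] assms by (simp add: pot_def)
  have "ssum m * (1 / real k) \<le> ssum m * 1" using r by (intro mult_left_mono) auto
  then have "ssum m / real k \<le> ssum L" using ssum_mono[OF assms(5)] by simp
  moreover have "psum l * (1 / real k + 1 / real m) \<le> 9 / 50 * 2"
    using r psum_le by (intro mult_mono) auto
  moreover have "cell k m l \<le> 3" using cell_range[of k m l] assms by simp
  ultimately show "pot k m l \<le> 4 + 2 * ssum L"
    using ssum_mono[OF assms(4)] unfolding pot_def by linarith
qed

lemma fpot_bounds: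
  assumes z: "z \<in> boxed i0 J" and J: "i0 \<le> J + 1" and L: "J + 3 - i0 \<le> int L"
  shows "real_of_int (leftmost z) \<le> fpot z" "fpot z \<le> real_of_int (leftmost z) + (4 + 2 * ssum L)"
proof -
  obtain k m l where kml: "1 \<le> k" "1 \<le> m" "1 \<le> l" "k \<le> L" "m \<le> L" "fpot z = real_of_int (leftmost z) + pot k m l"
  proof (cases "leftmost z \<le> J")
    case True
    obtain k m l l' where "runs z (leftmost z) J i0 k m l l'" using runs_exist[OF z J True] .
    then interpret runs z "leftmost z" J i0 k m l l' .
    have "k + m + l \<le> L" using in_box(3) iJ L by linarith
    then show ?thesis using that[of k m l] pos fpot by simp
  next
    case False
    \<comment> \<open>Here the leftmost one is at J + 1, in the alternating region, so that all runs
      behind it have length 1.\<close>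
    have lm: "is_leftmost z (leftmost z)" "leftmost z = J + 1"
      using boxed_leftmost[OF z J] False by auto
    have a: "z (s + 1) = (\<not> z s)" if "J \<le> s" for s using z that by (simp add: boxed_def)
    have 1: "z (J + 1)" using lm by (simp add: is_leftmost_def)
    have 2: "\<not> z (J + 2)" using a[of "J + 1"] 1 by (simp add: add.commute)
    have 3: "z (J + 3)" using a[of "J + 2"] 2 by (simp add: add.commute)
    have 4: "\<not> z (J + 4)" using a[of "J + 3"] 3 by (simp add: add.commute)
    have one: "seg z b 1 v" if "z b = v" "z (b + 1) = (\<not> v)" for b v
      unfolding seg_def
    proof (intro conjI allI impI)
      fix s assume "b \<le> s" "s < b + int 1"
      then have "s = b" by simp
      then show "z s = v" using that(1) by simp
    qed (use that in simp_all)
    have "fpot z = real_of_int (leftmost z) + pot 1 1 1"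
      unfolding lm(2) using lm 1 2 3 4 by (intro fpot_eq one) (simp_all add: add.assoc)
    moreover have "1 \<le> L" using J L by linarith
    ultimately show ?thesis using that[of 1 1 1] by simp
  qed
  show "real_of_int (leftmost z) \<le> fpot z" "fpot z \<le> real_of_int (leftmost z) + (4 + 2 * ssum L)"
    using pot_bounds[OF kml(1-5)] kml(6) by auto
qed

lemma qrt_16: "qrt (16 * n ^ 8) = 2 * (real n)\<^sup>2"
proof (rule power_eq_imp_eq_base[of _ 4])
  show "qrt (16 * n ^ 8) ^ 4 = (2 * (real n)\<^sup>2) ^ 4"
    by (simp add: qrt_pow4 power_mult_distrib flip: power_mult)
qed auto

text \<open>With y = n, the correction is of order y ^ 2, b of order y ^ 6, M and T of order y ^ 8.
  So b * M, of order y ^ 14, dominates the numerator, against y ^ 16 in the denominator. The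
  deviation 1/50 is 2.9 - 2.88.\<close>

lemma upper_expect:
  assumes w: "w \<in> boxed i0 J" and n: "1 \<le> n" and J: "J = i0 + 16 * int n ^ 8 - 3" and eta: "0 < \<eta>"
  shows "\<exists>K0>0. \<forall>K\<ge>K0. expect (1 - exp (- (real n ^ 8 / real K))) (concat (replicate K (sorted_list_of_set {i0..J})))
      (\<lambda>z. of_bool (fpot w + 29 / 10 * real n ^ 8 \<le> fpot z)) w \<le> 3 * 10 ^ 12 / (real n)\<^sup>2 + \<eta>"
proof -
  define y where "y = real n"
  define L where "L = 16 * n ^ 8"
  \<comment> \<open>Bounds 4 + 2 * ssum L, since ssum L \<le> 30 * qrt L and qrt L = 2 * y ^
    2.\<close>
  define Mp where "Mp = 124 * y\<^sup>2"
  \<comment> \<open>Inserting \<open>slack_lin\<close> and \<open>slack_sq\<close> into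
    \<open>drift_square\<close>: b collects the factors of \<open>slack k\<close>, and c2 the
    remaining terms.\<close>
  define b where "b = 256 * Mp\<^sup>2 + 512 + 1024 * (real L / qrt L)"
  define c2 where "c2 = 12 * Mp\<^sup>2 + 21 * Mp + 128"
  define M where "M = real L + Mp"
  define q where "q z = (if leftmost z \<le> J then slack (run z (leftmost z)) else 0)" for z
  have y: "1 \<le> y" using n by (simp add: y_def)
  have ypow: "y ^ i \<le> y ^ j" if "i \<le> j" for i j using power_increasing[OF that y] .
  have n8: "1 \<le> n ^ 8" using n by (rule one_le_power)
  then have L1: "16 \<le> L" by (simp add: L_def)
  have JL: "J + 3 - i0 = int L" using J by (simp add: L_def)
  then have iJ: "i0 \<le> J" using L1 by linarith
  have rL: "real L = 16 * y ^ 8" by (simp add: L_def y_def)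
  have qL: "qrt L = 2 * y\<^sup>2" unfolding L_def y_def by (rule qrt_16)
  have y2: "1 \<le> y\<^sup>2" using ypow[of 0 2] by simp
  have Mp1: "1 \<le> Mp" "0 \<le> Mp" using y2 by (auto simp: Mp_def)
  have sL: "4 + 2 * ssum L \<le> Mp" "ssum L \<le> Mp"
  proof -
    have "ssum L \<le> 60 * y\<^sup>2" using ssum_le[of L] qL by simp
    then show "4 + 2 * ssum L \<le> Mp" "ssum L \<le> Mp" using y2 unfolding Mp_def by linarith+
  qed
  have rqL: "real L / qrt L = 8 * y ^ 6"
    unfolding rL qL using y by (simp add: field_simps flip: power_add)
  have set: "set (sorted_list_of_set {i0..J}) = {i0..J}" by simp
  have T: "0 < y ^ 8" using y by simp
  have fb: "real_of_int (leftmost z) \<le> fpot z" "fpot z \<le> real_of_int (leftmost z) + Mp"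
    "i0 \<le> leftmost z" "leftmost z \<le> J + 1" if "z \<in> boxed i0 J" for z
    using fpot_bounds[OF that, of L] boxed_leftmost[OF that] iJ JL sL by auto
  have "\<exists>K0>0. \<forall>K\<ge>K0. expect (1 - exp (- (y ^ 8 / real K))) (concat (replicate K (sorted_list_of_set {i0..J})))
      (\<lambda>z. of_bool ((fpot w - i0) + 288 / 100 * y ^ 8 + 1 / 50 * y ^ 8 \<le> fpot z - i0)) w
      \<le> (c2 * y ^ 8 + b * (2 * M + \<bar>288 / 100\<bar> * y ^ 8)) / (1 / 50 * y ^ 8)\<^sup>2 + \<eta>"
  proof (rule drift_tail[where q = q and D = "\<lambda>s z. fpot (flip s z) - fpot z"])
    show "closed_under_flips (set (sorted_list_of_set {i0..J})) (boxed i0 J)"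
      unfolding set by (rule closed_boxed)
    show "\<bar>fpot z - real_of_int i0\<bar> \<le> M" if "z \<in> boxed i0 J" for z
    proof -
      have "real_of_int i0 \<le> real_of_int (leftmost z)" "real_of_int (leftmost z) \<le> real_of_int (J + 1)"
        using fb(3,4)[OF that] by (simp_all only: of_int_le_iff)
      moreover have "real_of_int (J + 1) \<le> real_of_int (i0 + int L)" using JL by (simp only: of_int_le_iff)
      ultimately show ?thesis using fb(1,2)[OF that] Mp1 by (simp add: M_def)
    qed
    show "0 \<le> q z" for z by (simp add: q_def)
    show "0 \<le> b" "0 \<le> c2" using Mp1 rqL y by (auto simp: b_def c2_def)
    show "b = 0 \<and> (\<forall>t\<in>{0..y ^ 8}. fpot z - real_of_int i0 \<le> fpot w - real_of_int i0 + 288 / 100 * t) \<and> (\<forall>s. fpot (flip s z) - fpot z = 0)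
      \<or> (\<Sum>s | s \<in> set (sorted_list_of_set {i0..J}) \<and> z s. fpot (flip s z) - fpot z) \<le> 288 / 100 - q z
        \<and> (\<Sum>s | s \<in> set (sorted_list_of_set {i0..J}) \<and> z s. (fpot (flip s z) - fpot z)\<^sup>2) \<le> c2 + b * q z"
      if z: "z \<in> boxed i0 J" for z
    proof (rule disjI2, unfold set, cases "leftmost z \<le> J")
      case True
      obtain k m l l' where "runs z (leftmost z) J i0 k m l l'" 
        using runs_exist[OF z _ True] iJ by (meson add_increasing2 zero_le_one)
      then interpret runs z "leftmost z" J i0 k m l l' .
      have qz: "q z = slack k" using True run_eq[OF s1] by (simp add: q_def)
      have kL: "k \<le> L" using in_box(3) iJ JL by linarith
      have "(\<Sum>s | s \<in> {i0..J} \<and> z s. (fpot (flip s z) - fpot z)\<^sup>2) \<le> real k * Mp\<^sup>2 + 2 * (real k)\<^sup>2 + 4 * Mp\<^sup>2 + 21 * Mp"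
      proof (rule drift_square[of L])
        show "\<bar>pot a b c\<bar> \<le> Mp" if "1 \<le> a" "1 \<le> b" "1 \<le> c" "a + b \<le> L" for a b c
          using pot_bounds[of a b c L] that sL by auto
      qed (use JL sL Mp1 in auto)
      also have "\<dots> \<le> (8 + 256 * slack k) * Mp\<^sup>2 + 2 * (64 + (256 + 512 * (real L / qrt L)) * slack k) + 4 * Mp\<^sup>2 + 21 * Mp"
        using slack_lin[of k] slack_sq[of L k] kL L1 by (intro add_mono mult_right_mono mult_left_mono) auto
      also have "\<dots> = c2 + b * q z" unfolding qz c2_def b_def by (simp add: algebra_simps)
      finally show "(\<Sum>s | s \<in> {i0..J} \<and> z s. fpot (flip s z) - fpot z) \<le> 288 / 100 - q z
        \<and> (\<Sum>s | s \<in> {i0..J} \<and> z s. (fpot (flip s z) - fpot z)\<^sup>2) \<le> c2 + b * q z"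
        using drift unfolding qz by blast
    next
      case False
      have "is_leftmost z (leftmost z)" using boxed_leftmost[OF z] iJ by simp
      \<comment> \<open>All ones lie beyond the box, so no site of the box can flip and both sums
        are empty.\<close>
      then have "{s. s \<in> {i0..J} \<and> z s} = {}" using False by (auto simp: is_leftmost_def)
      then show "(\<Sum>s | s \<in> {i0..J} \<and> z s. fpot (flip s z) - fpot z) \<le> 288 / 100 - q z
        \<and> (\<Sum>s | s \<in> {i0..J} \<and> z s. (fpot (flip s z) - fpot z)\<^sup>2) \<le> c2 + b * q z"
        using False Mp1 by (simp only: q_def c2_def) simp
    qed
  qed (use w T eta in auto)
  moreover have "(c2 * y ^ 8 + b * (2 * M + \<bar>288 / 100\<bar> * y ^ 8)) / (1 / 50 * y ^ 8)\<^sup>2 \<le> 3 * 10 ^ 12 / y\<^sup>2"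
  proof -
    have Mp2: "Mp\<^sup>2 = 15376 * y ^ 4" by (simp add: Mp_def power_mult_distrib flip: power_mult)
    have c: "c2 \<le> 187244 * y ^ 4"
      unfolding c2_def Mp2 unfolding Mp_def using ypow[of 2 4] ypow[of 0 4] by simp
    have b: "b \<le> 3944960 * y ^ 6"
      unfolding b_def Mp2 rqL using ypow[of 4 6] ypow[of 0 6] by simp
    have M: "2 * M + \<bar>288 / 100\<bar> * y ^ 8 \<le> 283 * y ^ 8"
      unfolding M_def rL Mp_def using ypow[of 2 8] ypow[of 0 8] by simp
    have "c2 * y ^ 8 + b * (2 * M + \<bar>288 / 100\<bar> * y ^ 8) \<le> (187244 * y ^ 4) * y ^ 8 + (3944960 * y ^ 6) * (283 * y ^ 8)"
      using c b M Mp1 y by (intro add_mono mult_right_mono mult_mono) (auto simp: M_def)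
    also have "\<dots> = 187244 * y ^ 12 + 1116423680 * y ^ 14" by (simp flip: power_add)
    also have "\<dots> \<le> 1200000000 * y ^ 14" using ypow[of 12 14] ypow[of 0 14] by simp
    finally have "(c2 * y ^ 8 + b * (2 * M + \<bar>288 / 100\<bar> * y ^ 8)) / (1 / 50 * y ^ 8)\<^sup>2
        \<le> 1200000000 * y ^ 14 / (1 / 50 * y ^ 8)\<^sup>2"
      by (intro divide_right_mono) auto
    also have sq: "(1 / 50 * y ^ 8)\<^sup>2 = y ^ 14 * y\<^sup>2 / 2500"
      by (simp add: power_divide flip: power_mult power_add)
    also have "1200000000 * y ^ 14 / (y ^ 14 * y\<^sup>2 / 2500) = 3 * 10 ^ 12 / y\<^sup>2"
    proof -
      have "1200000000 * u / (u * v / 2500) = 3 * 10 ^ 12 / v" if "u \<noteq> 0" for u v :: real using that by simp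
      moreover have "y ^ 14 \<noteq> 0" using y by simp
      ultimately show ?thesis .
    qed
    finally show ?thesis unfolding sq .
  qed
  moreover have e: "(fpot w - i0 + 288 / 100 * y ^ 8 + 1 / 50 * y ^ 8 \<le> fpot z - i0) = (fpot w + 29 / 10 * y ^ 8 \<le> fpot z)" for z
    by linarith
  ultimately show ?thesis unfolding e y_def[symmetric] by (meson add_right_mono order_trans)
qed

text \<open>
  The value \<open>- B\<close> close to the end of the box is low enough for the first alternative in \<open>drift_tail\<close>.
\<close>

definition lpot :: "int \<Rightarrow> int \<Rightarrow> real \<Rightarrow> (int \<Rightarrow> bool) \<Rightarrow> real" where
  "lpot i0 J B z = (if leftmost z + 9 \<le> J then - (real_of_int (leftmost z - i0) + wval z (leftmost z)) else - B)"

text \<open>\<open>drift_tail\<close> bounds upward deviations, whence the minus sign in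
  \<open>lpot\<close>. Increments are bounded here, so b = 0 and q = 0 will do; the deviation 1/2000
  is 1.647 - 1.6465.\<close>

lemma lower_expect:
  assumes w: "w \<in> boxed i0 J" "leftmost w = i0" and n: "1 \<le> n" and J: "J = i0 + 16 * int n ^ 8 - 3" and eta: "0 < \<eta>"
  shows "\<exists>K0>0. \<forall>K\<ge>K0. expect (1 - exp (- (real n ^ 8 / real K))) (concat (replicate K (sorted_list_of_set {i0..J})))
      (\<lambda>z. of_bool (lpot i0 J (18 * real n ^ 8 + 40) w - 16465 / 10000 * real n ^ 8 \<le> lpot i0 J (18 * real n ^ 8 + 40) z)) w
      \<le> 3 * 10 ^ 12 / (real n)\<^sup>2 + \<eta>"
proof -
  define y where "y = real n"
  define B where "B = 18 * y ^ 8 + 40"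
  let ?W = "lpot i0 J B"
  define adv where "adv z = real_of_int (look (advance 4000 lower_trie 9 1) (window z (leftmost z))) / 4000 - wval z (leftmost z)" for z
  \<comment> \<open>At the front D is - \<open>adv z\<close>, the worst case over the bits entering
    the window; this is only an upper bound for the increment of \<open>lpot\<close>, which is all
    that \<open>drift_tail\<close> asks for.\<close>
  define D where "D s z = (if J < leftmost z + 9 then 0 else if s = leftmost z then - adv z
      else if s \<le> leftmost z + 9 then - (wval (flip s z) (leftmost z) - wval z (leftmost z)) else 0)" for s z
  have y: "1 \<le> y" using n by (simp add: y_def)
  have y8: "1 \<le> y ^ 8" using y by (rule one_le_power)
  have n8: "1 \<le> int n ^ 8" using n by (intro one_le_power) simp
  have iJ: "i0 + 9 \<le> J" using J n8 by linarith
  have rJ: "real_of_int J = real_of_int i0 + 16 * y ^ 8 - 3" using J by (simp add: y_def)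
  have set: "set (sorted_list_of_set {i0..J}) = {i0..J}" by simp
  have lb: "is_leftmost z (leftmost z)" "i0 \<le> leftmost z" "leftmost z \<le> J + 1" if "z \<in> boxed i0 J" for z
    using boxed_leftmost[OF that] iJ by auto
  have W0: "- 3 \<le> ?W w" using iJ wval_range[of w i0] by (simp add: lpot_def w(2))
  have "\<exists>K0>0. \<forall>K\<ge>K0. expect (1 - exp (- (y ^ 8 / real K))) (concat (replicate K (sorted_list_of_set {i0..J})))
      (\<lambda>z. of_bool (?W w + (- (1647 / 1000)) * y ^ 8 + 1 / 2000 * y ^ 8 \<le> ?W z)) w
      \<le> (800 * y ^ 8 + 0 * (2 * B + \<bar>- (1647 / 1000)\<bar> * y ^ 8)) / (1 / 2000 * y ^ 8)\<^sup>2 + \<eta>"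
  proof (rule drift_tail[where q = "\<lambda>_. 0" and D = D])
    show "closed_under_flips (set (sorted_list_of_set {i0..J})) (boxed i0 J)"
      unfolding set by (rule closed_boxed)
    show "\<bar>?W z\<bar> \<le> B" if z: "z \<in> boxed i0 J" for z
    proof -
      have "real_of_int i0 \<le> real_of_int (leftmost z)" "real_of_int (leftmost z) \<le> real_of_int (J + 1)"
        using lb(2,3)[OF z] by (simp_all only: of_int_le_iff)
      then show ?thesis using rJ wval_range[of z "leftmost z"] y8 by (simp add: lpot_def B_def)
    qed
    show "?W (flip s z) \<le> ?W z + D s z" if z: "z \<in> boxed i0 J" and s: "s \<in> set (sorted_list_of_set {i0..J})" "z s" for z s
    proof -
      let ?i = "leftmost z"
      have s': "?i \<le> s" using lb(1)[OF z] s(2) by (meson is_leftmost_def not_le)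
      have zi: "z ?i" using lb(1)[OF z] by (simp add: is_leftmost_def)
      obtain k where k: "seg z ?i k True" using seg_exists[OF z, of ?i] zi by auto
      show ?thesis
      proof (cases "s = ?i")
        case True
        have lf: "leftmost (flip s z) = ?i + int k"
          using leftmost_eq[OF leftmost_flip_front[OF lb(1)[OF z] k]] True by simp
        have adv: "adv z \<le> min (real k) 10 + wval (flip s z) (?i + int k) - wval z ?i"
          using wval_front[OF zi k] True by (simp add: adv_def)
        show ?thesis
        proof (cases "J < ?i + 9")
          case True
          then show ?thesis by (simp add: lpot_def lf D_def)
        next
          case False
          then have Wz: "?W z + D s z = - real_of_int (?i - i0) - wval z ?i - adv z"
            using True by (simp add: lpot_def D_def)
          show ?thesis
          proof (cases "?i + int k + 9 \<le> J")
            case True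
            then have "?W (flip s z) = - real_of_int (?i - i0) - real k - wval (flip s z) (?i + int k)"
              by (simp add: lpot_def lf)
            then show ?thesis unfolding Wz using adv by linarith
          next
            case kJ: False
            then have "?W (flip s z) = - B" by (simp add: lpot_def lf)
            moreover have "real_of_int ?i + 9 \<le> real_of_int J" using False by linarith
            ultimately show ?thesis
              unfolding Wz using adv wval_range[of "flip s z" "?i + int k"] rJ y8 by (simp add: B_def min_def split: if_splits)
          qed
        qed
      next
        case False
        then have lf: "leftmost (flip s z) = ?i"
          using leftmost_eq[OF leftmost_flip[OF lb(1)[OF z], of s]] s' by simp
        have "wval (flip s z) ?i = wval z ?i" if "?i + 9 < s"
          using window_flip_far[OF that] by (simp add: wval_def)
        then show ?thesis using False by (auto simp: lpot_def lf D_def)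
      qed
    qed
    show "(0::real) = 0 \<and> (\<forall>t\<in>{0..y ^ 8}. ?W z \<le> ?W w + - (1647 / 1000) * t) \<and> (\<forall>s. D s z = 0)
      \<or> (\<Sum>s | s \<in> set (sorted_list_of_set {i0..J}) \<and> z s. D s z) \<le> - (1647 / 1000) - 0
        \<and> (\<Sum>s | s \<in> set (sorted_list_of_set {i0..J}) \<and> z s. (D s z)\<^sup>2) \<le> 800 + 0 * 0"
      if z: "z \<in> boxed i0 J" for z
    proof (cases "J < leftmost z + 9")
      case True
      have "?W z \<le> ?W w + - (1647 / 1000) * t" if "t \<in> {0..y ^ 8}" for t
        using True W0 that y8 by (simp add: lpot_def B_def)
      then show ?thesis using True by (simp add: D_def)
    next
      case False
      let ?i = "leftmost z"
      define d where "d j = (if z (?i + 1 + int j) then wval (flip (?i + 1 + int j) z) ?i - wval z ?i else 0)" for j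
      have drift: "1647 / 1000 \<le> (\<Sum>j<9. d j) + adv z"
        using wval_drift[of z ?i] by (simp add: d_def adv_def)
      have d3: "\<bar>d j\<bar> \<le> 3" for j
        using wval_range[of z ?i] wval_range[of "flip (?i + 1 + int j) z" ?i] by (auto simp: d_def abs_le_iff)
      have zi: "z ?i" using lb(1)[OF z] by (simp add: is_leftmost_def)
      obtain k where k: "seg z ?i k True" using seg_exists[OF z, of ?i] zi by auto
      \<comment> \<open>At most 10 for the jump and 3 for the correction; from below, the drift
        inequality gives at least 1.647 - 9 * 3. The squares then sum to at most 26 ^ 2 + 9 * 9,
        below 800.\<close>
      have "adv z \<le> 13" using wval_front[OF zi k] wval_range[of z ?i] wval_range[of "flip ?i z" "?i + int k"]
        by (simp add: adv_def min_def split: if_splits)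
      moreover have "(\<Sum>j<9. d j) \<le> (\<Sum>j<(9::nat). 3)" using d3 by (intro sum_mono) (meson abs_le_D1)
      then have "- 26 \<le> adv z" using drift by simp
      ultimately have adv2: "(adv z)\<^sup>2 \<le> 26\<^sup>2" by (intro power2_le_iff_abs_le[THEN iffD2]) auto
      have split: "(\<Sum>s | s \<in> {i0..J} \<and> z s. g (D s z)) = g (- adv z) + (\<Sum>j<9. g (- d j))" if g: "g 0 = 0" for g :: "real \<Rightarrow> real"
      proof -
        let ?A = "{s. s \<in> {i0..J} \<and> z s}"
        let ?f = "\<lambda>j::nat. ?i + 1 + int j"
        have sub: "{?i} \<union> {s \<in> ?f ` {..<9}. z s} \<subseteq> ?A"
          using lb(2)[OF z] False zi by auto
        have rest: "g (D s z) = 0" if "s \<in> ?A - ({?i} \<union> {s \<in> ?f ` {..<9}. z s})" for s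
        proof -
          have "\<not> s < ?i" using that lb(1)[OF z] by (auto simp: is_leftmost_def)
          moreover have "\<not> (?i < s \<and> s \<le> ?i + 9)"
          proof
            assume *: "?i < s \<and> s \<le> ?i + 9"
            then have "s = ?f (nat (s - ?i - 1))" "nat (s - ?i - 1) \<in> {..<9}" by auto
            then have "s \<in> ?f ` {..<9}" by (rule image_eqI)
            with that show False by blast
          qed
          moreover have "s \<noteq> ?i" using that by blast
          ultimately have "?i + 9 < s" by linarith
          then show ?thesis using g by (simp add: D_def)
        qed
        have "finite ?A" by (rule finite_subset[of _ "{i0..J}"]) auto
        then have "(\<Sum>s\<in>?A. g (D s z)) = (\<Sum>s\<in>{?i} \<union> {s \<in> ?f ` {..<9}. z s}. g (D s z))"
          using sub rest by (intro sum.mono_neutral_right) blast+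
        also have "\<dots> = g (D ?i z) + (\<Sum>s\<in>{s \<in> ?f ` {..<9}. z s}. g (D s z))"
          by (subst sum.union_disjoint) auto
        also have "D ?i z = - adv z" using False by (simp add: D_def)
        also have "(\<Sum>s\<in>{s \<in> ?f ` {..<9}. z s}. g (D s z)) = (\<Sum>s\<in>?f ` {..<9}. if z s then g (D s z) else 0)"
          by (rule sum.inter_filter) simp
        also have "\<dots> = (\<Sum>j<9. if z (?f j) then g (D (?f j) z) else 0)"
          by (subst sum.reindex) (auto simp: inj_on_def)
        also have "\<dots> = (\<Sum>j<9. g (- d j))"
          using False g by (intro sum.cong refl) (auto simp: D_def d_def)
        finally show ?thesis .
      qed
      have "(\<Sum>s | s \<in> {i0..J} \<and> z s. D s z) \<le> - (1647 / 1000)"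
        using split[of "\<lambda>x. x"] drift by (simp add: sum_negf)
      moreover have "(\<Sum>s | s \<in> {i0..J} \<and> z s. (D s z)\<^sup>2) \<le> 800"
      proof -
        have "(\<Sum>j<9. (- d j)\<^sup>2) \<le> (\<Sum>j<(9::nat). 3\<^sup>2)"
          using d3 by (intro sum_mono power2_le_iff_abs_le[THEN iffD2]) auto
        then show ?thesis using split[of "\<lambda>x. x\<^sup>2"] adv2 by simp
      qed
      ultimately show ?thesis unfolding set by simp
    qed
  qed (use w y8 eta in auto)
  moreover have "(800 * y ^ 8 + 0 * (2 * B + \<bar>- (1647 / 1000)\<bar> * y ^ 8)) / (1 / 2000 * y ^ 8)\<^sup>2 \<le> 3 * 10 ^ 12 / y\<^sup>2"
  proof -
    have "y\<^sup>2 \<le> y ^ 8" using y by (intro power_increasing) auto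
    then have "3200000000 / y ^ 8 \<le> 3200000000 / y\<^sup>2" using y by (intro divide_left_mono) auto
    also have "\<dots> \<le> 3 * 10 ^ 12 / y\<^sup>2" by (intro divide_right_mono) auto
    finally have "3200000000 / y ^ 8 \<le> 3 * 10 ^ 12 / y\<^sup>2" .
    moreover have "800 * y ^ 8 / (1 / 2000 * y ^ 8)\<^sup>2 = 3200000000 / y ^ 8"
      using y by (simp add: power2_eq_square field_simps)
    ultimately show ?thesis by simp
  qed
  moreover have e: "?W w + (- (1647 / 1000)) * y ^ 8 + 1 / 2000 * y ^ 8 = ?W w - 16465 / 10000 * y ^ 8" by simp
  ultimately show ?thesis unfolding e y_def[symmetric] B_def[symmetric] by (smt (verit) add_mono order_trans)
qed

lemma fpot_le:
  assumes "z \<in> boxed i0 (i0 + 16 * int n ^ 8 - 3)" "1 \<le> n"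
  shows "fpot z \<le> real_of_int (leftmost z) + 124 * (real n)\<^sup>2"
proof -
  have "1 \<le> int n ^ 8" using assms(2) by (intro one_le_power) simp
  then have "fpot z \<le> real_of_int (leftmost z) + (4 + 2 * ssum (16 * n ^ 8))"
    by (intro fpot_bounds(2)[OF assms(1)]) simp_all
  moreover have "ssum (16 * n ^ 8) \<le> 60 * (real n)\<^sup>2" using ssum_le[of "16 * n ^ 8"] by (simp add: qrt_16)
  moreover have "1 \<le> (real n)\<^sup>2" using assms(2) by (intro one_le_power) simp
  ultimately show ?thesis by linarith
qed

text \<open>The upper estimate comes first: it keeps the leftmost one of z at least 9 sites away
  from J. Only then is it the leftmost one of the chain itself, and \<open>lpot\<close> not at its
  frozen value, so that the lower estimate becomes informative. For n \<ge> 3 the term 124 * n ^ 2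
  is small against n ^ 8.\<close>

lemma (in ring_path) leftmost_between:
  fixes n :: nat and J :: int
  defines "J \<equiv> i0 + 16 * int n ^ 8 - 3" and "B \<equiv> 18 * real n ^ 8 + 40"
  defines "z \<equiv> box_chain c (alt w J) J (real n ^ 8)"
  assumes n: "3 \<le> n"
    and upper: "\<not> fpot (alt w J) + 29 / 10 * real n ^ 8 \<le> fpot z"
    and lower: "\<not> lpot i0 J B (alt w J) - 16465 / 10000 * real n ^ 8 \<le> lpot i0 J B z"
  shows "is_leftmost (chain c w (real n ^ 8)) (leftmost z)"
    and "16465 / 10000 * real n ^ 8 - 3 \<le> real_of_int (leftmost z - i0)"
    and "real_of_int (leftmost z - i0) \<le> 29 / 10 * real n ^ 8 + 124 * (real n)\<^sup>2"
proof -
  define y where "y = real n"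
  have y: "3 \<le> y" using n by (simp add: y_def)
  have "1 \<le> int n ^ 8" using n by (intro one_le_power) simp
  then have iJ: "i0 \<le> J" unfolding J_def by linarith
  have rJ: "real_of_int J = real_of_int i0 + 16 * y ^ 8 - 3" by (simp add: J_def y_def)
  note ab = alt_boxed[OF w_leftmost iJ]
  have la: "leftmost (alt w J) = i0" using leftmost_eq[OF ab(2)] .
  have zb: "z \<in> boxed i0 J" unfolding z_def using iJ by (intro box_chain_boxed) simp_all
  have "real_of_int (leftmost z) \<le> fpot z"
    by (rule fpot_bounds(1)[OF zb, of "nat (J + 3 - i0)"]) (use iJ in simp_all)
  moreover have "fpot (alt w J) \<le> real_of_int i0 + 124 * y\<^sup>2"
    using fpot_le[of "alt w J" i0 n] ab(1) la n unfolding J_def y_def by simp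
  ultimately have up: "real_of_int (leftmost z) \<le> real_of_int i0 + 124 * y\<^sup>2 + 29 / 10 * y ^ 8"
    using upper unfolding y_def by linarith
  then show "real_of_int (leftmost z - i0) \<le> 29 / 10 * real n ^ 8 + 124 * (real n)\<^sup>2"
    unfolding y_def by simp
  have "3 ^ 6 \<le> y ^ 6" using y by (intro power_mono) auto
  then have "y\<^sup>2 * 3 ^ 6 \<le> y\<^sup>2 * y ^ 6" by (rule mult_left_mono) simp
  then have "729 * y\<^sup>2 \<le> y ^ 8" by (simp flip: power_add)
  moreover have "3 ^ 8 \<le> y ^ 8" using y by (intro power_mono) auto
  ultimately have "real_of_int (leftmost z) + 9 \<le> real_of_int J" using up rJ by simp
  then have zJ: "leftmost z + 9 \<le> J" by linarith
  then show "is_leftmost (chain c w (real n ^ 8)) (leftmost z)"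
    unfolding z_def by (intro chain_leftmost_box) (use iJ in simp_all)
  have "16 * y ^ 8 - 3 \<ge> 9" using \<open>3 ^ 8 \<le> y ^ 8\<close> by simp
  then have "i0 + 9 \<le> J" using rJ by linarith
  then have "lpot i0 J B (alt w J) \<le> 0" using wval_range[of "alt w J" i0] by (simp add: lpot_def la)
  moreover have "lpot i0 J B z \<ge> - real_of_int (leftmost z - i0) - 3"
    using zJ wval_range[of z "leftmost z"] by (simp add: lpot_def)
  ultimately show "16465 / 10000 * real n ^ 8 - 3 \<le> real_of_int (leftmost z - i0)"
    using lower by linarith
qed

section \<open>From probability estimates to almost sure statements\<close>

context clocks
begin

text \<open>For each n the number K of slots is taken so large that \<eta> and the discretisation
  error are at most 1 / n ^ 2 each; the exceptional probabilities are then summable. The index is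
  shifted by one to avoid n = 0.\<close>

lemma AE_eventually_avoids:
  fixes v :: "nat \<Rightarrow> int \<Rightarrow> bool" and J :: "nat \<Rightarrow> int"
  assumes bound: "\<And>n \<eta>. 1 \<le> n \<Longrightarrow> 0 < \<eta> \<Longrightarrow> \<exists>K0>0. \<forall>K\<ge>K0. expect (1 - exp (- (real n ^ 8 / real K)))
      (concat (replicate K (sorted_list_of_set {leftmost (v n)..J n}))) (\<lambda>z. of_bool (z \<in> A n)) (v n) \<le> C / (real n)\<^sup>2 + \<eta>"
  shows "AE x in M. \<forall>\<^sub>F n in sequentially. box_chain (\<lambda>j t. N j t x) (v n) (J n) (real n ^ 8) \<notin> A n"
proof -
  let ?good = "\<lambda>n E. E \<in> events \<and> prob E \<le> (C + 2) / (real n)\<^sup>2 \<and>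
    (\<forall>x\<in>space M. (\<forall>j. counting_path (\<lambda>t. N j t x)) \<longrightarrow> x \<notin> E \<longrightarrow> box_chain (\<lambda>j t. N j t x) (v n) (J n) (real n ^ 8) \<notin> A n)"
  have "\<exists>E. ?good (Suc n) E" for n
  proof -
    define m where "m = Suc n"
    have m: "1 \<le> m" "0 < 1 / (real m)\<^sup>2" by (simp_all add: m_def)
    obtain K0 where K0: "0 < K0" "\<And>K. K0 \<le> K \<Longrightarrow> expect (1 - exp (- (real m ^ 8 / real K)))
        (concat (replicate K (sorted_list_of_set {leftmost (v m)..J m}))) (\<lambda>z. of_bool (z \<in> A m)) (v m)
        \<le> C / (real m)\<^sup>2 + 1 / (real m)\<^sup>2"
      using bound[OF m] by blast
    define u where "u = 2 * (real (card {leftmost (v m)..J m}))\<^sup>2 * (real m ^ 8)\<^sup>2"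
    obtain K1 :: nat where K1: "u * (real m)\<^sup>2 \<le> real K1" using real_arch_simple by blast
    define K where "K = max K0 K1"
    have K: "0 < K" "K0 \<le> K" "u * (real m)\<^sup>2 \<le> real K" using K0(1) K1 by (auto simp: K_def)
    have "u / real K \<le> 1 / (real m)\<^sup>2" using K(1,3) m by (simp add: field_simps)
    moreover have "C / (real m)\<^sup>2 + 1 / (real m)\<^sup>2 + 1 / (real m)\<^sup>2 = (C + 2) / (real m)\<^sup>2"
      by (simp add: add_divide_distrib)
    moreover have "0 < real m ^ 8" using m by simp
    then obtain E where "E \<in> events" "prob E \<le> expect (1 - exp (- (real m ^ 8 / real K)))
        (concat (replicate K (sorted_list_of_set {leftmost (v m)..J m}))) (\<lambda>z. of_bool (z \<in> A m)) (v m) + u / real K"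
      "\<forall>x\<in>space M. (\<forall>j. counting_path (\<lambda>t. N j t x)) \<longrightarrow> x \<notin> E \<longrightarrow> box_chain (\<lambda>j t. N j t x) (v m) (J m) (real m ^ 8) \<notin> A m"
      using box_chain_tail[OF _ K(1), of "real m ^ 8" "v m" "J m" "A m"] unfolding u_def by blast
    moreover note K0(2)[OF K(2)]
    ultimately have "?good m E" by simp
    then show ?thesis unfolding m_def by blast
  qed
  then obtain E where E: "\<And>n. ?good (Suc n) (E n)" by metis
  have "AE x in M. \<forall>\<^sub>F n in sequentially. x \<in> space M - E n"
  proof (rule borel_cantelli_AE1)
    show "E n \<in> events" for n using E by blast
    show "emeasure M (E n) < \<infinity>" for n by (simp add: less_top[symmetric])
    have "summable (\<lambda>n. (C + 2) * inverse ((real (Suc n))\<^sup>2))"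
      using inverse_power_summable[of 2, where 'a = real] by (intro summable_mult) (subst summable_Suc_iff, simp)
    moreover have "norm (prob (E n)) \<le> (C + 2) * inverse ((real (Suc n))\<^sup>2)" for n
      using E[of n] by (simp add: divide_inverse)
    ultimately show "summable (\<lambda>n. prob (E n))" by (rule summable_comparison_test'[where N = 0])
  qed
  with AE_counting show ?thesis
  proof eventually_elim
    case (elim x)
    have "\<forall>\<^sub>F n in sequentially. box_chain (\<lambda>j t. N j t x) (v (Suc n)) (J (Suc n)) (real (Suc n) ^ 8) \<notin> A (Suc n)"
      using elim(2) by (rule eventually_mono) (use E elim(1) in blast)
    then show ?case by (subst eventually_sequentially_Suc[symmetric])
  qed
qed

text \<open>Slot 1 of length n + 1 is the interval from n + 1 to 2 * (n + 1), which is free of rings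
  with probability exp (- (n + 1)). These probabilities are summable, so almost surely all but
  finitely many of the intervals contain a ring.\<close>

lemma AE_endless: "AE x in M. \<forall>s t. 0 \<le> t \<longrightarrow> (\<exists>u>t. rings (\<lambda>t. N s t x) u)"
proof -
  have "AE x in M. \<forall>t. 0 \<le> t \<longrightarrow> (\<exists>u>t. rings (\<lambda>t. N s t x) u)" for s
  proof -
    let ?S = "\<lambda>n. {x \<in> space M. (0 < inc (real (Suc n)) 1 s x) = False}"
    have meas: "?S n \<in> events" for n by measurable
    have "AE x in M. \<forall>\<^sub>F n in sequentially. x \<in> space M - ?S n"
    proof (rule borel_cantelli_AE1[OF meas])
      show "emeasure M (?S n) < \<infinity>" for n by (simp add: less_top[symmetric])
      have "prob (?S n) = exp (- 1) ^ Suc n" for n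
        using inc_zero_prob[of "real (Suc n)" 1 s False] exp_of_nat_mult[of "Suc n" "- 1 :: real"] by simp
      moreover have "summable (\<lambda>n. exp (- 1 :: real) ^ Suc n)"
        by (subst summable_Suc_iff) (simp add: summable_geometric)
      ultimately show "summable (\<lambda>n. prob (?S n))" by simp
    qed
    with AE_counting show ?thesis
    proof eventually_elim
      case (elim x)
      show ?case
      proof (intro allI impI)
        fix t :: real assume "0 \<le> t"
        obtain n0 where n0: "\<And>n. n0 \<le> n \<Longrightarrow> x \<in> space M - ?S n"
          using elim(2) unfolding eventually_sequentially by blast
        define n where "n = max n0 (nat \<lceil>t\<rceil>)"
        have n: "n0 \<le> n" "t \<le> real (Suc n)" unfolding n_def by linarith+
        have "N s (real (Suc n)) x < N s (2 * real (Suc n)) x"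
          using n0[OF n(1)] by (simp add: inc_def)
        then obtain u where "real (Suc n) < u" "rings (\<lambda>t. N s t x) u"
          using ring_exists[of "\<lambda>t. N s t x" "real (Suc n)" "2 * real (Suc n)"] elim(1) by auto
        then show "\<exists>u>t. rings (\<lambda>t. N s t x) u" using n(2) by (meson le_less_trans)
      qed
    qed
  qed
  then show ?thesis by (simp add: AE_all_countable)
qed

text \<open>The constants are strictly nested, 1.646 < 1.6463 < 1.6465 < 1.647 and 2.88 < 2.9 < 2.91
  < 2.92: one gap each for the deviation at time n ^ 8, the interpolation between these times, and
  the strict inequality for the limits.\<close>

lemma speed_bounds:
  assumes w: "w \<in> configurations"
  shows "AE x in M. ereal (16463 / 10000) \<le> liminf (spd (\<lambda>j t. N j t x) w) \<and>
    limsup (spd (\<lambda>j t. N j t x) w) \<le> ereal (291 / 100)"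
proof -
  obtain i where i: "is_leftmost w i" using w by (auto simp: configurations_def)
  have li: "leftmost w = i" using leftmost_eq[OF i] .
  define J where "J n = i + 16 * int n ^ 8 - 3" for n
  define v where "v n = alt w (J n)" for n
  define B where "B n = 18 * real n ^ 8 + 40" for n
  have iJ: "i \<le> J n" if "1 \<le> n" for n
  proof -
    have "1 \<le> int n ^ 8" using that by (intro one_le_power) simp
    then show ?thesis unfolding J_def by linarith
  qed
  note ab = alt_boxed[OF i iJ, folded v_def]
  have lv: "leftmost (v n) = i" if "1 \<le> n" for n using leftmost_eq[OF ab(2)[OF that]] .
  have up: "AE x in M. \<forall>\<^sub>F n in sequentially. box_chain (\<lambda>j t. N j t x) (v n) (J n) (real n ^ 8)
      \<notin> {z. fpot (v n) + 29 / 10 * real n ^ 8 \<le> fpot z}"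
  proof (rule AE_eventually_avoids)
    fix n :: nat and \<eta> :: real assume n: "1 \<le> n" "0 < \<eta>"
    show "\<exists>K0>0. \<forall>K\<ge>K0. expect (1 - exp (- (real n ^ 8 / real K)))
      (concat (replicate K (sorted_list_of_set {leftmost (v n)..J n})))
      (\<lambda>z. of_bool (z \<in> {z. fpot (v n) + 29 / 10 * real n ^ 8 \<le> fpot z})) (v n) \<le> 3 * 10 ^ 12 / (real n)\<^sup>2 + \<eta>"
      unfolding mem_Collect_eq lv[OF n(1)] by (rule upper_expect[OF ab(1)[OF n(1)] n(1) J_def n(2)])
  qed
  have low: "AE x in M. \<forall>\<^sub>F n in sequentially. box_chain (\<lambda>j t. N j t x) (v n) (J n) (real n ^ 8)
      \<notin> {z. lpot i (J n) (B n) (v n) - 16465 / 10000 * real n ^ 8 \<le> lpot i (J n) (B n) z}"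
  proof (rule AE_eventually_avoids)
    fix n :: nat and \<eta> :: real assume n: "1 \<le> n" "0 < \<eta>"
    show "\<exists>K0>0. \<forall>K\<ge>K0. expect (1 - exp (- (real n ^ 8 / real K)))
      (concat (replicate K (sorted_list_of_set {leftmost (v n)..J n})))
      (\<lambda>z. of_bool (z \<in> {z. lpot i (J n) (B n) (v n) - 16465 / 10000 * real n ^ 8 \<le> lpot i (J n) (B n) z})) (v n)
      \<le> 3 * 10 ^ 12 / (real n)\<^sup>2 + \<eta>"
      unfolding mem_Collect_eq lv[OF n(1)] B_def
      by (rule lower_expect[OF ab(1)[OF n(1)] lv[OF n(1)] n(1) J_def n(2)])
  qed
  from AE_counting AE_no_simultaneous AE_endless up low show ?thesis
  proof eventually_elim
    case (elim x)
    let ?c = "\<lambda>j t. N j t x"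
    interpret ring_path ?c w by (rule ring_path.intro) (use elim(1) w in auto)
    have i0: "i0 = i" unfolding i0_def by (rule li)
    let ?l = "\<lambda>n. leftmost (box_chain ?c (v n) (J n) (real n ^ 8))"
    have ev: "\<forall>\<^sub>F n in sequentially. is_leftmost (chain ?c w (real n ^ 8)) (?l n) \<and>
        16465 / 10000 * real n ^ 8 - 3 \<le> real_of_int (?l n - i0) \<and>
        real_of_int (?l n - i0) \<le> 29 / 10 * real n ^ 8 + 124 * (real n)\<^sup>2"
      using elim(4,5) eventually_ge_at_top[of 3]
    proof eventually_elim
      case (elim n)
      then show ?case
        using leftmost_between[of n] unfolding i0 v_def J_def B_def mem_Collect_eq by blast
    qed
    have "good_path ?c w"
    proof (intro good_path.intro good_path_axioms.intro)
      show "ring_path ?c w" by unfold_locales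
      show "\<exists>t'\<ge>t. \<exists>p. is_leftmost (chain ?c w t') p" if "0 \<le> t" for t :: real
      proof -
        obtain m where m: "\<And>n. m \<le> n \<Longrightarrow> is_leftmost (chain ?c w (real n ^ 8)) (?l n)"
          using ev unfolding eventually_sequentially by blast
        define n where "n = max m (max 1 (nat \<lceil>t\<rceil>))"
        have n: "m \<le> n" "1 \<le> real n" "t \<le> real n" unfolding n_def by linarith+
        have "real n ^ 1 \<le> real n ^ 8" using n(2) by (intro power_increasing) auto
        then have "t \<le> real n ^ 8" using n(3) unfolding power_one_right by linarith
        then show ?thesis using m[OF n(1)] by blast
      qed
      show "\<not> (rings (\<lambda>t. N s t x) t \<and> rings (\<lambda>t. N s' t x) t)" if "s \<noteq> s'" for s s' t
        using elim(2)[rule_format, OF that] .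
      show "\<exists>u>t. rings (\<lambda>t. N s t x) u" if "0 \<le> t" for s t
        using elim(3)[rule_format, OF that] .
    qed
    then interpret good_path ?c w .
    have "\<forall>\<^sub>F n in sequentially. \<forall>p. is_leftmost (chain ?c w (real n ^ 8)) p \<longrightarrow>
        16465 / 10000 * real n ^ 8 - 3 \<le> real_of_int (p - i0) \<and>
        real_of_int (p - i0) \<le> 29 / 10 * real n ^ 8 + 124 * (real n)\<^sup>2"
      using ev
    proof eventually_elim
      case (elim n)
      show ?case
      proof (intro allI impI)
        fix p assume "is_leftmost (chain ?c w (real n ^ 8)) p"
        then have "p = ?l n" using conjunct1[OF elim] by (rule is_leftmost_unique)
        then show "16465 / 10000 * real n ^ 8 - 3 \<le> real_of_int (p - i0) \<and>
            real_of_int (p - i0) \<le> 29 / 10 * real n ^ 8 + 124 * (real n)\<^sup>2"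
          using conjunct2[OF elim] by (simp only:)
      qed
    qed
    then have lo: "\<forall>\<^sub>F n in sequentially. \<forall>p. is_leftmost (chain ?c w (real n ^ 8)) p \<longrightarrow> 16465 / 10000 * real n ^ 8 - 3 \<le> real_of_int (p - i0)"
      and hi: "\<forall>\<^sub>F n in sequentially. \<forall>p. is_leftmost (chain ?c w (real n ^ 8)) p \<longrightarrow> real_of_int (p - i0) \<le> 29 / 10 * real n ^ 8 + 124 * (real n)\<^sup>2"
      by (rule eventually_mono, blast)+
    show ?case using spd_bounds[OF lo hi, where a' = "16463 / 10000" and b' = "291 / 100"] by simp
  qed
qed

end

theorem theorem2:
  fixes M :: "'a measure" and N :: "int \<Rightarrow> real \<Rightarrow> 'a \<Rightarrow> nat" and w :: "int \<Rightarrow> bool"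
  assumes "prob_space M"
    and "independent_clocks M N"
    and "w \<in> configurations"
  shows "AE x in M.
    ereal 1.646 < liminf (spd (\<lambda>j t. N j t x) w) \<and>
    liminf (spd (\<lambda>j t. N j t x) w) \<le> limsup (spd (\<lambda>j t. N j t x) w) \<and>
    limsup (spd (\<lambda>j t. N j t x) w) < ereal 2.92"
proof -
  interpret clocks M N using assms(1,2) by (simp add: clocks_def clocks_axioms_def)
  from speed_bounds[OF assms(3)] show ?thesis
  proof eventually_elim
    case (elim x)
    have "ereal 1.646 < ereal (16463 / 10000)" "ereal (291 / 100) < ereal 2.92" by simp_all
    moreover have "liminf (spd (\<lambda>j t. N j t x) w) \<le> limsup (spd (\<lambda>j t. N j t x) w)"
      by (rule Liminf_le_Limsup) simp
    ultimately show ?case using elim by (meson le_less_trans less_le_trans)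
  qed
qed

end
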